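(* Let $\mu_t\in M_t$, $t=0,\dots,T$, be probability measures, $\mu=\prod_{t=0}^T\mu_t$, and let $c:S\to\mathbb R$ be lower semicontinuous and $\mu$-integrable with $c\ge K\psi$ for some $K\in\mathbb R$. Consider \[ \text{(A)}\quad\text{minimize}\quad\int_Sc\,d\lambda\quad\text{over }\lambda\in M_+\quad\text{subject to}\quad\lambda_t=\mu_t,\ t=0,\dots,T, \] \[ \text{(B)}\quad\text{minimize}\quad\int_S\sum_{t=0}^Tx_t\,d\mu\quad\text{over }x\in\Phi . \] Then the optima in (A) and (B) are attained, there is no duality gap (i.e. $\inf(\mathrm B)=-\inf(\mathrm A)$), and feasible solutions $\lambda$ of (A) and $x$ of (B) are optimal if and only if \[ \int_S\Big(c+\sum_{t=0}^Tx_t\Big)d\lambda=0 . \] Moreover, if $x$ is feasible in (B), then $x_t\in\mathcal L^1_t$ for each $t$, so the objective of (B) can be written as \[ \int_S\sum_{t=0}^Tx_t\,d\mu=\sum_{t=0}^T\int_{S_t}x_t\,d\mu_t . \]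
   Context: $S_0,\dots,S_T$ are Polish spaces, $S=S_0\times\cdots\times S_T$, $\psi_t:S_t\to[1,\infty)$ are given continuous functions, $\psi(s)=\sum_{t=0}^T\psi_t(s_t)$. $M_t$ (resp. $M$) is the space of finite signed Borel measures on $S_t$ (resp. $S$) under which $\psi_t$ (resp. $\psi$) is integrable, and $M_+$ is the set of nonnegative elements of $M$. $\lambda_t$ is the $t$-th marginal of $\lambda$. $\mathcal L^0_t$ (resp. $\mathcal L^1_t$) is the space of real Borel measurable (resp. $\mu_t$-integrable) functions on $S_t$; $x_t$ is identified with $s\mapsto x_t(s_t)$ on $S$; and \[ \Phi=\Big\{x\in\prod_{t=0}^T\mathcal L^0_t\ \Big|\ -\sum_{t=0}^Tx_t\le c\quad(\mu_t)_{t=0}^T\text{-a.e.}\Big\}, \] where "$(\mu_t)_{t=0}^T$-a.e." means that the inequality holds on a set $\prod_{t=0}^TA_t$ with $A_t\in\mathcal B(S_t)$, $\mu_t(A_t)=1$. Integrals of functions are $+\infty$ unless the positive part is integrable. "Feasible" means satisfying the constraints with objective value less than $+\infty$. *)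

theory Defs
  imports "HOL-Probability.Probability"
begin

definition Polish_space :: "'a topology \<Rightarrow> bool" where
  "Polish_space X \<longleftrightarrow> separable_space X \<and> completely_metrizable_space X"

definition borel_of :: "'a topology \<Rightarrow> 'a measure" where
  "borel_of X = sigma (topspace X) {U. openin X U}"

definition lower_semicontinuous_map :: "'a topology \<Rightarrow> ('a \<Rightarrow> real) \<Rightarrow> bool" where
  "lower_semicontinuous_map X f \<longleftrightarrow> (\<forall>a. openin X {s \<in> topspace X. a < f s})"

text \<open>Extended-real valued integral: it is \<open>\<infinity>\<close> unless the positive part of
  \<open>f\<close> is integrable, and it may be \<open>-\<infinity>\<close>.  In the first branch the minuend is finite, so the
  subtraction in \<^typ>\<open>ereal\<close> is unambiguous.\<close>

definition ext_integral :: "'a measure \<Rightarrow> ('a \<Rightarrow> real) \<Rightarrow> ereal" where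
  "ext_integral M f =
     (if integrable M (\<lambda>s. max 0 (f s))
      then ereal (\<integral>s. max 0 (f s) \<partial>M) - enn2ereal (\<integral>\<^sup>+s. ennreal (- f s) \<partial>M)
      else \<infinity>)"

text \<open>The nonnegative elements of the space of finite signed Borel measures on \<open>X\<close> that
  integrate the weight \<open>w\<close>.\<close>

definition weighted_measures :: "'a topology \<Rightarrow> ('a \<Rightarrow> real) \<Rightarrow> 'a measure set" where
  "weighted_measures X w =
     {\<nu>. sets \<nu> = sets (borel_of X) \<and> finite_measure \<nu> \<and> integrable \<nu> w}"

text \<open>The spaces \<open>S 0, \<dots>, S T\<close> are topologies whose underlying sets are arbitrary subsets of one
  ambient type; points of their product are extensional functions on \<open>{..T}\<close>.\<close>

abbreviation prod_space :: "nat \<Rightarrow> (nat \<Rightarrow> 'a topology) \<Rightarrow> (nat \<Rightarrow> 'a) topology" where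
  "prod_space T S \<equiv> product_topology S {..T}"

definition separable_sum :: "nat \<Rightarrow> (nat \<Rightarrow> 'a \<Rightarrow> real) \<Rightarrow> (nat \<Rightarrow> 'a) \<Rightarrow> real" where
  "separable_sum T f s = (\<Sum>t\<le>T. f t (s t))"

definition marginal :: "(nat \<Rightarrow> 'a topology) \<Rightarrow> (nat \<Rightarrow> 'a) measure \<Rightarrow> nat \<Rightarrow> 'a measure" where
  "marginal S \<nu> t = distr \<nu> (borel_of (S t)) (\<lambda>s. s t)"

definition transport_plans ::
    "nat \<Rightarrow> (nat \<Rightarrow> 'a topology) \<Rightarrow> (nat \<Rightarrow> 'a \<Rightarrow> real) \<Rightarrow> (nat \<Rightarrow> 'a measure)
      \<Rightarrow> (nat \<Rightarrow> 'a) measure set" where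
  "transport_plans T S \<psi> \<mu> =
     {\<nu> \<in> weighted_measures (prod_space T S) (separable_sum T \<psi>).
        \<forall>t\<le>T. marginal S \<nu> t = \<mu> t}"

text \<open>The exceptional set in the constraint is the complement of a product of sets of full measure;
  this is more restrictive than being a null set of the product measure.\<close>

definition dual_potentials ::
    "nat \<Rightarrow> (nat \<Rightarrow> 'a topology) \<Rightarrow> (nat \<Rightarrow> 'a measure) \<Rightarrow> ((nat \<Rightarrow> 'a) \<Rightarrow> real)
      \<Rightarrow> (nat \<Rightarrow> 'a \<Rightarrow> real) set" where
  "dual_potentials T S \<mu> c =
     {x. (\<forall>t\<le>T. x t \<in> borel_measurable (borel_of (S t))) \<and>
         (\<exists>A. (\<forall>t\<le>T. A t \<in> sets (borel_of (S t)) \<and> measure (\<mu> t) (A t) = 1) \<and>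
              (\<forall>s \<in> (\<Pi>\<^sub>E t\<in>{..T}. A t). - separable_sum T x s \<le> c s))}"

definition primal_cost :: "((nat \<Rightarrow> 'a) \<Rightarrow> real) \<Rightarrow> (nat \<Rightarrow> 'a) measure \<Rightarrow> ereal" where
  "primal_cost c \<nu> = ext_integral \<nu> c"

definition dual_cost :: "nat \<Rightarrow> (nat \<Rightarrow> 'a measure) \<Rightarrow> (nat \<Rightarrow> 'a \<Rightarrow> real) \<Rightarrow> ereal" where
  "dual_cost T \<mu> x = ext_integral (Pi\<^sub>M {..T} \<mu>) (separable_sum T x)"

definition feasible :: "('b \<Rightarrow> ereal) \<Rightarrow> 'b set \<Rightarrow> 'b \<Rightarrow> bool" where
  "feasible f C z \<longleftrightarrow> z \<in> C \<and> f z < \<infinity>"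

definition optimal :: "('b \<Rightarrow> ereal) \<Rightarrow> 'b set \<Rightarrow> 'b \<Rightarrow> bool" where
  "optimal f C z \<longleftrightarrow> is_arg_min f (\<lambda>y. y \<in> C) z"

end

theory Submission
  imports Defs
begin

text \<open>
  Fix the dual value \<open>q\<close>, the supremum of \<open>- \<Sum>\<^sub>t \<integral> x\<^sub>t d\<mu>\<^sub>t\<close>, and price a bounded function \<open>f\<close> on the
  product by the infimum of \<open>\<Sum>\<^sub>t \<integral> x\<^sub>t d\<mu>\<^sub>t + a q\<close> over all dominations \<open>f \<le> \<Sum>\<^sub>t x\<^sub>t + a c\<close> with
  \<open>a \<ge> 0\<close>.  This price is sublinear, and by Hahn-Banach a linear functional \<open>L\<close> lies below it.  On
  indicators, \<open>L\<close> is a finitely additive set function with marginals \<open>\<mu>\<^sub>t\<close>; since these are tight,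
  it is inner regular on measurable rectangles, hence countably additive there, and extends to
  a plan \<open>\<nu>\<close>.  The nonnegative lower semicontinuous function \<open>c - K \<psi>\<close> is an increasing limit of step
  functions on open rectangles, so \<open>\<integral> c d\<nu> \<le> q\<close>: the plan is optimal and there is no gap.

  For the dual, recentring makes near-optimal potentials bounded in \<open>L\<^sup>1(\<mu>\<^sub>t)\<close>.  Split into positive
  and negative parts they form decreasing sets closed under midpoints, and nearly minimizing
  the strictly convex functional \<open>g \<mapsto> \<Sum>\<^sub>j \<integral> exp (- g\<^sub>j)\<close> on them selects an almost everywhere
  convergent sequence, whose limit is optimal by Fatou's lemma.
\<close>

section \<open>Sublinear functionals\<close>

text \<open>The functional acts on bounded functions, where neither topology nor measurability
  intervenes; the cost, which may be unbounded, enters only through the term \<open>a * c s\<close>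
  of a domination. A domination with \<open>a > 0\<close>, divided by \<open>a\<close>, yields a
  potential, so it is the definition of the dual value that keeps the price finite. What is lost is
  countable additivity of \<open>L\<close>. It is recovered from the marginals alone: a set whose
  indicator lies below a separable function has content at most the sum of the marginal integrals,
  however badly \<open>L\<close> behaves elsewhere. On the dual side a bound in the mean does not by
  itself give a weakly convergent subsequence, and convergence almost everywhere for the product
  measure would be too weak: the constraint must hold on a product of full sets, so convergence is
  needed in each coordinate separately. The arguments of the convex functional must be nonnegative
  for \<open>exp (- g)\<close> to be bounded, which is why potentials are split. Fatou's lemma is
  applied to \<open>c + \<Sum> x\<close>, which the constraint makes nonnegative; single components
  need not have a common lower bound.\<close>

definition sublinear :: "('v::real_vector \<Rightarrow> real) \<Rightarrow> bool" where
  "sublinear p \<longleftrightarrow> (\<forall>x y. p (x + y) \<le> p x + p y) \<and> (\<forall>a x. 0 \<le> a \<longrightarrow> p (a *\<^sub>R x) = a * p x)"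

lemma sublinear_zero: "sublinear p \<Longrightarrow> p 0 = 0"
  unfolding sublinear_def by (metis mult_zero_left order_refl scaleR_zero_left)

lemma sublinear_uminus_ge:
  assumes "sublinear p" shows "- p (- x) \<le> p x"
proof -
  have "p (x + - x) \<le> p x + p (- x)" using assms unfolding sublinear_def by blast
  then show ?thesis using sublinear_zero[OF assms] by simp
qed

text \<open>Zorn's lemma for the reversed pointwise order. The infimum of a chain stays finite
  because every \<open>r \<le> p\<close> satisfies
  \<open>- p (- x) \<le> - r (- x) \<le> r x\<close>, and it stays subadditive because any two
  members of a chain have the smaller one below both.\<close>

lemma sublinear_minimal_exists:
  fixes p :: "'v::real_vector \<Rightarrow> real"
  assumes p: "sublinear p"
  obtains m where "sublinear m" "m \<le> p" "\<And>r. sublinear r \<Longrightarrow> r \<le> m \<Longrightarrow> r = m"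
proof -
  define A where "A = {r. sublinear r \<and> r \<le> p}"
  define P where "P = (\<lambda>r s :: 'v \<Rightarrow> real. s \<le> r)"
  have "\<exists>m\<in>A. \<forall>a\<in>A. P m a \<longrightarrow> a = m"
  proof (rule predicate_Zorn)
    show "partial_order_on A (relation_of P A)"
      by (rule partial_order_on_relation_ofI) (auto simp: P_def)
  next
    fix C assume C: "C \<in> Chains (relation_of P A)"
    then have CA: "C \<subseteq> A" and lin: "\<And>r s. r \<in> C \<Longrightarrow> s \<in> C \<Longrightarrow> r \<le> s \<or> s \<le> r"
      unfolding Chains_def relation_of_def P_def by auto
    show "\<exists>u\<in>A. \<forall>a\<in>C. P a u"
    proof (cases "C = {}")
      case True then show ?thesis using p by (auto simp: A_def)
    next
      case False
      define u where "u = (\<lambda>x. INF r\<in>C. r x)"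
      have bdd: "bdd_below ((\<lambda>r. r x) ` C)" for x
      proof (rule bdd_belowI2[where m = "- p (- x)"])
        fix r assume "r \<in> C"
        then have "sublinear r" "r \<le> p" using CA by (auto simp: A_def)
        then show "- p (- x) \<le> r x"
          using sublinear_uminus_ge[of r x] le_funD[of r p "- x"] by linarith
      qed
      have u_le: "u x \<le> r x" if "r \<in> C" for r x
        unfolding u_def by (rule cINF_lower[OF bdd that])
      have u_ge: "a \<le> u x" if "\<And>r. r \<in> C \<Longrightarrow> a \<le> r x" for a x
        unfolding u_def by (rule cINF_greatest[OF False that])
      have "sublinear u"
        unfolding sublinear_def
      proof (intro conjI allI impI)
        fix x y
        have *: "u (x + y) \<le> r x + s y" if "r \<in> C" "s \<in> C" for r s
        proof -
          obtain t where t: "t \<in> C" "t \<le> r" "t \<le> s" using lin \<open>r \<in> C\<close> \<open>s \<in> C\<close> by blast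
          then have "t (x + y) \<le> t x + t y" using CA by (auto simp: A_def sublinear_def)
          then show ?thesis using u_le[OF t(1), of "x + y"] t(2,3)[THEN le_funD] 
            by (smt (verit))
        qed
        have "u (x + y) - s y \<le> u x" if "s \<in> C" for s
          by (rule u_ge) (use * that in force)
        then have "u (x + y) - u x \<le> u y"
          by (intro u_ge) force
        then show "u (x + y) \<le> u x + u y" by simp
      next
        fix a :: real and x assume a: "0 \<le> a"
        have h: "r (a *\<^sub>R x) = a * r x" if "r \<in> C" for r
          using that CA a by (auto simp: A_def sublinear_def)
        show "u (a *\<^sub>R x) = a * u x"
        proof (rule antisym)
          show "a * u x \<le> u (a *\<^sub>R x)"
            by (rule u_ge) (simp add: h u_le mult_left_mono a)
          show "u (a *\<^sub>R x) \<le> a * u x"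
          proof (cases "a = 0")
            case True
            obtain r where "r \<in> C" using False by blast
            then show ?thesis using u_le[of r "a *\<^sub>R x"] h[of r] True by simp
          next
            case False
            then have "0 < a" using a by simp
            have "u (a *\<^sub>R x) / a \<le> u x"
              by (rule u_ge)
                (use u_le[of _ "a *\<^sub>R x"] h \<open>0 < a\<close> in \<open>force simp: field_simps\<close>)
            then show ?thesis using \<open>0 < a\<close> by (simp add: field_simps)
          qed
        qed
      qed
      moreover have "u \<le> p"
      proof -
        obtain r where "r \<in> C" using False by blast
        then show ?thesis using u_le[of r] CA by (auto simp: A_def le_fun_def intro: order_trans)
      qed
      ultimately show ?thesis using u_le by (intro bexI[of _ u]) (auto simp: A_def P_def le_fun_def)
    qed
  qed
  then obtain m where m: "m \<in> A" "\<And>a. a \<in> A \<Longrightarrow> a \<le> m \<Longrightarrow> a = m" unfolding P_def by blast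
  show thesis
    by (rule that[of m]) (use m in \<open>auto simp: A_def intro: order_trans\<close>)
qed

text \<open>Hahn-Banach without extending from subspaces: a minimal sublinear functional is already
  linear. Minimality is played against one competitor for each direction \<open>y\<close>.\<close>

theorem sublinear_dominates_linear:
  fixes p :: "'v::real_vector \<Rightarrow> real"
  assumes p: "sublinear p"
  obtains L where "linear L" "\<And>x. L x \<le> p x"
proof -
  obtain m where m: "sublinear m" "m \<le> p" and min: "\<And>r. sublinear r \<Longrightarrow> r \<le> m \<Longrightarrow> r = m"
    using sublinear_minimal_exists[OF p] by blast
  have sub: "m (x + y) \<le> m x + m y" and hom: "0 \<le> a \<Longrightarrow> m (a *\<^sub>R x) = a * m x" for x y a
    using m(1) by (auto simp: sublinear_def)
  have super: "m x + m y \<le> m (x + y)" for x y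
  proof -
    \<comment> \<open>The competitor is again sublinear and lies below \<open>m\<close> by
      \<open>t = 0\<close>. Minimality forces equality, and \<open>t = 1\<close> then reads
      \<open>m x + m y \<le> m (x + y)\<close>.\<close>
    define r where "r = (\<lambda>x. INF t\<in>{0..}. m (x + t *\<^sub>R y) - t * m y)"
    have bdd: "bdd_below ((\<lambda>t. m (x + t *\<^sub>R y) - t * m y) ` {0..})" for x
    proof (rule bdd_belowI2[where m = "- m (- x)"])
      fix t :: real assume "t \<in> {0..}"
      then have "t * m y \<le> m (x + t *\<^sub>R y) + m (- x)"
        using sub[of "x + t *\<^sub>R y" "- x"] hom[of t y] by simp
      then show "- m (- x) \<le> m (x + t *\<^sub>R y) - t * m y" by simp
    qed
    have r_le: "r x \<le> m (x + t *\<^sub>R y) - t * m y" if "0 \<le> t" for t x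
      unfolding r_def by (rule cINF_lower[OF bdd]) (use that in auto)
    have r_ge: "a \<le> r x" if "\<And>t. 0 \<le> t \<Longrightarrow> a \<le> m (x + t *\<^sub>R y) - t * m y" for a x
      unfolding r_def by (rule cINF_greatest) (use that in auto)
    have "sublinear r"
      unfolding sublinear_def
    proof (intro conjI allI impI)
      fix x z
      have *: "r (x + z) \<le> (m (x + t *\<^sub>R y) - t * m y) + (m (z + s *\<^sub>R y) - s * m y)"
        if "0 \<le> t" "0 \<le> s" for t s
      proof -
        have "r (x + z) \<le> m ((x + z) + (t + s) *\<^sub>R y) - (t + s) * m y"
          by (rule r_le) (use that in auto)
        also have "(x + z) + (t + s) *\<^sub>R y = (x + t *\<^sub>R y) + (z + s *\<^sub>R y)"
          by (simp add: algebra_simps)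
        also have "m \<dots> \<le> m (x + t *\<^sub>R y) + m (z + s *\<^sub>R y)" by (rule sub)
        finally show ?thesis by (simp add: algebra_simps)
      qed
      have "r (x + z) - (m (z + s *\<^sub>R y) - s * m y) \<le> r x" if "0 \<le> s" for s
        by (rule r_ge) (use * that in force)
      then have "r (x + z) - r x \<le> r z"
        by (intro r_ge) force
      then show "r (x + z) \<le> r x + r z" by simp
    next
      have le: "r (a *\<^sub>R x) \<le> a * r x" if "0 < a" for a x
      proof -
        have "r (a *\<^sub>R x) / a \<le> r x"
        proof (rule r_ge)
          fix t :: real assume "0 \<le> t"
          have "r (a *\<^sub>R x) \<le> m (a *\<^sub>R x + (a * t) *\<^sub>R y) - (a * t) * m y"
            by (rule r_le) (use that \<open>0 \<le> t\<close> in auto)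
          also have "a *\<^sub>R x + (a * t) *\<^sub>R y = a *\<^sub>R (x + t *\<^sub>R y)" by (simp add: algebra_simps)
          also have "m \<dots> - (a * t) * m y = a * (m (x + t *\<^sub>R y) - t * m y)"
            using hom[of a "x + t *\<^sub>R y"] that by (simp add: right_diff_distrib)
          finally show "r (a *\<^sub>R x) / a \<le> m (x + t *\<^sub>R y) - t * m y"
            using that by (simp add: field_simps)
        qed
        then show ?thesis using that by (simp add: field_simps)
      qed
      fix a :: real and x assume a: "0 \<le> a"
      show "r (a *\<^sub>R x) = a * r x"
      proof (cases "a = 0")
        case True
        have "0 \<le> r 0" by (rule r_ge) (use hom in auto)
        moreover have "r 0 \<le> 0" using r_le[of 0 0] sublinear_zero[OF m(1)] by simp
        ultimately show ?thesis using True by simp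
      next
        case False
        then have "0 < a" using a by simp
        \<comment> \<open>Only one inequality was shown for positive scalars; applied to the scalar
          \<open>1 / a\<close> it gives the other.\<close>
        have "r x = r ((1 / a) *\<^sub>R (a *\<^sub>R x))" using False by simp
        also have "\<dots> \<le> (1 / a) * r (a *\<^sub>R x)" by (rule le) (use \<open>0 < a\<close> in simp)
        finally have "a * r x \<le> r (a *\<^sub>R x)" using \<open>0 < a\<close> by (simp add: field_simps)
        then show ?thesis using le[OF \<open>0 < a\<close>, of x] by simp
      qed
    qed
    moreover have "r \<le> m" using r_le[of 0] by (auto simp: le_fun_def)
    ultimately have "r = m" by (rule min)
    then show ?thesis using r_le[of 1 x] by simp
  qed
  have add: "m (x + y) = m x + m y" for x y
    using sub super by (rule antisym)
  have neg: "m (- x) = - m x" for x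
    using add[of x "- x"] sublinear_zero[OF m(1)] by simp
  have "linear m"
  proof (rule linearI)
    fix a x
    show "m (a *\<^sub>R x) = a *\<^sub>R m x"
    proof (cases "0 \<le> a")
      case True then show ?thesis by (simp add: hom)
    next
      case False
      then have "m ((- a) *\<^sub>R x) = (- a) * m x" by (intro hom) simp
      then show ?thesis using neg[of "a *\<^sub>R x"] by simp
    qed
  qed (rule add)
  then show thesis using m(2) that by (auto simp: le_fun_def)
qed

section \<open>Borel measures on Polish spaces\<close>

lemma space_borel_of [simp]: "space (borel_of X) = topspace X"
  unfolding borel_of_def by (rule space_measure_of) (use openin_subset in blast)

lemma sets_borel_of: "sets (borel_of X) = sigma_sets (topspace X) {U. openin X U}"
  unfolding borel_of_def by (rule sets_measure_of) (use openin_subset in blast)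

lemma openin_sets_borel_of: "openin X U \<Longrightarrow> U \<in> sets (borel_of X)"
  by (simp add: sets_borel_of sigma_sets.Basic)

lemma closedin_sets_borel_of: "closedin X C \<Longrightarrow> C \<in> sets (borel_of X)"
  using sets.compl_sets[OF openin_sets_borel_of, of X "topspace X - C"]
  by (simp add: closedin_def Diff_Diff_Int inf.absorb2)

lemma continuous_map_measurable_borel_of:
  assumes "continuous_map X Y f" shows "f \<in> measurable (borel_of X) (borel_of Y)"
  unfolding borel_of_def[of Y]
proof (rule measurable_measure_of)
  show "{U. openin Y U} \<subseteq> Pow (topspace Y)" using openin_subset by blast
  show "f \<in> space (borel_of X) \<rightarrow> topspace Y" using assms by (auto simp: continuous_map_def)
  fix U assume "U \<in> {U. openin Y U}"
  then have "openin X {x \<in> topspace X. f x \<in> U}" using assms by (auto simp: continuous_map_def)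
  then show "f -` U \<inter> space (borel_of X) \<in> sets (borel_of X)"
    using openin_sets_borel_of by (simp add: vimage_def Int_def conj_commute)
qed

lemma continuous_map_borel_measurable:
  assumes "continuous_map X euclideanreal f" shows "f \<in> borel_measurable (borel_of X)"
proof -
  have "sets (borel_of euclideanreal) = sets (borel :: real measure)"
    by (simp add: sets_borel_of borel_def sets_measure_of)
  then show ?thesis
    using continuous_map_measurable_borel_of[OF assms] measurable_cong_sets by blast
qed

lemma lower_semicontinuous_borel_measurable:
  "lower_semicontinuous_map X f \<Longrightarrow> f \<in> borel_measurable (borel_of X)"
  by (auto simp: borel_measurable_iff_greater lower_semicontinuous_map_def
      intro: openin_sets_borel_of)

text \<open>Approximating a set and its complement at once makes the property symmetric. The gaps
  \<open>e / 2 * (1/2) ^ Suc n\<close> add up to \<open>e / 2\<close>. The union of the inner sets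
  need not be closed and is cut at a finite index, which costs the other half; the intersection of
  the outer sets is closed without cutting.\<close>

lemma closed_approximation_Union:
  fixes A :: "nat \<Rightarrow> 'a set"
  assumes M: "finite_measure M" "sets M = sets (borel_of X)" and e: "0 < e"
    and A: "\<And>n. \<And>e. 0 < e \<Longrightarrow> \<exists>C C'. closedin X C \<and> closedin X C' \<and> C \<subseteq> A n \<and> C' \<inter> A n = {} \<and>
      measure M (topspace X - (C \<union> C')) < e"
  shows "\<exists>C C'. closedin X C \<and> closedin X C' \<and> C \<subseteq> (\<Union>n. A n) \<and> C' \<inter> (\<Union>n. A n) = {} \<and>
      measure M (topspace X - (C \<union> C')) < e"
proof -
  interpret finite_measure M by fact
  have sp: "space M = topspace X" using sets_eq_imp_space_eq[OF M(2)] by simp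
  have cl: "closedin X C \<Longrightarrow> C \<in> sets M" for C using closedin_sets_borel_of M(2) by blast
  have "\<forall>n. \<exists>C C'. closedin X C \<and> closedin X C' \<and> C \<subseteq> A n \<and> C' \<inter> A n = {} \<and>
      measure M (topspace X - (C \<union> C')) < e / 2 * (1/2) ^ Suc n"
    by (intro allI A) (use e in simp)
  then obtain C C' where C: "\<And>n. closedin X (C n)" "\<And>n. closedin X (C' n)" "\<And>n. C n \<subseteq> A n"
      "\<And>n. C' n \<inter> A n = {}" "\<And>n. measure M (topspace X - (C n \<union> C' n)) < e / 2 * (1/2) ^ Suc n"
    by metis
  define V where "V = (\<lambda>n. topspace X - (C n \<union> C' n))"
  define U where "U = (\<lambda>N. \<Union>n<N. C n)"
  have V: "V n \<in> sets M" for n using cl C sp unfolding V_def by (metis sets.Diff sets.Un sets.top)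
  have U: "U n \<in> sets M" for n using cl C unfolding U_def by blast
  have "(\<lambda>n. e / 2 * (1/2) ^ Suc n) sums (e / 2 * 1)"
    by (intro sums_mult power_half_series)
  then have s: "(\<lambda>n. e / 2 * (1/2) ^ Suc n) sums (e / 2)" by simp
  have sV: "summable (\<lambda>n. measure M (V n))"
    by (rule summable_comparison_test'[OF sums_summable[OF s], of 0])
      (use C(5) in \<open>simp add: V_def less_imp_le\<close>)
  have "measure M (\<Union>n. V n) \<le> (\<Sum>n. measure M (V n))"
    by (rule finite_measure_subadditive_countably) (use V sV in auto)
  also have "\<dots> \<le> (\<Sum>n. e / 2 * (1/2) ^ Suc n)"
    by (rule suminf_le[OF _ sV sums_summable[OF s]]) (use C(5) in \<open>simp add: V_def less_imp_le\<close>)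
  also have "\<dots> = e / 2" using s by (simp add: sums_iff)
  finally have mV: "measure M (\<Union>n. V n) \<le> e / 2" .
  have "(\<lambda>n. measure M (U n)) \<longlonglongrightarrow> measure M (\<Union>n. U n)"
    by (rule finite_Lim_measure_incseq) (use U in \<open>force simp: incseq_def U_def\<close>)+
  then have "eventually (\<lambda>n. measure M (\<Union>n. U n) - e / 2 < measure M (U n)) sequentially"
    by (rule order_tendstoD(1)) (use e in simp)
  then obtain N where N: "measure M (\<Union>n. U n) - e / 2 < measure M (U N)"
    by (auto simp: eventually_sequentially)
  have mU: "measure M ((\<Union>n. U n) - U N) < e / 2"
    using N U by (subst finite_measure_Diff) auto
  have "measure M (topspace X - (U N \<union> (\<Inter>n. C' n))) \<le> measure M ((\<Union>n. V n) \<union> ((\<Union>n. U n) - U N))"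
  proof (rule finite_measure_mono)
    show "topspace X - (U N \<union> (\<Inter>n. C' n)) \<subseteq> (\<Union>n. V n) \<union> ((\<Union>n. U n) - U N)"
      by (auto simp: V_def U_def)
  qed (use V U in auto)
  also have "\<dots> \<le> measure M (\<Union>n. V n) + measure M ((\<Union>n. U n) - U N)"
    by (rule measure_Un_le) (use V U in auto)
  also have "\<dots> < e" using mU mV by simp
  finally have "measure M (topspace X - (U N \<union> (\<Inter>n. C' n))) < e" .
  moreover have "closedin X (U N)" unfolding U_def by (rule closedin_Union) (use C in auto)
  moreover have "closedin X (\<Inter>n. C' n)" by (rule closedin_Inter) (use C in auto)
  moreover have "U N \<subseteq> (\<Union>n. A n)" "(\<Inter>n. C' n) \<inter> (\<Union>n. A n) = {}"
    using C(3,4) unfolding U_def by blast+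
  ultimately show ?thesis by blast
qed

text \<open>Induction over the generated sigma-algebra. The metric enters in the basic case only: an
  open set is an increasing union of closed sets, which exhaust its measure, and its complement is
  closed as it stands.\<close>

lemma closed_approximation:
  assumes X: "metrizable_space X" and M: "finite_measure M" "sets M = sets (borel_of X)"
    and A: "A \<in> sets (borel_of X)" and e: "0 < (e::real)"
  shows "\<exists>C C'. closedin X C \<and> closedin X C' \<and> C \<subseteq> A \<and> C' \<inter> A = {} \<and>
      measure M (topspace X - (C \<union> C')) < e"
  using A e unfolding sets_borel_of
proof (induction arbitrary: e)
  interpret finite_measure M by fact
  have sp: "space M = topspace X" using sets_eq_imp_space_eq[OF M(2)] by simp
  {
    case (Basic U)
    then have U: "openin X U" by simp
    have "fsigma_in X U"
      using closed_imp_gdelta_in[OF X, of "topspace X - U"] U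
      by (simp add: fsigma_in_gdelta_in openin_subset closedin_def Diff_Diff_Int inf.absorb2)
    then obtain C :: "nat \<Rightarrow> 'a set"
      where C: "\<And>n. closedin X (C n)" "\<And>n. C n \<subseteq> C (Suc n)" "\<Union> (range C) = U"
      unfolding fsigma_in_ascending by blast
    have "(\<lambda>n. measure M (C n)) \<longlonglongrightarrow> measure M (\<Union>n. C n)"
      by (rule finite_Lim_measure_incseq)
        (use C(1,2) closedin_sets_borel_of[of X] M(2) in \<open>auto simp: incseq_Suc_iff\<close>)
    then have "eventually (\<lambda>n. measure M (\<Union>n. C n) - e < measure M (C n)) sequentially"
      by (rule order_tendstoD(1)) (use Basic in simp)
    then obtain N where N: "measure M U - e < measure M (C N)"
      using C by (auto simp: eventually_sequentially)
    have "topspace X - (C N \<union> (topspace X - U)) = U - C N" using openin_subset[OF U] by auto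
    moreover have "measure M (U - C N) = measure M U - measure M (C N)"
      by (rule finite_measure_Diff)
        (use C(1,3) closedin_sets_borel_of[of X] openin_sets_borel_of[OF U] M(2) in auto)
    ultimately show ?case
      using U C N by (intro exI[of _ "C N"] exI[of _ "topspace X - U"]) auto
  next
    case Empty
    then show ?case by (intro exI[of _ "{}"] exI[of _ "topspace X"]) auto
  next
    case (Compl A)
    then obtain C C' where C: "closedin X C" "closedin X C'" "C \<subseteq> A" "C' \<inter> A = {}"
      "measure M (topspace X - (C' \<union> C)) < e" by (metis Un_commute)
    moreover have "C' \<subseteq> topspace X - A" "C \<inter> (topspace X - A) = {}"
      using C(3,4) closedin_subset[OF C(2)] by blast+
    ultimately show ?case by blast
  next
    case (Union A)
    show ?case by (rule closed_approximation_Union[OF M Union.prems Union.IH])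
  }
qed

section \<open>Tightness and inner regularity of finite measures on Polish spaces\<close>

lemma Polish_spaceE:
  assumes "Polish_space X"
  obtains d C where "Metric_space (topspace X) d" "Metric_space.mcomplete (topspace X) d"
    "Metric_space.mtopology (topspace X) d = X" "countable C" "C \<subseteq> topspace X"
    "X closure_of C = topspace X"
proof -
  obtain M d where d: "Metric_space M d" "Metric_space.mcomplete M d" "X = Metric_space.mtopology M d"
    using assms unfolding Polish_space_def completely_metrizable_space_def by blast
  then have "topspace X = M" by (simp add: Metric_space.topspace_mtopology)
  then show thesis using that d assms unfolding Polish_space_def separable_space_def by metis
qed

lemma Polish_space_metrizable: "Polish_space X \<Longrightarrow> metrizable_space X"
  by (simp add: Polish_space_def completely_metrizable_imp_metrizable_space)

text \<open>Ulam's argument. For each \<open>k\<close>, finitely many balls of radius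
  \<open>1 / real (Suc k)\<close> around a dense sequence miss only a small part of the mass; the
  intersection over \<open>k\<close> is closed and totally bounded, hence compact by
  completeness.\<close>

lemma Polish_space_tight:
  assumes X: "Polish_space X" and M: "finite_measure M" "sets M = sets (borel_of X)"
    and e: "0 < e"
  shows "\<exists>K. compactin X K \<and> measure M (topspace X - K) < e"
proof -
  interpret finite_measure M by fact
  have sp: "space M = topspace X" using sets_eq_imp_space_eq[OF M(2)] by simp
  obtain d C where d: "Metric_space (topspace X) d" "Metric_space.mcomplete (topspace X) d"
    "Metric_space.mtopology (topspace X) d = X" and C: "countable C" "C \<subseteq> topspace X"
    "X closure_of C = topspace X" using Polish_spaceE[OF X] .
  interpret Metric_space "topspace X" d by fact
  show ?thesis
  proof (cases "topspace X = {}")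
    case True
    then show ?thesis using e by (intro exI[of _ "{}"]) auto
  next
    case False
    then have "C \<noteq> {}" using C(3) closure_of_empty by metis
    define x where "x = from_nat_into C"
    have xC: "range x = C" unfolding x_def using \<open>C \<noteq> {}\<close> C by (simp add: range_from_nat_into)
    have x: "x n \<in> topspace X" for n using xC C by auto
    have dense: "\<exists>n. d (x n) y < r" if "y \<in> topspace X" "0 < r" for y r
    proof -
      have "y \<in> mtopology closure_of C" using that C d(3) by simp
      then obtain z where "z \<in> C" "z \<in> mball y r"
        using \<open>0 < r\<close> unfolding metric_closure_of by blast
      then obtain n where "z = x n" using xC by blast
      then show ?thesis using \<open>z \<in> mball y r\<close> by (auto simp: commute)
    qed
    define B where "B = (\<lambda>k N. \<Union>n<N. mcball (x n) (1 / real (Suc k)))"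
    have B: "closedin X (B k N)" for k N
      unfolding B_def using closedin_mcball d(3) by (intro closedin_Union) auto
    have Bs: "B k N \<in> sets M" for k N using B closedin_sets_borel_of M(2) by blast
    have "\<exists>N. measure M (topspace X - B k N) < e / 2 * (1/2) ^ Suc k" for k
    proof -
      have cov: "(\<Union>N. B k N) = topspace X"
      proof
        show "topspace X \<subseteq> (\<Union>N. B k N)"
        proof
          fix y assume y: "y \<in> topspace X"
          obtain n where "d (x n) y < 1 / real (Suc k)" using dense[OF y] by (meson of_nat_0_less_iff zero_less_Suc zero_less_divide_1_iff)
          then have "y \<in> B k (Suc n)" using x y by (auto simp: B_def intro!: bexI[of _ n])
          then show "y \<in> (\<Union>N. B k N)" by blast
        qed
      qed (use B closedin_subset in blast)
      have "(\<lambda>N. measure M (B k N)) \<longlonglongrightarrow> measure M (\<Union>N. B k N)"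
        by (rule finite_Lim_measure_incseq) (use Bs in \<open>force simp: incseq_def B_def\<close>)+
      then have "eventually (\<lambda>N. measure M (topspace X) - e / 2 * (1/2) ^ Suc k < measure M (B k N)) sequentially"
        unfolding cov by (rule order_tendstoD(1)) (use e in simp)
      then obtain N where "measure M (topspace X) - e / 2 * (1/2) ^ Suc k < measure M (B k N)"
        by (auto simp: eventually_sequentially)
      moreover have "measure M (topspace X - B k N) = measure M (topspace X) - measure M (B k N)"
        using Bs sp by (metis finite_measure_compl)
      ultimately show ?thesis by (intro exI[of _ N]) simp
    qed
    then obtain N where N: "\<And>k. measure M (topspace X - B k (N k)) < e / 2 * (1/2) ^ Suc k"
      by metis
    define K where "K = (\<Inter>k. B k (N k))"
    have Kc: "closedin X K" unfolding K_def by (rule closedin_Inter) (use B in auto)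
    have Ks: "K \<subseteq> topspace X" using Kc closedin_subset by blast
    have "mtotally_bounded K"
      unfolding mtotally_bounded_def
    proof (intro allI impI)
      fix r :: real assume r: "0 < r"
      obtain k where k: "1 / real (Suc k) < r / 2"
        using reals_Archimedean[of "r / 2"] r by (auto simp: inverse_eq_divide)
      \<comment> \<open>Total boundedness asks for centres inside \<open>K\<close>, so a ball that
        meets \<open>K\<close> is replaced by one of twice the radius around a point of
        \<open>K\<close>. This explains \<open>r / 2\<close> in the choice of
        \<open>k\<close>.\<close>
      define J where "J = {n. n < N k \<and> K \<inter> mcball (x n) (1 / real (Suc k)) \<noteq> {}}"
      have "\<forall>n\<in>J. \<exists>y. y \<in> K \<inter> mcball (x n) (1 / real (Suc k))" by (auto simp: J_def)
      then obtain y where y: "\<And>n. n \<in> J \<Longrightarrow> y n \<in> K \<inter> mcball (x n) (1 / real (Suc k))"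
        by metis
      have "K \<subseteq> (\<Union>z\<in>y ` J. mball z r)"
      proof
        fix z assume z: "z \<in> K"
        then obtain n where n: "n < N k" "z \<in> mcball (x n) (1 / real (Suc k))"
          unfolding K_def B_def by blast
        then have "n \<in> J" using z by (auto simp: J_def)
        note yn = y[OF this]
        have "d (y n) z \<le> d (y n) (x n) + d (x n) z"
          using yn n by (intro triangle) auto
        also have "\<dots> < r" using yn n k by (auto simp: commute)
        finally have "z \<in> mball (y n) r" using yn n by auto
        then show "z \<in> (\<Union>z\<in>y ` J. mball z r)" using \<open>n \<in> J\<close> by blast
      qed
      moreover have "finite (y ` J)" "y ` J \<subseteq> K" using y by (auto simp: J_def)
      ultimately show "\<exists>F. finite F \<and> F \<subseteq> K \<and> K \<subseteq> (\<Union>x\<in>F. mball x r)" by blast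
    qed
    then have "compactin X K"
      using mtotally_bounded_eq_compact_closure_of[OF d(2), of K] Kc d(3) by (simp add: closure_of_closedin)
    moreover have "measure M (topspace X - K) < e"
    proof -
      have s: "(\<lambda>n. e / 2 * (1/2) ^ Suc n) sums (e / 2 * 1)"
        by (intro sums_mult power_half_series)
      have sV: "summable (\<lambda>k. measure M (topspace X - B k (N k)))"
        by (rule summable_comparison_test'[OF sums_summable[OF s], of 0])
          (use N in \<open>simp add: less_imp_le\<close>)
      have V: "topspace X - B k (N k) \<in> sets M" for k using Bs sp by (metis sets.compl_sets)
      have "measure M (topspace X - K) = measure M (\<Union>k. topspace X - B k (N k))"
        by (rule arg_cong[of _ _ "measure M"]) (auto simp: K_def)
      also have "\<dots> \<le> (\<Sum>k. measure M (topspace X - B k (N k)))"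
        by (rule finite_measure_subadditive_countably) (use V sV in auto)
      also have "\<dots> \<le> (\<Sum>n. e / 2 * (1/2) ^ Suc n)"
        by (rule suminf_le[OF _ sV sums_summable[OF s]]) (use N in \<open>simp add: less_imp_le\<close>)
      also have "\<dots> < e" using s e by (simp add: sums_iff)
      finally show ?thesis .
    qed
    ultimately show ?thesis by blast
  qed
qed

lemma Polish_space_Hausdorff: "Polish_space X \<Longrightarrow> Hausdorff_space X"
  by (simp add: Polish_space_metrizable metrizable_imp_Hausdorff_space)

text \<open>A compact set that carries most of the mass, intersected with a closed inner set, is
  compact and loses at most the two gaps.\<close>

lemma Polish_space_inner_regular:
  assumes X: "Polish_space X" and M: "finite_measure M" "sets M = sets (borel_of X)"
    and A: "A \<in> sets (borel_of X)" and e: "0 < e"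
  shows "\<exists>K. compactin X K \<and> K \<subseteq> A \<and> measure M (A - K) < e"
proof -
  interpret finite_measure M by fact
  have cl: "closedin X C \<Longrightarrow> C \<in> sets M" for C using closedin_sets_borel_of M(2) by blast
  have top: "topspace X \<in> sets M" by (rule cl) simp
  obtain C C' where C: "closedin X C" "closedin X C'" "C \<subseteq> A" "C' \<inter> A = {}"
    "measure M (topspace X - (C \<union> C')) < e / 2"
    using closed_approximation[OF Polish_space_metrizable[OF X] M A, of "e / 2"] e by auto
  obtain K where K: "compactin X K" "measure M (topspace X - K) < e / 2"
    using Polish_space_tight[OF X M, of "e / 2"] e by auto
  have Kcl: "closedin X K"
    using K(1) Polish_space_Hausdorff[OF X] by (rule compactin_imp_closedin[rotated])
  have As: "A \<subseteq> topspace X" using sets.sets_into_space[OF A] by simp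
  have "measure M (A - (K \<inter> C)) \<le> measure M ((topspace X - (C \<union> C')) \<union> (topspace X - K))"
    by (rule finite_measure_mono) (use As C(4) cl[OF Kcl] cl[OF C(1)] cl[OF C(2)] top in auto)
  also have "\<dots> \<le> measure M (topspace X - (C \<union> C')) + measure M (topspace X - K)"
    by (rule measure_Un_le) (use cl[OF Kcl] cl[OF C(1)] cl[OF C(2)] top in auto)
  also have "\<dots> < e" using C(5) K(2) by simp
  finally show ?thesis
    using C K compact_Int_closedin[OF K(1) C(1)] by (intro exI[of _ "K \<inter> C"]) auto
qed

section \<open>Countable bases and the Borel sets of a finite product\<close>

lemma Polish_space_countable_base:
  assumes "Polish_space X"
  shows "\<exists>\<B>. countable \<B> \<and> (\<forall>V\<in>\<B>. openin X V) \<and>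
    (\<forall>U x. openin X U \<longrightarrow> x \<in> U \<longrightarrow> (\<exists>V\<in>\<B>. x \<in> V \<and> V \<subseteq> U))"
proof -
  obtain d C where d: "Metric_space (topspace X) d" "Metric_space.mcomplete (topspace X) d"
    "Metric_space.mtopology (topspace X) d = X" and C: "countable C" "C \<subseteq> topspace X"
    "X closure_of C = topspace X" using Polish_spaceE[OF assms] .
  interpret Metric_space "topspace X" d by fact
  define \<B> where "\<B> = (\<lambda>(z, n). mball z (1 / real (Suc n))) ` (C \<times> (UNIV :: nat set))"
  show ?thesis
  proof (intro exI[of _ \<B>] conjI ballI allI impI)
    show "countable \<B>" unfolding \<B>_def using C(1) by (intro countable_image countable_SIGMA) auto
    show "openin X V" if "V \<in> \<B>" for V
      using that openin_mball d(3) unfolding \<B>_def by (auto simp: image_iff)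
    fix U x assume U: "openin X U" "x \<in> U"
    then have x: "x \<in> topspace X" using openin_subset by blast
    obtain r where r: "r > 0" "mball x r \<subseteq> U" using U openin_mtopology d(3) by metis
    obtain n where n: "1 / real (Suc n) < r / 2"
      using reals_Archimedean[of "r / 2"] r by (auto simp: inverse_eq_divide)
    have "x \<in> mtopology closure_of C" using x C d(3) by simp
    moreover have "0 < 1 / real (Suc n)" by simp
    ultimately obtain z where z: "z \<in> C" "z \<in> mball x (1 / real (Suc n))"
      unfolding metric_closure_of by blast
    have "x \<in> mball z (1 / real (Suc n))" using z by (auto simp: commute)
    moreover have "mball z (1 / real (Suc n)) \<subseteq> mball x r"
    proof
      fix y assume y: "y \<in> mball z (1 / real (Suc n))"
      have "d x y \<le> d x z + d z y" using x y z by (intro triangle) auto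
      also have "\<dots> < r" using n y z by auto
      finally show "y \<in> mball x r" using x y by auto
    qed
    ultimately show "\<exists>V\<in>\<B>. x \<in> V \<and> V \<subseteq> U"
      using z r unfolding \<B>_def by (intro bexI[of _ "mball z (1 / real (Suc n))"]) auto
  qed
qed

text \<open>The base serves twice: it identifies the Borel sets of the product topology with the
  product sigma-algebra, and it supplies the rectangles from which semicontinuous functions are
  built.\<close>

lemma product_rectangle_base:
  fixes S :: "nat \<Rightarrow> 'a topology"
  assumes I: "finite I" and S: "\<forall>t\<in>I. Polish_space (S t)"
  shows "\<exists>\<R>. countable \<R> \<and> (\<forall>R\<in>\<R>. \<exists>U. R = Pi\<^sub>E I U \<and> (\<forall>t\<in>I. openin (S t) (U t))) \<and>
    (\<forall>U s. openin (product_topology S I) U \<longrightarrow> s \<in> U \<longrightarrow> (\<exists>R\<in>\<R>. s \<in> R \<and> R \<subseteq> U))"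
proof -
  have "\<forall>t\<in>I. \<exists>\<B>. countable \<B> \<and> (\<forall>V\<in>\<B>. openin (S t) V) \<and>
      (\<forall>U x. openin (S t) U \<longrightarrow> x \<in> U \<longrightarrow> (\<exists>V\<in>\<B>. x \<in> V \<and> V \<subseteq> U))"
    using Polish_space_countable_base S by blast
  then obtain \<B> where B: "\<And>t. t \<in> I \<Longrightarrow> countable (\<B> t)"
    "\<And>t V. t \<in> I \<Longrightarrow> V \<in> \<B> t \<Longrightarrow> openin (S t) V"
    "\<And>t U x. t \<in> I \<Longrightarrow> openin (S t) U \<Longrightarrow> x \<in> U \<Longrightarrow> \<exists>V\<in>\<B> t. x \<in> V \<and> V \<subseteq> U"
    by metis
  show ?thesis
  proof (intro exI[of _ "Pi\<^sub>E I ` Pi\<^sub>E I \<B>"] conjI ballI allI impI)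
    show "countable (Pi\<^sub>E I ` Pi\<^sub>E I \<B>)"
      by (intro countable_image countable_PiE I B)
    show "\<exists>U. R = Pi\<^sub>E I U \<and> (\<forall>t\<in>I. openin (S t) (U t))" if "R \<in> Pi\<^sub>E I ` Pi\<^sub>E I \<B>" for R
      using that B(2) by (auto simp: PiE_iff)
    fix U s assume "openin (product_topology S I) U" "s \<in> U"
    then obtain W where W: "\<And>t. t \<in> I \<Longrightarrow> openin (S t) (W t)" "s \<in> Pi\<^sub>E I W" "Pi\<^sub>E I W \<subseteq> U"
      unfolding openin_product_topology_alt by metis
    have "\<forall>t\<in>I. \<exists>V\<in>\<B> t. s t \<in> V \<and> V \<subseteq> W t" using B(3) W by (meson PiE_mem)
    then obtain V where V: "\<And>t. t \<in> I \<Longrightarrow> V t \<in> \<B> t \<and> s t \<in> V t \<and> V t \<subseteq> W t" by metis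
    have "restrict V I \<in> Pi\<^sub>E I \<B>" using V by auto
    moreover have "Pi\<^sub>E I (restrict V I) = Pi\<^sub>E I V" by (rule PiE_cong) auto
    moreover have "s \<in> Pi\<^sub>E I V" using V W(2) by (auto simp: PiE_iff)
    moreover have "Pi\<^sub>E I V \<subseteq> U" using V W(3) PiE_mono[of I V W] by blast
    ultimately show "\<exists>R\<in>Pi\<^sub>E I ` Pi\<^sub>E I \<B>. s \<in> R \<and> R \<subseteq> U"
      by (smt (verit) image_eqI)
  qed
qed

text \<open>An open set of the product is a countable union of open rectangles, and this is where
  separability is used. The converse inclusion is measurability of the projections.\<close>

lemma sets_PiM_borel_of:
  fixes S :: "nat \<Rightarrow> 'a topology"
  assumes I: "finite I" and S: "\<forall>t\<in>I. Polish_space (S t)"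
  shows "sets (Pi\<^sub>M I (\<lambda>t. borel_of (S t))) = sets (borel_of (product_topology S I))"
proof
  let ?X = "product_topology S I" and ?P = "Pi\<^sub>M I (\<lambda>t. borel_of (S t))"
  have sp: "space ?P = topspace ?X" by (simp add: space_PiM)
  obtain \<R> where R: "countable \<R>"
    "\<forall>R\<in>\<R>. \<exists>U. R = Pi\<^sub>E I U \<and> (\<forall>t\<in>I. openin (S t) (U t))"
    "\<forall>U s. openin ?X U \<longrightarrow> s \<in> U \<longrightarrow> (\<exists>R\<in>\<R>. s \<in> R \<and> R \<subseteq> U)"
    using product_rectangle_base[OF I S] by blast
  have RP: "R \<in> sets ?P" if "R \<in> \<R>" for R
  proof -
    obtain U where U: "R = Pi\<^sub>E I U" "\<forall>t\<in>I. openin (S t) (U t)" using R(2) \<open>R \<in> \<R>\<close> by blast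
    show ?thesis
      unfolding U(1) by (rule sets_PiM_I_finite[OF I]) (use U(2) openin_sets_borel_of in blast)
  qed
  have "U \<in> sets ?P" if "openin ?X U" for U
  proof -
    have "U = \<Union> {R \<in> \<R>. R \<subseteq> U}" using R(3) that by blast
    moreover have "\<Union> {R \<in> \<R>. R \<subseteq> U} \<in> sets ?P"
      by (rule sets.countable_Union) (use RP R(1) in auto)
    ultimately show ?thesis by simp
  qed
  then show "sets (borel_of ?X) \<subseteq> sets ?P"
    using sets.sigma_sets_subset[of "{U. openin ?X U}" ?P] unfolding sets_borel_of sp by blast
  have m: "(\<lambda>s. s) \<in> measurable (borel_of ?X) ?P"
  proof (rule measurable_PiM_single')
    show "(\<lambda>s. s t) \<in> measurable (borel_of ?X) (borel_of (S t))" if "t \<in> I" for t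
      using that by (intro continuous_map_measurable_borel_of continuous_map_product_projection)
    show "(\<lambda>s. s) \<in> space (borel_of ?X) \<rightarrow> (\<Pi>\<^sub>E t\<in>I. space (borel_of (S t)))" by auto
  qed
  show "sets ?P \<subseteq> sets (borel_of ?X)"
  proof
    fix A assume A: "A \<in> sets ?P"
    then have "A \<subseteq> topspace ?X" using sets.sets_into_space sp by blast
    then show "A \<in> sets (borel_of ?X)" using measurable_sets[OF m A] by (simp add: inf.absorb1)
  qed
qed

section \<open>Countably additive extension of a content\<close>

text \<open>Two compact sets, one inside \<open>E\<close> and one inside its complement, make
  closure under complements immediate. The content will be defined on all subsets, so this class
  takes over the role of the algebra in Caratheodory's extension.\<close>

definition compact_approximable :: "'b topology \<Rightarrow> ('b set \<Rightarrow> real) \<Rightarrow> 'b set set" where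
  "compact_approximable X m = {E. E \<subseteq> topspace X \<and> (\<forall>e>0. \<exists>K K'. compactin X K \<and> compactin X K' \<and>
     K \<subseteq> E \<and> K' \<inter> E = {} \<and> m (topspace X - (K \<union> K')) < e)}"

text \<open>For the empty set the inner compact set is empty and the outer one is arbitrary, so the
  last assumption says that \<open>m\<close> is tight.\<close>

locale finitely_additive_content =
  fixes X :: "'b topology" and m :: "'b set \<Rightarrow> real"
  assumes Hausdorff: "Hausdorff_space X"
    and content_nonneg: "\<And>E. E \<subseteq> topspace X \<Longrightarrow> 0 \<le> m E"
    and content_additive: "\<And>E F. E \<subseteq> topspace X \<Longrightarrow> F \<subseteq> topspace X \<Longrightarrow> E \<inter> F = {} \<Longrightarrow> m (E \<union> F) = m E + m F"
    and empty_approximable: "{} \<in> compact_approximable X m"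
begin

lemma content_empty: "m {} = 0"
  using content_additive[of "{}" "{}"] by simp

lemma content_mono:
  assumes "E \<subseteq> F" "F \<subseteq> topspace X" shows "m E \<le> m F"
proof -
  have "E \<union> (F - E) = F" "E \<subseteq> topspace X" "F - E \<subseteq> topspace X" using assms by auto
  then show ?thesis using content_additive[of E "F - E"] content_nonneg[of "F - E"] by auto
qed

lemma content_subadditive:
  assumes "E \<subseteq> topspace X" "F \<subseteq> topspace X" shows "m (E \<union> F) \<le> m E + m F"
proof -
  have "m (E \<union> F) = m E + m (F - E)" using content_additive[of E "F - E"] assms by auto
  then show ?thesis using content_mono[of "F - E" F] assms by auto
qed

lemma content_subadditive_finite:
  "finite I \<Longrightarrow> (\<And>i. i \<in> I \<Longrightarrow> E i \<subseteq> topspace X) \<Longrightarrow> m (\<Union>i\<in>I. E i) \<le> (\<Sum>i\<in>I. m (E i))"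
proof (induction I rule: finite_induct)
  case (insert i I)
  have "m (\<Union>i\<in>insert i I. E i) \<le> m (E i) + m (\<Union>i\<in>I. E i)"
    using content_subadditive[of "E i" "\<Union>i\<in>I. E i"] insert.prems by (auto simp: UN_subset_iff)
  then show ?case using insert by auto
qed (simp add: content_empty)

abbreviation "\<A> \<equiv> compact_approximable X m"

lemma approximableE:
  assumes "E \<in> \<A>" "0 < e"
  obtains K K' where "compactin X K" "compactin X K'" "K \<subseteq> E" "K' \<inter> E = {}"
    "m (topspace X - (K \<union> K')) < e"
  using assms unfolding compact_approximable_def by blast

lemma approximable_Compl: "E \<in> \<A> \<Longrightarrow> topspace X - E \<in> \<A>"
  unfolding compact_approximable_def
proof (safe, goal_cases)
  case (1 e)
  then obtain K K' where "compactin X K" "compactin X K'" "K \<subseteq> E" "K' \<inter> E = {}"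
    "m (topspace X - (K' \<union> K)) < e" by (metis Un_commute)
  moreover have "K' \<subseteq> topspace X - E" "K \<inter> (topspace X - E) = {}"
    using calculation compactin_subset_topspace by blast+
  ultimately show ?case by blast
qed

text \<open>Inner sets are united and outer sets intersected; the intersection is compact because
  compact sets of a Hausdorff space are closed.\<close>

lemma approximable_Un:
  assumes "E \<in> \<A>" "F \<in> \<A>" shows "E \<union> F \<in> \<A>"
  unfolding compact_approximable_def
proof (safe, goal_cases)
  case (3 e)
  obtain K K' where K: "compactin X K" "compactin X K'" "K \<subseteq> E" "K' \<inter> E = {}"
    "m (topspace X - (K \<union> K')) < e / 2"
    using approximableE[OF assms(1), of "e / 2"] 3 by auto
  obtain L L' where L: "compactin X L" "compactin X L'" "L \<subseteq> F" "L' \<inter> F = {}"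
    "m (topspace X - (L \<union> L')) < e / 2"
    using approximableE[OF assms(2), of "e / 2"] 3 by auto
  have "m (topspace X - ((K \<union> L) \<union> (K' \<inter> L'))) \<le> m ((topspace X - (K \<union> K')) \<union> (topspace X - (L \<union> L')))"
    by (rule content_mono) auto
  also have "\<dots> \<le> m (topspace X - (K \<union> K')) + m (topspace X - (L \<union> L'))"
    by (rule content_subadditive) auto
  also have "\<dots> < e" using K L by simp
  finally have "m (topspace X - ((K \<union> L) \<union> (K' \<inter> L'))) < e" .
  moreover have "compactin X (K \<union> L)" using K L by (simp add: compactin_Un)
  moreover have "compactin X (K' \<inter> L')"
    using K L compactin_imp_closedin[OF Hausdorff] by (simp add: compact_Int_closedin)
  moreover have "K \<union> L \<subseteq> E \<union> F" "K' \<inter> L' \<inter> (E \<union> F) = {}" using K L by auto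
  ultimately show ?case by blast
qed (use assms in \<open>auto simp: compact_approximable_def\<close>)

lemma approximable_ring: "ring_of_sets (topspace X) \<A>"
proof (rule ring_of_setsI)
  show "\<A> \<subseteq> Pow (topspace X)" by (auto simp: compact_approximable_def)
  show "{} \<in> \<A>" by (rule empty_approximable)
  show "a \<union> b \<in> \<A>" if "a \<in> \<A>" "b \<in> \<A>" for a b using that by (rule approximable_Un)
  show "a - b \<in> \<A>" if "a \<in> \<A>" "b \<in> \<A>" for a b
  proof -
    have "a \<subseteq> topspace X" using that by (auto simp: compact_approximable_def)
    then have "a - b = topspace X - ((topspace X - a) \<union> b)" by auto
    then show ?thesis using that approximable_Compl approximable_Un by auto
  qed
qed

text \<open>The compact class argument. Compact \<open>K n \<subseteq> A n\<close> that lose little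
  content have empty total intersection, so some finite intersection is empty already; then
  \<open>A N\<close> is covered by the losses \<open>A n - K n\<close> with
  \<open>n \<le> N\<close>.\<close>

lemma content_empty_continuous:
  assumes A: "range A \<subseteq> \<A>" and dec: "decseq A" and empty: "(\<Inter>i. A i) = {}"
  shows "(\<lambda>i. m (A i)) \<longlonglongrightarrow> 0"
proof -
  have As: "A i \<subseteq> topspace X" for i using A by (auto simp: compact_approximable_def)
  have ex: "\<exists>N. m (A N) < e" if e: "0 < e" for e
  proof -
    have "\<exists>K. compactin X K \<and> K \<subseteq> A n \<and> m (A n - K) < e / 2 * (1/2) ^ Suc n" for n
    proof -
      have pos: "0 < e / 2 * (1/2) ^ Suc n" using e by simp
      have "A n \<in> \<A>" using A by blast
      then obtain K K' where "compactin X K" "K \<subseteq> A n" "K' \<inter> A n = {}"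
        "m (topspace X - (K \<union> K')) < e / 2 * (1/2) ^ Suc n"
        using pos unfolding compact_approximable_def by blast
      moreover have "m (A n - K) \<le> m (topspace X - (K \<union> K'))"
        by (rule content_mono) (use As calculation in auto)
      ultimately show ?thesis by force
    qed
    then obtain K where K: "\<And>n. compactin X (K n)" "\<And>n. K n \<subseteq> A n"
      "\<And>n. m (A n - K n) < e / 2 * (1/2) ^ Suc n" by metis
    have s: "(\<lambda>n. e / 2 * (1/2) ^ Suc n) sums (e / 2 * 1)"
      by (intro sums_mult power_half_series)
    have cl: "closedin X (K n)" for n using compactin_imp_closedin[OF Hausdorff] K(1) .
    have "\<exists>N. (\<Inter>n\<le>N. K n) = {}"
    proof (rule ccontr)
      assume no: "\<not> ?thesis"
      have "K 0 \<inter> \<Inter> (range K) \<noteq> {}"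
      proof (rule compactin_fip[THEN iffD1, OF K(1), THEN conjunct2, rule_format], intro conjI ballI allI impI)
        show "closedin X C" if "C \<in> range K" for C using that cl by auto
        fix \<F> assume F: "finite \<F> \<and> \<F> \<subseteq> range K"
        then obtain J where J: "finite J" "\<F> = K ` J" by (meson finite_subset_image)
        then obtain N where N: "J \<subseteq> {..N}" by (meson finite_nat_iff_bounded_le)
        have "(\<Inter>n\<le>N. K n) \<subseteq> K 0 \<inter> \<Inter> \<F>" using J N by auto
        then show "K 0 \<inter> \<Inter> \<F> \<noteq> {}" using no by blast
      qed
      then obtain x where "\<And>n. x \<in> K n" by blast
      then have "x \<in> (\<Inter>i. A i)" using K(2) by blast
      then show False unfolding empty by simp
    qed
    then obtain N where N: "(\<Inter>n\<le>N. K n) = {}" by blast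
    have "A N \<subseteq> (\<Union>n\<le>N. A n - K n)"
    proof
      fix x assume x: "x \<in> A N"
      then obtain n where "n \<le> N" "x \<notin> K n" using N by blast
      moreover have "x \<in> A n" using x dec \<open>n \<le> N\<close> by (auto simp: decseq_def)
      ultimately show "x \<in> (\<Union>n\<le>N. A n - K n)" by blast
    qed
    then have "m (A N) \<le> m (\<Union>n\<le>N. A n - K n)" by (rule content_mono) (use As in auto)
    also have "\<dots> \<le> (\<Sum>n\<le>N. m (A n - K n))"
      by (rule content_subadditive_finite) (use As in auto)
    also have "\<dots> \<le> (\<Sum>n\<le>N. e / 2 * (1/2) ^ Suc n)" by (rule sum_mono) (use K(3) less_imp_le in blast)
    also have "\<dots> \<le> (\<Sum>n. e / 2 * (1/2) ^ Suc n)"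
      by (rule sum_le_suminf[OF sums_summable[OF s]]) (use e in simp_all)
    also have "\<dots> = e / 2" using sums_unique[OF s] by simp
    finally show ?thesis using e by (intro exI[of _ N]) simp
  qed
  have mono: "m (A j) \<le> m (A i)" if "i \<le> j" for i j
    using dec that As by (intro content_mono) (auto simp: decseq_def)
  show ?thesis
  proof (rule LIMSEQ_I)
    fix e :: real assume "0 < e"
    then obtain N where "m (A N) < e" using ex by blast
    then show "\<exists>N. \<forall>n\<ge>N. norm (m (A n) - 0) < e"
      using mono content_nonneg[OF As] by (intro exI[of _ N]) (force intro: le_less_trans)
  qed
qed

text \<open>For a finite content on a ring, continuity at the empty set amounts to countable
  additivity, so nothing else has to be checked. The resulting sigma-algebra is compared with the
  Borel sets only later.\<close>

theorem content_extension:
  obtains M where "space M = topspace X" "sets M = sigma_sets (topspace X) \<A>"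
    "\<And>E. E \<in> \<A> \<Longrightarrow> emeasure M E = ennreal (m E)"
proof -
  interpret ring_of_sets "topspace X" \<A> by (rule approximable_ring)
  have As: "E \<subseteq> topspace X" if "E \<in> \<A>" for E using that by (auto simp: compact_approximable_def)
  have "\<exists>\<mu>. (\<forall>s\<in>\<A>. \<mu> s = ennreal (m s)) \<and> measure_space (topspace X) (sigma_sets (topspace X) \<A>) \<mu>"
  proof (rule caratheodory_empty_continuous)
    show "positive \<A> (\<lambda>s. ennreal (m s))" by (simp add: positive_def content_empty)
    show "additive \<A> (\<lambda>s. ennreal (m s))"
      using As content_additive content_nonneg by (auto simp: additive_def ennreal_plus)
    show "(\<lambda>i. ennreal (m (A i))) \<longlonglongrightarrow> 0"
      if "range A \<subseteq> \<A>" "decseq A" "(\<Inter>i. A i) = {}" for A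
      using tendsto_ennrealI[OF content_empty_continuous[OF that]] by simp
  qed simp
  then obtain \<mu> where mu: "\<And>s. s \<in> \<A> \<Longrightarrow> \<mu> s = ennreal (m s)"
    "measure_space (topspace X) (sigma_sets (topspace X) \<A>) \<mu>" by blast
  define M where "M = measure_of (topspace X) \<A> \<mu>"
  have P: "\<A> \<subseteq> Pow (topspace X)" using As by blast
  have s: "sets M = sigma_sets (topspace X) \<A>" unfolding M_def using P by (rule sets_measure_of)
  show thesis
  proof
    show "space M = topspace X" unfolding M_def using P by (rule space_measure_of)
    show "sets M = sigma_sets (topspace X) \<A>" by (rule s)
    show "emeasure M E = ennreal (m E)" if "E \<in> \<A>" for E
      using emeasure_measure_of[OF M_def P, of E] mu that s
      by (auto simp: measure_space_def)
  qed
qed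

end

section \<open>Separable functions and midpoint-closed families\<close>

text \<open>By Fubini almost every section is integrable. In a probability space this yields at
  least one section, on which \<open>f\<close> differs from an integrable function by a
  constant.\<close>

lemma integrable_sum_pairD:
  fixes f :: "'a \<Rightarrow> real" and g :: "'b \<Rightarrow> real"
  assumes M: "prob_space M" and N: "prob_space N"
    and int: "integrable (M \<Otimes>\<^sub>M N) (\<lambda>(x, y). f x + g y)"
  shows "integrable M f"
proof -
  interpret M: prob_space M by fact
  interpret N: prob_space N by fact
  interpret P: pair_sigma_finite M N ..
  interpret Q: pair_sigma_finite N M ..
  have "integrable (N \<Otimes>\<^sub>M M) (\<lambda>(y, x). f x + g y)"
    using P.integrable_product_swap[OF int] by simp
  from Q.AE_integrable_fst'[OF this] have "AE y in N. integrable M (\<lambda>x. f x + g y)" by simp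
  then have "\<exists>y. integrable M (\<lambda>x. f x + g y)"
    using N.AE_False by fastforce
  then obtain y where "integrable M (\<lambda>x. f x + g y)" ..
  then have "integrable M (\<lambda>x. (f x + g y) - g y)"
    by (intro Bochner_Integration.integrable_diff) auto
  then show ?thesis by simp
qed

text \<open>Jensen's inequality in the second variable: replacing \<open>g\<close> by its mean
  cannot increase the integral of the absolute value.\<close>

lemma integral_abs_sum_pair_ge:
  fixes f :: "'a \<Rightarrow> real" and g :: "'b \<Rightarrow> real"
  assumes M: "prob_space M" and N: "prob_space N"
    and int: "integrable (M \<Otimes>\<^sub>M N) (\<lambda>(x, y). f x + g y)"
    and f: "integrable M f" and g: "integrable N g"
  shows "(\<integral>x. \<bar>f x + (\<integral>y. g y \<partial>N)\<bar> \<partial>M) \<le> (\<integral>(x, y). \<bar>f x + g y\<bar> \<partial>(M \<Otimes>\<^sub>M N))"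
proof -
  interpret M: prob_space M by fact
  interpret N: prob_space N by fact
  interpret P: pair_sigma_finite M N ..
  have abs: "integrable (M \<Otimes>\<^sub>M N) (\<lambda>(x, y). \<bar>f x + g y\<bar>)"
    using integrable_abs[OF int] by (simp add: case_prod_beta')
  have "(\<integral>x. \<bar>f x + (\<integral>y. g y \<partial>N)\<bar> \<partial>M) \<le> (\<integral>x. (\<integral>y. \<bar>f x + g y\<bar> \<partial>N) \<partial>M)"
  proof (rule integral_mono)
    show "integrable M (\<lambda>x. \<bar>f x + (\<integral>y. g y \<partial>N)\<bar>)" using f by auto
    show "integrable M (\<lambda>x. \<integral>y. \<bar>f x + g y\<bar> \<partial>N)" using P.integrable_fst'[OF abs] by simp
    fix x
    have "f x + (\<integral>y. g y \<partial>N) = (\<integral>y. f x + g y \<partial>N)" using g by (simp add: N.prob_space)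
    then show "\<bar>f x + (\<integral>y. g y \<partial>N)\<bar> \<le> (\<integral>y. \<bar>f x + g y\<bar> \<partial>N)"
      using integral_abs_bound[of N "\<lambda>y. f x + g y"] by simp
  qed
  also have "\<dots> = (\<integral>(x, y). \<bar>f x + g y\<bar> \<partial>(M \<Otimes>\<^sub>M N))"
    using P.integral_fst'[OF abs] by simp
  finally show ?thesis .
qed

text \<open>Only the marginals of \<open>N\<close> enter, so the same formula serves the product
  measure and every other plan.\<close>

lemma integral_sum_marginals:
  fixes f :: "'i \<Rightarrow> 'a \<Rightarrow> real"
  assumes I: "finite I" and m: "\<And>i. i \<in> I \<Longrightarrow> (\<lambda>s. s i) \<in> measurable N (M i)"
    and d: "\<And>i. i \<in> I \<Longrightarrow> distr N (M i) (\<lambda>s. s i) = M i"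
    and f: "\<And>i. i \<in> I \<Longrightarrow> integrable (M i) (f i)"
  shows "integrable N (\<lambda>s. \<Sum>i\<in>I. f i (s i))"
    "(\<integral>s. (\<Sum>i\<in>I. f i (s i)) \<partial>N) = (\<Sum>i\<in>I. \<integral>x. f i x \<partial>M i)"
proof -
  have i: "integrable N (\<lambda>s. f i (s i))" if "i \<in> I" for i
    by (rule integrable_distr[OF m[OF that]]) (simp add: d that f)
  then show "integrable N (\<lambda>s. \<Sum>i\<in>I. f i (s i))" by auto
  have "(\<integral>s. f i (s i) \<partial>N) = (\<integral>x. f i x \<partial>M i)" if "i \<in> I" for i
    using integral_distr[OF m[OF that], of "f i"] f[OF that] by (simp add: d that)
  then show "(\<integral>s. (\<Sum>i\<in>I. f i (s i)) \<partial>N) = (\<Sum>i\<in>I. \<integral>x. f i x \<partial>M i)"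
    using i by simp
qed

text \<open>Coordinate \<open>t\<close> is detached by a measure-preserving map, so that the results
  on two factors apply to sums over \<open>I\<close>.\<close>

lemma PiM_sum_split:
  fixes f :: "'i \<Rightarrow> 'a \<Rightarrow> real"
  assumes I: "finite I" "t \<in> I" and M: "\<And>i. i \<in> I \<Longrightarrow> prob_space (M i)"
    and int: "integrable (Pi\<^sub>M I M) (\<lambda>s. \<Sum>i\<in>I. f i (s i))"
  defines "J \<equiv> I - {t}"
  shows "integrable (M t \<Otimes>\<^sub>M Pi\<^sub>M J M) (\<lambda>(x, y). f t x + (\<Sum>i\<in>J. f i (y i)))"
    "(\<integral>s. \<bar>\<Sum>i\<in>I. f i (s i)\<bar> \<partial>Pi\<^sub>M I M) = (\<integral>(x, y). \<bar>f t x + (\<Sum>i\<in>J. f i (y i))\<bar> \<partial>(M t \<Otimes>\<^sub>M Pi\<^sub>M J M))"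
proof -
  have ins: "insert t J = I" using I by (auto simp: J_def)
  let ?T = "\<lambda>(x, X). X(t := x)"
  have T: "?T \<in> measurable (M t \<Otimes>\<^sub>M Pi\<^sub>M J M) (Pi\<^sub>M I M)"
  proof -
    have "(\<lambda>p. (snd p, fst p)) \<in> measurable (M t \<Otimes>\<^sub>M Pi\<^sub>M J M) (Pi\<^sub>M J M \<Otimes>\<^sub>M M t)" by simp
    from measurable_compose[OF this measurable_add_dim] show ?thesis
      by (simp add: ins case_prod_beta')
  qed
  have D: "distr (M t \<Otimes>\<^sub>M Pi\<^sub>M J M) (Pi\<^sub>M I M) ?T = Pi\<^sub>M I M"
    using distr_pair_PiM_eq_PiM[of J M t] M I ins by (auto simp: J_def)
  have sum: "(\<Sum>i\<in>I. f i ((?T p) i)) = (case p of (x, y) \<Rightarrow> f t x + (\<Sum>i\<in>J. f i (y i)))" for p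
    using I by (auto simp: J_def sum.remove[of I t] split: prod.split intro!: sum.cong)
  show "integrable (M t \<Otimes>\<^sub>M Pi\<^sub>M J M) (\<lambda>(x, y). f t x + (\<Sum>i\<in>J. f i (y i)))"
    using integrable_distr[OF T, of "\<lambda>s. \<Sum>i\<in>I. f i (s i)"] int unfolding D sum by (simp add: case_prod_beta')
  have "(\<lambda>s. \<bar>\<Sum>i\<in>I. f i (s i)\<bar>) \<in> borel_measurable (Pi\<^sub>M I M)"
    using int by auto
  from integral_distr[OF T this]
  show "(\<integral>s. \<bar>\<Sum>i\<in>I. f i (s i)\<bar> \<partial>Pi\<^sub>M I M) = (\<integral>(x, y). \<bar>f t x + (\<Sum>i\<in>J. f i (y i))\<bar> \<partial>(M t \<Otimes>\<^sub>M Pi\<^sub>M J M))"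
    unfolding D sum by (simp add: case_prod_beta')
qed

text \<open>The product structure is essential: for a measure on the diagonal,
  \<open>f x - f y\<close> integrates to \<open>0\<close> whatever \<open>f\<close> is. This is what
  makes potentials of finite cost integrable in each component.\<close>

lemma PiM_sum_integrableD:
  fixes f :: "'i \<Rightarrow> 'a \<Rightarrow> real"
  assumes I: "finite I" "t \<in> I" and M: "\<And>i. i \<in> I \<Longrightarrow> prob_space (M i)"
    and int: "integrable (Pi\<^sub>M I M) (\<lambda>s. \<Sum>i\<in>I. f i (s i))"
  shows "integrable (M t) (f t)"
proof (rule integrable_sum_pairD[OF M[OF I(2)]])
  show "prob_space (Pi\<^sub>M (I - {t}) M)" using M by (intro prob_space_PiM) auto
  show "integrable (M t \<Otimes>\<^sub>M Pi\<^sub>M (I - {t}) M) (\<lambda>(x, y). f t x + (\<Sum>i\<in>I - {t}. f i (y i)))"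
    by (rule PiM_sum_split[OF I M int])
qed

lemma integral_sum_PiM:
  fixes f :: "'i \<Rightarrow> 'a \<Rightarrow> real"
  assumes I: "finite I" and M: "\<And>i. i \<in> I \<Longrightarrow> prob_space (M i)"
    and f: "\<And>i. i \<in> I \<Longrightarrow> integrable (M i) (f i)"
  shows "integrable (Pi\<^sub>M I M) (\<lambda>s. \<Sum>i\<in>I. f i (s i))"
    "(\<integral>s. (\<Sum>i\<in>I. f i (s i)) \<partial>Pi\<^sub>M I M) = (\<Sum>i\<in>I. \<integral>x. f i x \<partial>M i)"
proof -
  have m: "(\<lambda>s. s i) \<in> measurable (Pi\<^sub>M I M) (M i)" if "i \<in> I" for i using that by simp
  have d: "distr (Pi\<^sub>M I M) (M i) (\<lambda>s. s i) = M i" if "i \<in> I" for i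
    using M that by (rule distr_PiM_component)
  show "integrable (Pi\<^sub>M I M) (\<lambda>s. \<Sum>i\<in>I. f i (s i))"
    "(\<integral>s. (\<Sum>i\<in>I. f i (s i)) \<partial>Pi\<^sub>M I M) = (\<Sum>i\<in>I. \<integral>x. f i x \<partial>M i)"
    using integral_sum_marginals[OF I m d f] by blast+
qed

lemma integral_abs_sum_PiM_ge:
  fixes f :: "'i \<Rightarrow> 'a \<Rightarrow> real"
  assumes I: "finite I" "t \<in> I" and M: "\<And>i. i \<in> I \<Longrightarrow> prob_space (M i)"
    and f: "\<And>i. i \<in> I \<Longrightarrow> integrable (M i) (f i)"
  shows "(\<integral>x. \<bar>f t x + (\<Sum>i\<in>I - {t}. \<integral>y. f i y \<partial>M i)\<bar> \<partial>M t) \<le> (\<integral>s. \<bar>\<Sum>i\<in>I. f i (s i)\<bar> \<partial>Pi\<^sub>M I M)"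
proof -
  let ?J = "I - {t}"
  note int = integral_sum_PiM[OF I(1) M f]
  have J: "integrable (Pi\<^sub>M ?J M) (\<lambda>s. \<Sum>i\<in>?J. f i (s i))"
    "(\<integral>s. (\<Sum>i\<in>?J. f i (s i)) \<partial>Pi\<^sub>M ?J M) = (\<Sum>i\<in>?J. \<integral>x. f i x \<partial>M i)"
    using integral_sum_PiM[of ?J M f] I M f by auto
  have "prob_space (Pi\<^sub>M ?J M)" using M by (intro prob_space_PiM) auto
  from integral_abs_sum_pair_ge[OF M[OF I(2)] this PiM_sum_split(1)[OF I M int(1)] f[OF I(2)] J(1)]
  show ?thesis
    unfolding J(2) by (subst PiM_sum_split(2)[OF I M int(1)])
qed

text \<open>The midpoint convexity gap of \<open>exp (- a)\<close> is an exact square, so a small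
  gap forces \<open>exp (- a / 2)\<close> and \<open>exp (- b / 2)\<close> together, in the mean
  square after integration.\<close>

lemma exp_midpoint_gap:
  "exp (- a) / 2 + exp (- b) / 2 - exp (- ((a + b) / 2)) = (exp (- a / 2) - exp (- b / 2))\<^sup>2 / 2"
  for a b :: real
proof -
  have "exp (- a / 2) ^ 2 = exp (- a)" "exp (- b / 2) ^ 2 = exp (- b)"
    "exp (- a / 2) * exp (- b / 2) = exp (- ((a + b) / 2))"
    by (simp_all add: exp_double[symmetric] exp_add[symmetric] add_divide_distrib)
  then show ?thesis by (simp add: power2_diff field_simps)
qed

text \<open>Increments with summable mean are absolutely summable almost everywhere, and the series
  telescopes.\<close>

lemma AE_convergent_of_summable_integral_diff:
  fixes e :: "nat \<Rightarrow> 'a \<Rightarrow> real"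
  assumes m: "\<And>n. e n \<in> borel_measurable M"
    and int: "\<And>n. integrable M (\<lambda>x. \<bar>e (Suc n) x - e n x\<bar>)"
    and s: "summable (\<lambda>n. \<integral>x. \<bar>e (Suc n) x - e n x\<bar> \<partial>M)"
  shows "AE x in M. convergent (\<lambda>n. e n x)"
proof -
  have "(\<integral>\<^sup>+x. (\<Sum>n. ennreal \<bar>e (Suc n) x - e n x\<bar>) \<partial>M) = (\<Sum>n. \<integral>\<^sup>+x. ennreal \<bar>e (Suc n) x - e n x\<bar> \<partial>M)"
    using m by (intro nn_integral_suminf) auto
  also have "\<dots> = (\<Sum>n. ennreal (\<integral>x. \<bar>e (Suc n) x - e n x\<bar> \<partial>M))"
    using int by (intro suminf_cong nn_integral_eq_integral) auto
  also have "\<dots> = ennreal (\<Sum>n. \<integral>x. \<bar>e (Suc n) x - e n x\<bar> \<partial>M)"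
    using s by (intro suminf_ennreal2) auto
  finally have "(\<integral>\<^sup>+x. (\<Sum>n. ennreal \<bar>e (Suc n) x - e n x\<bar>) \<partial>M) \<noteq> \<infinity>" by simp
  then have "AE x in M. (\<Sum>n. ennreal \<bar>e (Suc n) x - e n x\<bar>) \<noteq> \<infinity>"
    using m by (intro nn_integral_PInf_AE) auto
  then show ?thesis
  proof eventually_elim
    case (elim x)
    then have "summable (\<lambda>n. \<bar>e (Suc n) x - e n x\<bar>)"
      by (intro summable_suminf_not_top) auto
    then have "summable (\<lambda>n. e (Suc n) x - e n x)" by (rule summable_rabs_cancel)
    then have "convergent (\<lambda>n. \<Sum>i<n. e (Suc i) x - e i x)" by (simp add: summable_iff_convergent)
    then have "convergent (\<lambda>n. e n x - e 0 x)" by (subst (asm) sum_lessThan_telescope)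
    then show ?case by (simp add: convergent_diff_const_right_iff)
  qed
qed

text \<open>If the limit of \<open>exp (- u n x / 2)\<close> is positive, the logarithm finishes.
  Limit \<open>0\<close> means that \<open>u n x\<close> diverges to infinity, which Fatou's lemma
  and the uniform bound \<open>R\<close> confine to a null set.\<close>

lemma AE_convergent_of_exp_convergent:
  fixes u :: "nat \<Rightarrow> 'a \<Rightarrow> real"
  assumes u: "\<And>n. integrable M (u n)" "\<And>n x. 0 \<le> u n x" "\<And>n. (\<integral>x. u n x \<partial>M) \<le> R"
    and conv: "AE x in M. convergent (\<lambda>n. exp (- u n x / 2))"
  shows "AE x in M. convergent (\<lambda>n. u n x)"
proof -
  have "(\<integral>\<^sup>+x. liminf (\<lambda>n. ennreal (u n x)) \<partial>M) \<le> liminf (\<lambda>n. \<integral>\<^sup>+x. ennreal (u n x) \<partial>M)"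
    using u by (intro nn_integral_liminf) auto
  also have "\<dots> \<le> ennreal R"
    using u by (intro Liminf_le) (auto simp: nn_integral_eq_integral intro!: always_eventually ennreal_leI)
  finally have "(\<integral>\<^sup>+x. liminf (\<lambda>n. ennreal (u n x)) \<partial>M) \<noteq> \<infinity>" by (auto simp: top_unique)
  then have "AE x in M. liminf (\<lambda>n. ennreal (u n x)) \<noteq> \<infinity>"
    using u by (intro nn_integral_PInf_AE) auto
  with conv show ?thesis
  proof eventually_elim
    case (elim x)
    then obtain l where l: "(\<lambda>n. exp (- u n x / 2)) \<longlonglongrightarrow> l" by (auto simp: convergent_def)
    have "0 \<le> l" by (rule LIMSEQ_le_const[OF l]) auto
    moreover have "l \<noteq> 0"
    proof
      assume "l = 0"
      then have "filterlim (\<lambda>n. exp (- u n x / 2)) (at_right 0) sequentially"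
        using l by (auto simp: filterlim_at intro!: always_eventually)
      from filterlim_compose[OF ln_at_0 this]
      have "filterlim (\<lambda>n. - u n x / 2) at_bot sequentially" by simp
      then have "filterlim (\<lambda>n. u n x / 2) at_top sequentially"
        by (simp add: filterlim_uminus_at_bot)
      from filterlim_tendsto_pos_mult_at_top[OF tendsto_const[of 2] _ this]
      have "filterlim (\<lambda>n. u n x) at_top sequentially" by simp
      then have "(\<lambda>n. ennreal (u n x)) \<longlonglongrightarrow> \<infinity>"
        by (simp add: ennreal_tendsto_top_eq_at_top)
      then have "liminf (\<lambda>n. ennreal (u n x)) = \<infinity>" by (intro lim_imp_Liminf) auto
      then show False using elim by simp
    qed
    ultimately have "(\<lambda>n. ln (exp (- u n x / 2))) \<longlonglongrightarrow> ln l" by (intro tendsto_ln l)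
    then have "(\<lambda>n. - 2 * ln (exp (- u n x / 2))) \<longlonglongrightarrow> - 2 * ln l" by (intro tendsto_mult tendsto_const)
    then show ?case by (auto simp: convergent_def)
  qed
qed

text \<open>The sequence is nearly optimal for the strictly convex functional \<open>g \<mapsto> \<Sum>\<^sub>j \<integral> exp (- g\<^sub>j)\<close>;
  midpoint closedness then bounds the convexity gap of consecutive members.\<close>

lemma midpoint_closed_AE_convergent:
  fixes M :: "'j \<Rightarrow> 'a measure" and D :: "nat \<Rightarrow> ('j \<Rightarrow> 'a \<Rightarrow> real) set"
  assumes J: "finite J" and M: "\<And>j. j \<in> J \<Longrightarrow> finite_measure (M j)"
    and ne: "\<And>n. D n \<noteq> {}" and dec: "\<And>n. D (Suc n) \<subseteq> D n"
    and mid: "\<And>n g h. g \<in> D n \<Longrightarrow> h \<in> D n \<Longrightarrow> (\<lambda>j x. (g j x + h j x) / 2) \<in> D n"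
    and nonneg: "\<And>n g j x. g \<in> D n \<Longrightarrow> 0 \<le> g j x"
    and int: "\<And>n g j. g \<in> D n \<Longrightarrow> j \<in> J \<Longrightarrow> integrable (M j) (g j)"
    and bound: "\<And>n g j. g \<in> D n \<Longrightarrow> j \<in> J \<Longrightarrow> (\<integral>x. g j x \<partial>M j) \<le> R"
  obtains g where "\<And>n. g n \<in> D n" "\<And>j. j \<in> J \<Longrightarrow> AE x in M j. convergent (\<lambda>n. g n j x)"
proof -
  define F where "F = (\<lambda>g :: 'j \<Rightarrow> 'a \<Rightarrow> real. \<Sum>j\<in>J. \<integral>x. exp (- g j x) \<partial>M j)"
  define V where "V = (\<lambda>n. Inf (F ` D n))"
  define W where "W = (\<Sum>j\<in>J. measure (M j) (space (M j)))"
  have D_mono: "D n \<subseteq> D k" if "k \<le> n" for k n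
    using that dec by (rule lift_Suc_antimono_le[rotated])
  have eint: "integrable (M j) (\<lambda>x. exp (- g j x))" if "g \<in> D n" "j \<in> J" for g n j
  proof -
    interpret finite_measure "M j" using M that by blast
    show ?thesis
      using nonneg[OF that(1)] int[OF that]
      by (intro integrable_const_bound[where B = 1]) auto
  qed
  have F0: "0 \<le> F g" for g unfolding F_def by (intro sum_nonneg integral_nonneg) auto
  have FW: "F g \<le> W" if "g \<in> D n" for g n
    unfolding F_def W_def
  proof (rule sum_mono)
    fix j assume j: "j \<in> J"
    interpret finite_measure "M j" using M j by blast
    have "(\<integral>x. exp (- g j x) \<partial>M j) \<le> (\<integral>x. 1 \<partial>M j)"
      using nonneg[OF that] eint[OF that j] by (intro integral_mono) auto
    then show "(\<integral>x. exp (- g j x) \<partial>M j) \<le> measure (M j) (space (M j))" by simp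
  qed
  have bdd: "bdd_below (F ` D n)" for n using F0 by (intro bdd_belowI2[where m = 0]) auto
  have V_le: "V n \<le> F g" if "g \<in> D n" for g n unfolding V_def using bdd that by (intro cINF_lower) auto
  have V_mono: "V k \<le> V n" if "k \<le> n" for k n
    unfolding V_def using ne bdd D_mono[OF that] by (intro cINF_superset_mono) auto
  have "V n \<le> W" for n using ne V_le FW by (meson all_not_in_conv order_trans)
  then obtain L where L: "V \<longlonglongrightarrow> L" "\<And>n. V n \<le> L"
    using incseq_convergent[of V W] V_mono by (auto simp: incseq_def)
  \<comment> \<open>Tolerances of order \<open>(1/4) ^ n\<close> remain summable after
    multiplication by the weight \<open>2 ^ n\<close> that appears below.\<close>
  define \<delta> where "\<delta> = (\<lambda>n::nat. (1/4::real) ^ n)"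
  have "\<forall>n. \<exists>k. \<forall>i\<ge>k. L - \<delta> n < V i"
    using order_tendstoD(1)[OF L(1)] by (auto simp: eventually_sequentially \<delta>_def)
  then obtain k0 where k0: "\<And>n i. k0 n \<le> i \<Longrightarrow> L - \<delta> n < V i" by metis
  \<comment> \<open>Summing all thresholds up to \<open>n\<close> and adding \<open>n\<close> makes
    \<open>k\<close> monotone and at least both \<open>n\<close> and \<open>k0 n\<close>.\<close>
  define k where "k = (\<lambda>n. n + (\<Sum>i\<le>n. k0 i))"
  have k: "n \<le> k n" "k n \<le> k (Suc n)" "k0 n \<le> k n" for n
    unfolding k_def by (auto intro!: trans_le_add2 member_le_sum)
  have "\<exists>g\<in>D (k n). F g < V (k n) + \<delta> n" for n
  proof -
    have "Inf (F ` D (k n)) < V (k n) + \<delta> n" by (simp add: V_def \<delta>_def)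
    then show ?thesis using cInf_lessD[of "F ` D (k n)"] ne by blast
  qed
  then obtain g where g: "\<And>n. g n \<in> D (k n)" "\<And>n. F (g n) < V (k n) + \<delta> n" by metis
  have gD: "g n \<in> D n" for n using g(1) D_mono[OF k(1)] by blast
  have conv: "AE x in M j. convergent (\<lambda>n. g n j x)" if j: "j \<in> J" for j
  proof -
    interpret finite_measure "M j" using M j by blast
    define e where "e = (\<lambda>n x. exp (- g n j x / 2))"
    have em: "e n \<in> borel_measurable (M j)" for n
      unfolding e_def using int[OF gD j] by auto
    have e01: "0 \<le> e n x" "e n x \<le> 1" for n x
      unfolding e_def using nonneg[OF gD] by auto
    have sq: "integrable (M j) (\<lambda>x. (e (Suc n) x - e n x)\<^sup>2)" for n
    proof (rule integrable_const_bound[where B = 1])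
      show "AE x in M j. norm ((e (Suc n) x - e n x)\<^sup>2) \<le> 1"
        using e01[of n] e01[of "Suc n"] by (auto intro!: AE_I2 simp: abs_square_le_1 abs_le_iff add_increasing add_increasing2 diff_le_eq)
    qed (use em in auto)
    \<comment> \<open>Members \<open>n\<close> and \<open>Suc n\<close> lie in
      \<open>D (k n)\<close>, and so does their midpoint. The values are at most
      \<open>L + \<delta> n\<close> at the ends and at least \<open>L - \<delta> n\<close> in the
      middle, so the total gap is at most \<open>2 * \<delta> n\<close>. Its summands are
      nonnegative, and the square comes with a factor one half.\<close>
    have gap: "(\<integral>x. (e (Suc n) x - e n x)\<^sup>2 \<partial>M j) \<le> 4 * \<delta> n" for n
    proof -
      let ?a = "g (Suc n)" and ?b = "g n"
      let ?m = "\<lambda>j x. (?a j x + ?b j x) / 2"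
      have aD: "?a \<in> D (k n)" using g(1) D_mono[OF k(2)] by blast
      note bD = g(1)[of n]
      have mD: "?m \<in> D (k n)" by (rule mid[OF aD bD])
      let ?G = "\<lambda>j x. exp (- ?a j x) / 2 + exp (- ?b j x) / 2 - exp (- ?m j x)"
      have Gi: "integrable (M i) (?G i)" if "i \<in> J" for i
        using eint[OF aD that] eint[OF bD that] eint[OF mD that] by auto
      have Gpos: "0 \<le> (\<integral>x. ?G i x \<partial>M i)" for i
        unfolding exp_midpoint_gap by (intro Bochner_Integration.integral_nonneg) simp
      have "(\<integral>x. (e (Suc n) x - e n x)\<^sup>2 / 2 \<partial>M j) = (\<integral>x. ?G j x \<partial>M j)"
        unfolding e_def exp_midpoint_gap ..
      also have "\<dots> \<le> (\<Sum>i\<in>J. \<integral>x. ?G i x \<partial>M i)"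
        using J j Gpos by (intro member_le_sum) auto
      also have "\<dots> = F ?a / 2 + F ?b / 2 - F ?m"
        unfolding F_def sum_divide_distrib sum.distrib[symmetric] sum_subtractf[symmetric]
        using eint[OF aD] eint[OF bD] eint[OF mD] by (intro sum.cong) auto
      also have "\<dots> \<le> 2 * \<delta> n"
      proof -
        have "\<delta> (Suc n) \<le> \<delta> n" by (simp add: \<delta>_def)
        then have "F ?a \<le> L + \<delta> n" using g(2)[of "Suc n"] L(2)[of "k (Suc n)"] by linarith
        moreover have "F ?b \<le> L + \<delta> n" using g(2)[of n] L(2)[of "k n"] by auto
        moreover have "L - \<delta> n \<le> F ?m" using V_le[OF mD] k0[OF k(3), of n] by simp
        ultimately show ?thesis by simp
      qed
      finally show ?thesis by simp
    qed
    \<comment> \<open>Young's inequality with weights \<open>(1/2) ^ n\<close> and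
      \<open>2 ^ n\<close> turns the mean square bound into a summable mean bound; the constant term
      is integrable because the measure is finite.\<close>
    have amgm: "\<bar>d\<bar> \<le> (1/2) ^ n + 2 ^ n * d\<^sup>2" for d :: real and n :: nat
    proof -
      have "0 \<le> ((1/2) ^ n - \<bar>d\<bar> / 2)\<^sup>2 * 2 ^ n" by simp
      also have "\<dots> = (1/2) ^ n - \<bar>d\<bar> + 2 ^ n * d\<^sup>2 / 4"
        by (simp add: power2_eq_square field_simps power_mult_distrib power_divide)
      finally have "\<bar>d\<bar> \<le> (1/2) ^ n + 2 ^ n * d\<^sup>2 / 4" by simp
      moreover have "0 \<le> 2 ^ n * d\<^sup>2" by simp
      ultimately show ?thesis by linarith
    qed
    have dint: "integrable (M j) (\<lambda>x. \<bar>e (Suc n) x - e n x\<bar>)" for n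
      by (rule integrable_const_bound[where B = 1])
        (use em e01[of n] e01[of "Suc n"] in \<open>auto intro!: AE_I2 simp: abs_le_iff add_increasing add_increasing2 diff_le_eq\<close>)
    have le: "(\<integral>x. \<bar>e (Suc n) x - e n x\<bar> \<partial>M j) \<le> (measure (M j) (space (M j)) + 4) * (1/2) ^ n" for n
    proof -
      have "(\<integral>x. \<bar>e (Suc n) x - e n x\<bar> \<partial>M j) \<le> (\<integral>x. (1/2) ^ n + 2 ^ n * (e (Suc n) x - e n x)\<^sup>2 \<partial>M j)"
        by (intro integral_mono dint) (use sq amgm in auto)
      also have "\<dots> = (1/2) ^ n * measure (M j) (space (M j)) + 2 ^ n * (\<integral>x. (e (Suc n) x - e n x)\<^sup>2 \<partial>M j)"
        using sq by simp
      also have "\<dots> \<le> (1/2) ^ n * measure (M j) (space (M j)) + 2 ^ n * (4 * \<delta> n)"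
        using gap by (intro add_mono mult_left_mono) auto
      also have "2 ^ n * (4 * \<delta> n) = 4 * (1/2) ^ n"
        by (simp add: \<delta>_def power_mult_distrib[symmetric])
      finally show ?thesis by (simp add: algebra_simps)
    qed
    have "summable (\<lambda>n. (measure (M j) (space (M j)) + 4) * (1/2::real) ^ n)"
      by (intro summable_mult summable_geometric) auto
    then have "summable (\<lambda>n. \<integral>x. \<bar>e (Suc n) x - e n x\<bar> \<partial>M j)"
      by (rule summable_comparison_test'[where N = 0]) (use le in auto)
    then have "AE x in M j. convergent (\<lambda>n. e n x)"
      by (intro AE_convergent_of_summable_integral_diff em dint)
    then show ?thesis
      unfolding e_def
      by (rule AE_convergent_of_exp_convergent[OF int[OF gD j] nonneg[OF gD] bound[OF gD j]])
  qed
  show thesis by (rule that[OF gD conv])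
qed

section \<open>Plans and potentials\<close>

locale transport_problem =
  fixes T :: nat
    and S :: "nat \<Rightarrow> 'a topology"
    and \<psi> :: "nat \<Rightarrow> 'a \<Rightarrow> real"
    and \<mu> :: "nat \<Rightarrow> 'a measure"
    and c :: "(nat \<Rightarrow> 'a) \<Rightarrow> real"
    and K :: real
  assumes Polish: "\<And>t. t \<le> T \<Longrightarrow> Polish_space (S t)"
    and continuous_weight: "\<And>t. t \<le> T \<Longrightarrow> continuous_map (S t) euclideanreal (\<psi> t)"
    and mu_weighted: "\<And>t. t \<le> T \<Longrightarrow> \<mu> t \<in> weighted_measures (S t) (\<psi> t)"
    and prob_mu: "\<And>t. t \<le> T \<Longrightarrow> prob_space (\<mu> t)"
    and lsc_cost: "lower_semicontinuous_map (prod_space T S) c"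
    and integrable_cost: "integrable (Pi\<^sub>M {..T} \<mu>) c"
    and cost_ge: "\<And>s. s \<in> topspace (prod_space T S) \<Longrightarrow> K * separable_sum T \<psi> s \<le> c s"
begin

abbreviation "X \<equiv> prod_space T S"
abbreviation "\<P> \<equiv> Pi\<^sub>M {..T} \<mu>"
abbreviation "plans \<equiv> transport_plans T S \<psi> \<mu>"
abbreviation "potentials \<equiv> dual_potentials T S \<mu> c"
abbreviation "integrable_family x \<equiv> \<forall>t\<le>T. integrable (\<mu> t) (x t)"

definition marginal_integral :: "(nat \<Rightarrow> 'a \<Rightarrow> real) \<Rightarrow> real" where
  "marginal_integral x = (\<Sum>t\<le>T. \<integral>a. x t a \<partial>\<mu> t)"

text \<open>Restricted to integrable components, so that \<open>marginal_integral\<close> never uses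
  the default value \<open>0\<close> of a missing integral. Potentials of finite dual cost turn out
  to be of this kind, so nothing is lost.\<close>

definition max_value :: real where
  "max_value = Sup {- marginal_integral x |x. x \<in> potentials \<and> integrable_family x}"

section \<open>Plans, their marginals and weak duality\<close>

lemma sets_mu: "t \<le> T \<Longrightarrow> sets (\<mu> t) = sets (borel_of (S t))"
  using mu_weighted by (simp add: weighted_measures_def)

lemma space_mu: "t \<le> T \<Longrightarrow> space (\<mu> t) = topspace (S t)"
  using sets_eq_imp_space_eq[OF sets_mu] by simp

lemma measurable_mu: "t \<le> T \<Longrightarrow> measurable (\<mu> t) N = measurable (borel_of (S t)) N"
  by (rule measurable_cong_sets[OF sets_mu refl])

lemma integrable_weight: "t \<le> T \<Longrightarrow> integrable (\<mu> t) (\<psi> t)"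
  using mu_weighted by (simp add: weighted_measures_def)

lemma Polish': "\<forall>t\<in>{..T}. Polish_space (S t)"
  using Polish by simp

lemma sets_P: "sets \<P> = sets (borel_of X)"
proof -
  have "sets \<P> = sets (Pi\<^sub>M {..T} (\<lambda>t. borel_of (S t)))"
    by (rule sets_PiM_cong) (simp_all add: sets_mu)
  then show ?thesis using sets_PiM_borel_of[OF _ Polish'] by simp
qed

lemma prob_P: "prob_space \<P>"
  by (rule prob_space_PiM) (simp add: prob_mu)

lemma projection_measurable: "t \<le> T \<Longrightarrow> (\<lambda>s. s t) \<in> measurable (borel_of X) (borel_of (S t))"
  by (intro continuous_map_measurable_borel_of continuous_map_product_projection) simp

lemma cost_measurable: "c \<in> borel_measurable (borel_of X)"
  by (rule lower_semicontinuous_borel_measurable[OF lsc_cost])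

lemma separable_sum_measurable:
  "(\<And>t. t \<le> T \<Longrightarrow> x t \<in> borel_measurable (borel_of (S t))) \<Longrightarrow>
    separable_sum T x \<in> borel_measurable (borel_of X)"
  unfolding separable_sum_def[abs_def]
  by (intro borel_measurable_sum) (auto intro: measurable_compose[OF projection_measurable])

lemma separable_integral_marginals:
  assumes "sets \<nu> = sets (borel_of X)" "\<And>t. t \<le> T \<Longrightarrow> marginal S \<nu> t = \<mu> t" "integrable_family x"
  shows "integrable \<nu> (separable_sum T x)" "(\<integral>s. separable_sum T x s \<partial>\<nu>) = marginal_integral x"
proof -
  have m: "(\<lambda>s. s t) \<in> measurable \<nu> (\<mu> t)" if "t \<in> {..T}" for t
    using projection_measurable[of t] that measurable_cong_sets[OF assms(1) sets_mu[of t]] by simp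
  have d: "distr \<nu> (\<mu> t) (\<lambda>s. s t) = \<mu> t" if "t \<in> {..T}" for t
  proof -
    have "distr \<nu> (\<mu> t) (\<lambda>s. s t) = marginal S \<nu> t"
      unfolding marginal_def using that by (intro distr_cong sets_mu) auto
    then show ?thesis using assms(2) that by simp
  qed
  note * = integral_sum_marginals[where f = x and N = \<nu> and M = \<mu>, OF finite_atMost m d]
  show "integrable \<nu> (separable_sum T x)" "(\<integral>s. separable_sum T x s \<partial>\<nu>) = marginal_integral x"
    unfolding separable_sum_def[abs_def] marginal_integral_def by (rule *; use assms(3) in simp)+
qed

lemma planD:
  assumes "\<nu> \<in> plans"
  shows "sets \<nu> = sets (borel_of X)" "space \<nu> = topspace X" "\<And>t. t \<le> T \<Longrightarrow> marginal S \<nu> t = \<mu> t"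
    "finite_measure \<nu>"
  using assms sets_eq_imp_space_eq[of \<nu> "borel_of X"]
  by (auto simp: transport_plans_def weighted_measures_def)

lemma plan_integral:
  assumes "\<nu> \<in> plans" "integrable_family x"
  shows "integrable \<nu> (separable_sum T x)" "(\<integral>s. separable_sum T x s \<partial>\<nu>) = marginal_integral x"
  using separable_integral_marginals[OF planD(1) planD(3) assms(2)] assms(1) by blast+

lemma plan_measurable: "\<nu> \<in> plans \<Longrightarrow> measurable \<nu> N = measurable (borel_of X) N"
  by (rule measurable_cong_sets[OF planD(1) refl])

text \<open>The weight is separable, so the marginals already decide its integrability.\<close>

lemma planI:
  assumes \<nu>: "sets \<nu> = sets (borel_of X)" "\<And>t. t \<le> T \<Longrightarrow> marginal S \<nu> t = \<mu> t" and fin: "finite_measure \<nu>"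
  shows "\<nu> \<in> plans"
  using assms separable_integral_marginals[OF \<nu>, of \<psi>] integrable_weight
  by (auto simp: transport_plans_def weighted_measures_def)

lemma plan_prob:
  assumes "\<nu> \<in> plans" shows "prob_space \<nu>"
proof
  have m: "(\<lambda>s. s 0) \<in> measurable \<nu> (borel_of (S 0))"
    using projection_measurable[of 0] plan_measurable[OF assms] by blast
  have "emeasure \<nu> (space \<nu>) = emeasure (marginal S \<nu> 0) (space (marginal S \<nu> 0))"
    unfolding marginal_def using measurable_space[OF m]
    by (subst emeasure_distr[OF m]) (auto simp: openin_sets_borel_of intro!: arg_cong[of _ _ "emeasure \<nu>"])
  then show "emeasure \<nu> (space \<nu>) = 1"
    using planD(3)[OF assms] prob_space.emeasure_space_1[OF prob_mu] by simp
qed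

lemma product_plan: "\<P> \<in> plans"
proof (rule planI[OF sets_P])
  show "finite_measure \<P>" using prob_P by (simp add: prob_space_def)
  fix t assume t: "t \<le> T"
  have "marginal S \<P> t = distr \<P> (\<mu> t) (\<lambda>s. s t)"
    unfolding marginal_def using sets_mu[OF t] by (intro distr_cong) auto
  also have "\<dots> = \<mu> t" using t prob_mu by (intro distr_PiM_component) auto
  finally show "marginal S \<P> t = \<mu> t" .
qed

text \<open>A plan may be singular to the product measure, and a null set of \<open>\<P>\<close>
  could carry all its mass. A product of full sets is safe because each factor is seen by a
  marginal.\<close>

lemma AE_plan_full_product:
  assumes \<nu>: "\<nu> \<in> plans" and A: "\<And>t. t \<le> T \<Longrightarrow> A t \<in> sets (borel_of (S t)) \<and> measure (\<mu> t) (A t) = 1"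
  shows "AE s in \<nu>. s \<in> (\<Pi>\<^sub>E t\<in>{..T}. A t)"
proof -
  have "AE s in \<nu>. s t \<in> A t" if t: "t \<le> T" for t
  proof -
    interpret prob_space "\<mu> t" using prob_mu[OF t] .
    have m: "(\<lambda>s. s t) \<in> measurable \<nu> (borel_of (S t))"
      using projection_measurable[OF t] plan_measurable[OF \<nu>] by blast
    have "AE a in \<mu> t. a \<in> A t" using A[OF t] sets_mu[OF t] AE_in_set_eq_1 by blast
    then have "AE a in distr \<nu> (borel_of (S t)) (\<lambda>s. s t). a \<in> A t"
      unfolding marginal_def[symmetric] planD(3)[OF \<nu> t] .
    then show ?thesis by (rule AE_distrD[OF m])
  qed
  then have "AE s in \<nu>. \<forall>t\<in>{..T}. s t \<in> A t" by (intro AE_finite_allI) auto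
  with AE_space show ?thesis
    by eventually_elim (auto simp: planD(2)[OF \<nu>] PiE_iff)
qed

lemma potential_AE:
  assumes "x \<in> potentials" "\<nu> \<in> plans"
  shows "AE s in \<nu>. 0 \<le> c s + separable_sum T x s"
proof -
  obtain A where A: "\<forall>t\<le>T. A t \<in> sets (borel_of (S t)) \<and> measure (\<mu> t) (A t) = 1"
    "\<forall>s \<in> (\<Pi>\<^sub>E t\<in>{..T}. A t). - separable_sum T x s \<le> c s"
    using assms(1) unfolding dual_potentials_def by blast
  have "AE s in \<nu>. s \<in> (\<Pi>\<^sub>E t\<in>{..T}. A t)"
    by (rule AE_plan_full_product[OF assms(2)]) (use A(1) in blast)
  then show ?thesis by eventually_elim (use A(2) in force)
qed

lemma potential_measurable: "x \<in> potentials \<Longrightarrow> t \<le> T \<Longrightarrow> x t \<in> borel_measurable (borel_of (S t))"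
  by (simp add: dual_potentials_def)

lemma potentialI:
  assumes "integrable_family x" "\<And>s. s \<in> topspace X \<Longrightarrow> - separable_sum T x s \<le> c s"
  shows "x \<in> potentials"
  unfolding dual_potentials_def
proof (intro CollectI conjI exI[of _ "\<lambda>t. topspace (S t)"] allI impI ballI)
  fix t assume t: "t \<le> T"
  show "x t \<in> borel_measurable (borel_of (S t))"
    using assms(1) t borel_measurable_integrable measurable_mu[OF t] by blast
  show "topspace (S t) \<in> sets (borel_of (S t))" by (rule closedin_sets_borel_of) simp
  show "measure (\<mu> t) (topspace (S t)) = 1"
    using prob_space.prob_space[OF prob_mu[OF t]] space_mu[OF t] by simp
next
  fix s assume "s \<in> (\<Pi>\<^sub>E t\<in>{..T}. topspace (S t))"
  then show "- separable_sum T x s \<le> c s" using assms(2) by simp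
qed

text \<open>The constraint makes \<open>c + \<Sum> x\<close> nonnegative almost everywhere under the
  plan, and the integral of the separable part is determined by the marginals.\<close>

lemma weak_duality:
  assumes "x \<in> potentials" "integrable_family x" "\<nu> \<in> plans" "integrable \<nu> c"
  shows "integrable \<nu> (\<lambda>s. c s + separable_sum T x s)"
    "(\<integral>s. c s + separable_sum T x s \<partial>\<nu>) = (\<integral>s. c s \<partial>\<nu>) + marginal_integral x"
    "0 \<le> (\<integral>s. c s \<partial>\<nu>) + marginal_integral x"
proof -
  note * = plan_integral[OF assms(3,2)]
  show 1: "integrable \<nu> (\<lambda>s. c s + separable_sum T x s)" using * assms(4) by simp
  show 2: "(\<integral>s. c s + separable_sum T x s \<partial>\<nu>) = (\<integral>s. c s \<partial>\<nu>) + marginal_integral x"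
    using * assms(4) by simp
  show "0 \<le> (\<integral>s. c s \<partial>\<nu>) + marginal_integral x"
    unfolding 2[symmetric] by (rule integral_nonneg_AE[OF potential_AE[OF assms(1,3)]])
qed

section \<open>Arithmetic of separable families and domination by them\<close>

lemma marginal_integral_add:
  "integrable_family x \<Longrightarrow> integrable_family y \<Longrightarrow>
    marginal_integral (\<lambda>t a. x t a + y t a) = marginal_integral x + marginal_integral y"
  by (simp add: marginal_integral_def sum.distrib)

lemma marginal_integral_mult: "marginal_integral (\<lambda>t a. r * x t a) = r * marginal_integral x"
  by (simp add: marginal_integral_def sum_distrib_left)

lemma separable_sum_add:
  "separable_sum T (\<lambda>t a. x t a + y t a) s = separable_sum T x s + separable_sum T y s"
  by (simp add: separable_sum_def sum.distrib)

lemma separable_sum_mult: "separable_sum T (\<lambda>t a. r * x t a) s = r * separable_sum T x s"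
  by (simp add: separable_sum_def sum_distrib_left)

text \<open>A constant written as a separable sum: all of it goes into component \<open>0\<close>,
  which is present for every \<open>T\<close>.\<close>

definition constant_family :: "real \<Rightarrow> nat \<Rightarrow> 'a \<Rightarrow> real" where
  "constant_family r = (\<lambda>t a. if t = 0 then r else 0)"

lemma constant_family:
  "separable_sum T (constant_family r) s = r" "marginal_integral (constant_family r) = r"
  "integrable_family (constant_family r)"
proof -
  show "separable_sum T (constant_family r) s = r"
    by (simp add: separable_sum_def constant_family_def)
  have "(\<integral>a. (if t = 0 then r else 0) \<partial>\<mu> t) = (if t = 0 then r else 0)" if "t \<le> T" for t
    using prob_space.prob_space[OF prob_mu[OF that]] by simp
  then have "marginal_integral (constant_family r) = (\<Sum>t\<le>T. if t = 0 then r else 0)"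
    unfolding marginal_integral_def constant_family_def by (intro sum.cong) auto
  then show "marginal_integral (constant_family r) = r" by simp
  show "integrable_family (constant_family r)"
    using prob_mu by (auto simp: constant_family_def prob_space_def finite_measure.integrable_const)
qed

text \<open>The lower bound on the cost is itself a dual constraint; it shows that the supremum in
  \<open>max_value\<close> runs over a nonempty set.\<close>

lemma weight_potential:
  "(\<lambda>t a. - K * \<psi> t a) \<in> potentials" "integrable_family (\<lambda>t a. - K * \<psi> t a)"
proof -
  show i: "integrable_family (\<lambda>t a. - K * \<psi> t a)" using integrable_weight by auto
  show "(\<lambda>t a. - K * \<psi> t a) \<in> potentials"
    by (rule potentialI[OF i]) (use cost_ge separable_sum_mult[of "- K" \<psi>] in simp)
qed

text \<open>A real supremum needs an upper bound, and weak duality against the product plan, whose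
  cost is integrable, provides one.\<close>

lemma le_max_value:
  assumes "x \<in> potentials" "integrable_family x" shows "- marginal_integral x \<le> max_value"
  unfolding max_value_def
proof (rule cSup_upper)
  show "bdd_above {- marginal_integral x |x. x \<in> potentials \<and> integrable_family x}"
  proof (rule bdd_aboveI)
    fix r assume "r \<in> {- marginal_integral x |x. x \<in> potentials \<and> integrable_family x}"
    then obtain x where x: "r = - marginal_integral x" "x \<in> potentials" "integrable_family x" by blast
    show "r \<le> (\<integral>s. c s \<partial>\<P>)"
      using weak_duality(3)[OF x(2,3) product_plan integrable_cost] x(1) by simp
  qed
qed (use assms in blast)

lemma max_value_less:
  assumes "0 < e"
  shows "\<exists>x. x \<in> potentials \<and> integrable_family x \<and> max_value - e < - marginal_integral x"
proof -
  have "\<exists>r\<in>{- marginal_integral x |x. x \<in> potentials \<and> integrable_family x}. max_value - e < r"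
  proof (rule less_cSupD)
    show "{- marginal_integral x |x. x \<in> potentials \<and> integrable_family x} \<noteq> {}"
      using weight_potential by blast
    show "max_value - e < Sup {- marginal_integral x |x. x \<in> potentials \<and> integrable_family x}"
      using assms unfolding max_value_def by simp
  qed
  then show ?thesis by blast
qed

text \<open>Dominations with \<open>a = 0\<close> will fix the marginals of the functional; one with
  \<open>a = 1\<close> will bound it on bounded functions below \<open>c - K \<psi>\<close>. Letting
  \<open>a\<close> range over all nonnegative numbers makes the price positively
  homogeneous.\<close>

definition dominates :: "(nat \<Rightarrow> 'a \<Rightarrow> real) \<Rightarrow> real \<Rightarrow> ((nat \<Rightarrow> 'a) \<Rightarrow> real) \<Rightarrow> bool" where
  "dominates x a f \<longleftrightarrow> 0 \<le> a \<and> integrable_family x \<and>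
     (\<forall>s\<in>topspace X. f s \<le> separable_sum T x s + a * c s)"

lemma dominatesD:
  assumes "dominates x a f"
  shows "0 \<le> a" "integrable_family x" "\<And>s. s \<in> topspace X \<Longrightarrow> f s \<le> separable_sum T x s + a * c s"
  using assms unfolding dominates_def by blast+

text \<open>For \<open>a > 0\<close> the shifted and scaled family \<open>(x + B) / a\<close> is a
  potential, so its value is at most \<open>max_value\<close>. For \<open>a = 0\<close> the
  inequality is integrated against the product measure. Hence prices of bounded functions are
  bounded below.\<close>

lemma dominates_ge:
  assumes "dominates x a f" "\<And>s. - B \<le> f s"
  shows "- B \<le> marginal_integral x + a * max_value"
proof (cases "a = 0")
  case True
  interpret prob_space \<P> by (rule prob_P)
  note * = plan_integral[OF product_plan, of x]
  have "- B \<le> (\<integral>s. separable_sum T x s \<partial>\<P>)"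
  proof (rule integral_ge_const)
    show "integrable \<P> (separable_sum T x)" using * assms(1) by (simp add: dominates_def)
    show "AE s in \<P>. - B \<le> separable_sum T x s"
    proof (rule AE_I2)
      fix s assume "s \<in> space \<P>"
      then have "f s \<le> separable_sum T x s"
        using dominatesD(3)[OF assms(1)] True unfolding planD(2)[OF product_plan] by fastforce
      then show "- B \<le> separable_sum T x s" using assms(2)[of s] by simp
    qed
  qed
  then show ?thesis using * assms(1) True by (simp add: dominates_def)
next
  case False
  then have a: "0 < a" using assms(1) by (simp add: dominates_def)
  define y where "y = (\<lambda>t r. (1 / a) * (x t r + constant_family B t r))"
  have x: "integrable_family x" using assms(1) by (simp add: dominates_def)
  have y: "integrable_family y" using x constant_family(3) by (auto simp: y_def)
  have "- separable_sum T y s \<le> c s" if "s \<in> topspace X" for s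
  proof -
    have "- B \<le> separable_sum T x s + a * c s"
      using assms(2)[of s] dominatesD(3)[OF assms(1) that] by simp
    then show ?thesis using a
      unfolding y_def separable_sum_mult separable_sum_add constant_family by (simp add: field_simps)
  qed
  from le_max_value[OF potentialI[OF y this] y]
  have "- ((marginal_integral x + B) / a) \<le> max_value"
    unfolding y_def marginal_integral_mult
    using marginal_integral_add[OF x constant_family(3), of B] constant_family(2)[of B] by simp
  then show ?thesis using a by (simp add: field_simps)
qed

end

section \<open>The dominated functional\<close>

context transport_problem
begin

text \<open>A superreplication price: separable functions cost their marginal integrals, and the
  cost function is bought at \<open>max_value\<close>. For bounded \<open>f\<close> the set is
  nonempty and bounded below, so the real infimum is genuine.\<close>

definition upper_price :: "((nat \<Rightarrow> 'a) \<Rightarrow> real) \<Rightarrow> real" where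
  "upper_price f = Inf {marginal_integral x + a * max_value |x a. dominates x a f}"

lemma upper_price_le:
  assumes "dominates x a f" "\<And>s. \<bar>f s\<bar> \<le> B"
  shows "upper_price f \<le> marginal_integral x + a * max_value"
  unfolding upper_price_def
proof (rule cInf_lower)
  show "bdd_below {marginal_integral x + a * max_value |x a. dominates x a f}"
  proof (rule bdd_belowI)
    fix r assume "r \<in> {marginal_integral x + a * max_value |x a. dominates x a f}"
    then obtain x a where "r = marginal_integral x + a * max_value" "dominates x a f" by blast
    then show "- B \<le> r" using dominates_ge[of x a f B] assms(2) by (auto simp: abs_le_iff minus_le_iff)
  qed
qed (use assms in blast)

lemma dominates_constant:
  assumes "\<And>s. \<bar>f s\<bar> \<le> B" shows "dominates (constant_family B) 0 f"
  using assms constant_family by (auto simp: dominates_def abs_le_iff)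

lemma upper_price_ge:
  assumes "\<And>x a. dominates x a f \<Longrightarrow> r \<le> marginal_integral x + a * max_value" "\<And>s. \<bar>f s\<bar> \<le> B"
  shows "r \<le> upper_price f"
  unfolding upper_price_def
proof (rule cInf_greatest)
  have "dominates (constant_family B) 0 f" by (rule dominates_constant[OF assms(2)])
  then show "{marginal_integral x + a * max_value |x a. dominates x a f} \<noteq> {}"
    by blast
  fix z assume "z \<in> {marginal_integral x + a * max_value |x a. dominates x a f}"
  then obtain x a where "z = marginal_integral x + a * max_value" "dominates x a f" by blast
  then show "r \<le> z" using assms(1) by simp
qed

lemma dominates_add:
  assumes "dominates x a f" "dominates y b g"
  shows "dominates (\<lambda>t r. x t r + y t r) (a + b) (\<lambda>s. f s + g s)"
  unfolding dominates_def separable_sum_add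
proof (intro conjI ballI)
  show "0 \<le> a + b" using assms[THEN dominatesD(1)] by simp
  show "integrable_family (\<lambda>t r. x t r + y t r)" using assms[THEN dominatesD(2)] by auto
  fix s assume s: "s \<in> topspace X"
  show "f s + g s \<le> separable_sum T x s + separable_sum T y s + (a + b) * c s"
    using dominatesD(3)[OF assms(1) s] dominatesD(3)[OF assms(2) s] by (simp add: algebra_simps)
qed

lemma dominates_mult:
  assumes "dominates x a f" "0 \<le> r"
  shows "dominates (\<lambda>t z. r * x t z) (r * a) (\<lambda>s. r * f s)"
  unfolding dominates_def separable_sum_mult
proof (intro conjI ballI)
  show "0 \<le> r * a" using dominatesD(1)[OF assms(1)] assms(2) by simp
  show "integrable_family (\<lambda>t z. r * x t z)" using dominatesD(2)[OF assms(1)] by auto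
  fix s assume "s \<in> topspace X"
  from mult_left_mono[OF dominatesD(3)[OF assms(1) this] assms(2)]
  show "r * f s \<le> r * separable_sum T x s + r * a * c s"
    by (simp add: algebra_simps)
qed

lemma upper_price_add:
  assumes f: "\<And>s. \<bar>f s\<bar> \<le> A" and g: "\<And>s. \<bar>g s\<bar> \<le> B"
  shows "upper_price (\<lambda>s. f s + g s) \<le> upper_price f + upper_price g"
proof -
  have fg: "\<bar>f s + g s\<bar> \<le> A + B" for s using f[of s] g[of s] by simp
  have *: "upper_price (\<lambda>s. f s + g s) \<le> (marginal_integral x + a * max_value) + (marginal_integral y + b * max_value)"
    if "dominates x a f" "dominates y b g" for x a y b
    using upper_price_le[OF dominates_add[OF that] fg] that[THEN dominatesD(2)]
    by (simp add: marginal_integral_add algebra_simps)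
  have "upper_price (\<lambda>s. f s + g s) - (marginal_integral y + b * max_value) \<le> upper_price f"
    if "dominates y b g" for y b
    by (rule upper_price_ge[OF _ f]) (use *[OF _ that] in force)
  then have "upper_price (\<lambda>s. f s + g s) - upper_price f \<le> upper_price g"
    by (intro upper_price_ge[OF _ g]) force
  then show ?thesis by simp
qed

lemma upper_price_mult:
  assumes f: "\<And>s. \<bar>f s\<bar> \<le> B" and r: "0 \<le> r"
  shows "upper_price (\<lambda>s. r * f s) = r * upper_price f"
proof -
  have le: "upper_price (\<lambda>s. r * f s) \<le> r * upper_price f" if r: "0 < r" and f: "\<And>s. \<bar>f s\<bar> \<le> B" for r f B
  proof -
    have rf: "\<bar>r * f s\<bar> \<le> r * B" for s using f[of s] r by (simp add: abs_mult)
    have "upper_price (\<lambda>s. r * f s) / r \<le> upper_price f"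
    proof (rule upper_price_ge[OF _ f])
      fix x a assume "dominates x a f"
      from upper_price_le[OF dominates_mult[OF this less_imp_le[OF r]] rf]
      show "upper_price (\<lambda>s. r * f s) / r \<le> marginal_integral x + a * max_value"
        using r by (simp add: marginal_integral_mult field_simps)
    qed
    then show ?thesis using r by (simp add: field_simps)
  qed
  show ?thesis
  proof (cases "r = 0")
    case True
    have z: "upper_price (\<lambda>s. 0) \<le> 0"
      using upper_price_le[OF dominates_constant[of "\<lambda>s. 0" 0], of 0] constant_family(2)[of 0] by simp
    have "0 \<le> upper_price (\<lambda>s. 0)"
      by (rule upper_price_ge[where B = 0]) (use dominates_ge[where B = 0] in auto)
    then show ?thesis using z True by simp
  next
    case False
    then have r: "0 < r" using r by simp
    have rf: "\<bar>r * f s\<bar> \<le> r * B" for s using f[of s] r by (simp add: abs_mult)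
    have "upper_price (\<lambda>s. (1 / r) * (r * f s)) \<le> (1 / r) * upper_price (\<lambda>s. r * f s)"
      by (rule le[OF _ rf]) (use r in simp)
    then have "r * upper_price f \<le> upper_price (\<lambda>s. r * f s)" using r by (simp add: field_simps)
    then show ?thesis using le[of r f, OF r f] by simp
  qed
qed

text \<open>The space of bounded functions on an untopologised type is the space of bounded continuous
  functions on its discrete copy.\<close>

lemma dominated_functional:
  obtains L :: "((nat \<Rightarrow> 'a) \<Rightarrow> real) \<Rightarrow> real" where
    "\<And>f g. bounded (range f) \<Longrightarrow> bounded (range g) \<Longrightarrow> L (\<lambda>s. f s + g s) = L f + L g"
    "\<And>r f. bounded (range f) \<Longrightarrow> L (\<lambda>s. r * f s) = r * L f"
    "\<And>x a f. bounded (range f) \<Longrightarrow> dominates x a f \<Longrightarrow> L f \<le> marginal_integral x + a * max_value"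
proof -
  define p where "p = (\<lambda>g :: (nat \<Rightarrow> 'a) discrete \<Rightarrow>\<^sub>C real. upper_price (\<lambda>s. apply_bcontfun g (discrete s)))"
  have b: "\<bar>apply_bcontfun g (discrete s)\<bar> \<le> norm g" for g :: "(nat \<Rightarrow> 'a) discrete \<Rightarrow>\<^sub>C real" and s
    using norm_bounded[of g "discrete s"] by simp
  have "sublinear p"
    unfolding sublinear_def p_def
  proof (intro conjI allI impI)
    fix g h :: "(nat \<Rightarrow> 'a) discrete \<Rightarrow>\<^sub>C real"
    show "upper_price (\<lambda>s. apply_bcontfun (g + h) (discrete s)) \<le>
        upper_price (\<lambda>s. apply_bcontfun g (discrete s)) + upper_price (\<lambda>s. apply_bcontfun h (discrete s))"
      using upper_price_add[OF b[of g] b[of h]] by simp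
  next
    fix a :: real and g :: "(nat \<Rightarrow> 'a) discrete \<Rightarrow>\<^sub>C real" assume "0 \<le> a"
    then show "upper_price (\<lambda>s. apply_bcontfun (a *\<^sub>R g) (discrete s)) = a * upper_price (\<lambda>s. apply_bcontfun g (discrete s))"
      using upper_price_mult[OF b[of g], of a] by simp
  qed
  from sublinear_dominates_linear[OF this] obtain l where l: "linear l" "\<And>g. l g \<le> p g" by blast
  define E where "E = (\<lambda>f :: (nat \<Rightarrow> 'a) \<Rightarrow> real. Bcontfun (\<lambda>d. f (of_discrete d)))"
  have E: "apply_bcontfun (E f) d = f (of_discrete d)" if "bounded (range f)" for f d
  proof -
    have "range (\<lambda>d. f (of_discrete d)) \<subseteq> range f" by blast
    then have "(\<lambda>d. f (of_discrete d)) \<in> bcontfun"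
      using bounded_subset[OF that]
      by (auto simp: bcontfun_def continuous_on_topological intro!: exI[of _ "{_}"] open_discrete)
    then show ?thesis by (simp add: E_def Bcontfun_inverse)
  qed
  have bs: "bounded (range (\<lambda>s. f s + g s))" if "bounded (range f)" "bounded (range g)" for f g :: "(nat \<Rightarrow> 'a) \<Rightarrow> real"
    using bounded_plus_comp[OF that] .
  have bm: "bounded (range (\<lambda>s. r * f s))" if "bounded (range f)" for f :: "(nat \<Rightarrow> 'a) \<Rightarrow> real" and r
    using bounded_scaleR_comp[OF that, of r] by simp
  show thesis
  proof (rule that[of "\<lambda>f. l (E f)"])
    fix f g :: "(nat \<Rightarrow> 'a) \<Rightarrow> real" assume fg: "bounded (range f)" "bounded (range g)"
    have "E (\<lambda>s. f s + g s) = E f + E g"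
      by (rule bcontfun_eqI) (simp add: E fg bs)
    then show "l (E (\<lambda>s. f s + g s)) = l (E f) + l (E g)" using linear_add[OF l(1)] by simp
  next
    fix r and f :: "(nat \<Rightarrow> 'a) \<Rightarrow> real" assume f: "bounded (range f)"
    have "E (\<lambda>s. r * f s) = r *\<^sub>R E f"
      by (rule bcontfun_eqI) (simp add: E f bm)
    then show "l (E (\<lambda>s. r * f s)) = r * l (E f)" using linear_scale[OF l(1)] by simp
  next
    fix x a and f :: "(nat \<Rightarrow> 'a) \<Rightarrow> real" assume f: "bounded (range f)" and d: "dominates x a f"
    have "l (E f) \<le> upper_price f" using l(2)[of "E f"] by (simp add: p_def E f discrete_inverse)
    also obtain B where "\<And>s. \<bar>f s\<bar> \<le> B" using f by (auto simp: bounded_iff)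
    then have "upper_price f \<le> marginal_integral x + a * max_value" by (rule upper_price_le[OF d])
    finally show "l (E f) \<le> marginal_integral x + a * max_value" .
  qed
qed

end

section \<open>The content induced by the functional\<close>

text \<open>\<open>L\<close> takes arbitrary functions as arguments so that no separate type has to
  be carried along; its laws are stated for bounded ones.\<close>

locale dominated_transport = transport_problem +
  fixes L :: "((nat \<Rightarrow> 'a) \<Rightarrow> real) \<Rightarrow> real"
  assumes L_add: "\<And>f g. bounded (range f) \<Longrightarrow> bounded (range g) \<Longrightarrow> L (\<lambda>s. f s + g s) = L f + L g"
    and L_mult: "\<And>r f. bounded (range f) \<Longrightarrow> L (\<lambda>s. r * f s) = r * L f"
    and L_le: "\<And>x a f. bounded (range f) \<Longrightarrow> dominates x a f \<Longrightarrow> L f \<le> marginal_integral x + a * max_value"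
begin

definition content :: "(nat \<Rightarrow> 'a) set \<Rightarrow> real" where
  "content E = L (indicat_real E)"

lemma bounded_indicator: "bounded (range (indicat_real E))"
  by (rule boundedI[where B = 1]) (auto simp: indicator_def)

lemma L_zero: "L (\<lambda>s. 0) = 0"
  using L_mult[of "\<lambda>s. 0" 0] by simp

lemma L_le_separable:
  assumes "bounded (range f)" "integrable_family x" "\<And>s. s \<in> topspace X \<Longrightarrow> f s \<le> separable_sum T x s"
  shows "L f \<le> marginal_integral x"
  using L_le[of f x 0] assms by (simp add: dominates_def)

text \<open>Domination is one-sided, but applied to \<open>- f\<close> it becomes a lower bound.
  Thus \<open>L\<close> is forced on bounded separable functions with integrable components.\<close>

lemma L_ge_separable:
  assumes f: "bounded (range f)" and x: "integrable_family x"
    and ge: "\<And>s. s \<in> topspace X \<Longrightarrow> separable_sum T x s \<le> f s"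
  shows "marginal_integral x \<le> L f"
proof -
  have "bounded (range (\<lambda>s. - 1 * f s))" using f by (auto simp: bounded_iff)
  moreover have "- 1 * f s \<le> separable_sum T (\<lambda>t a. - 1 * x t a) s" if "s \<in> topspace X" for s
    using ge[OF that] unfolding separable_sum_mult by simp
  moreover have "integrable_family (\<lambda>t a. - 1 * x t a)" using x by auto
  ultimately have "L (\<lambda>s. - 1 * f s) \<le> marginal_integral (\<lambda>t a. - 1 * x t a)"
    by (intro L_le_separable)
  then show ?thesis using L_mult[OF f, of "- 1"] marginal_integral_mult[of "- 1" x] by simp
qed

lemma L_nonneg:
  assumes "bounded (range f)" "\<And>s. s \<in> topspace X \<Longrightarrow> 0 \<le> f s" shows "0 \<le> L f"
  using L_ge_separable[OF assms(1) constant_family(3)[of 0]] assms(2) constant_family(1,2)[of 0] by simp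

lemma L_sum:
  "finite V \<Longrightarrow> (\<And>v. v \<in> V \<Longrightarrow> bounded (range (f v))) \<Longrightarrow> L (\<lambda>s. \<Sum>v\<in>V. f v s) = (\<Sum>v\<in>V. L (f v))
    \<and> bounded (range (\<lambda>s. \<Sum>v\<in>V. f v s))"
proof (induction V rule: finite_induct)
  case empty
  then show ?case by (simp add: L_zero)
next
  case (insert v V)
  then show ?case using L_add[of "f v" "\<lambda>s. \<Sum>v\<in>V. f v s"] bounded_plus_comp[of "f v" UNIV "\<lambda>s. \<Sum>v\<in>V. f v s"] by simp
qed

lemma content_nonneg: "0 \<le> content E"
  unfolding content_def by (rule L_nonneg[OF bounded_indicator]) simp

lemma content_additive: "E \<inter> F = {} \<Longrightarrow> content (E \<union> F) = content E + content F"
proof -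
  assume "E \<inter> F = {}"
  then have "indicat_real (E \<union> F) = (\<lambda>s. indicator E s + indicator F s)"
    by (auto simp: indicator_def fun_eq_iff)
  then show ?thesis unfolding content_def using L_add[OF bounded_indicator bounded_indicator] by simp
qed

lemma integrable_indicator_mu: "t \<le> T \<Longrightarrow> A \<in> sets (borel_of (S t)) \<Longrightarrow> integrable (\<mu> t) (indicat_real A)"
  using prob_mu sets_mu by (simp add: integrable_indicator_iff prob_space_def finite_measure.emeasure_finite less_top[symmetric])

lemma integral_indicator_mu: "t \<le> T \<Longrightarrow> A \<in> sets (borel_of (S t)) \<Longrightarrow> (\<integral>a. indicat_real A a \<partial>\<mu> t) = measure (\<mu> t) A"
  using sets.sets_into_space[of A "\<mu> t"] by (simp add: sets_mu inf.absorb1)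

definition cylinder :: "nat \<Rightarrow> 'a set \<Rightarrow> (nat \<Rightarrow> 'a) set" where
  "cylinder t A = {s \<in> topspace X. s t \<in> A}"

text \<open>On the product space the indicator of a cylinder is itself separable, so the upper and
  the lower bound coincide.\<close>

lemma content_cylinder:
  assumes t: "t \<le> T" and A: "A \<in> sets (borel_of (S t))"
  shows "content (cylinder t A) = measure (\<mu> t) A"
proof -
  define x where "x = (\<lambda>r. if r = t then indicat_real A else (\<lambda>_. 0))"
  have i: "integrable_family x" using integrable_indicator_mu[OF t A] by (auto simp: x_def)
  have s: "separable_sum T x s = indicator (cylinder t A) s" if "s \<in> topspace X" for s
  proof -
    have "separable_sum T x s = (\<Sum>r\<le>T. if r = t then indicat_real A (s t) else 0)"
      unfolding separable_sum_def x_def by (intro sum.cong) auto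
    then show ?thesis using t that by (simp add: cylinder_def indicator_def)
  qed
  have "marginal_integral x = (\<Sum>r\<le>T. if r = t then measure (\<mu> t) A else 0)"
    unfolding marginal_integral_def x_def using integral_indicator_mu[OF t A] by (intro sum.cong) auto
  then have m: "marginal_integral x = measure (\<mu> t) A" using t by simp
  show ?thesis
    unfolding content_def m[symmetric]
    by (intro antisym L_le_separable L_ge_separable bounded_indicator i) (simp_all only: s order_refl)
qed

lemma compactin_PiE_topspace:
  "(\<And>t. t \<le> T \<Longrightarrow> compactin (S t) (C t)) \<Longrightarrow> compactin X (Pi\<^sub>E {..T} C)"
  by (simp add: compactin_PiE)

text \<open>Boxes of compact sets approximate the cylinder and its complement. What they miss is
  dominated by a separable function with small marginal integrals, and this is how tightness passes
  from the \<open>\<mu> t\<close> to the content.\<close>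

lemma cylinder_approximable:
  assumes t: "t \<le> T" and A: "A \<in> sets (borel_of (S t))"
  shows "cylinder t A \<in> compact_approximable X content"
  unfolding compact_approximable_def
proof (intro CollectI conjI allI impI)
  show "cylinder t A \<subseteq> topspace X" by (auto simp: cylinder_def)
  fix e :: real assume "0 < e"
  \<comment> \<open>One gap for the tightness of each of the \<open>T + 1\<close> marginals and two
    for the inner approximations of \<open>A\<close> and its complement; \<open>real T + 4\<close>
    keeps the total strictly below \<open>e\<close>.\<close>
  define \<epsilon> where "\<epsilon> = e / (real T + 4)"
  have \<epsilon>: "0 < \<epsilon>" using \<open>0 < e\<close> by (simp add: \<epsilon>_def)
  have fin: "finite_measure (\<mu> r)" if "r \<le> T" for r using prob_mu[OF that] by (simp add: prob_space_def)
  have "\<exists>C. compactin (S r) C \<and> measure (\<mu> r) (topspace (S r) - C) < \<epsilon>" if "r \<le> T" for r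
    by (rule Polish_space_tight[OF Polish[OF that] fin[OF that] sets_mu[OF that] \<epsilon>])
  then obtain C where C: "\<And>r. r \<le> T \<Longrightarrow> compactin (S r) (C r)"
    "\<And>r. r \<le> T \<Longrightarrow> measure (\<mu> r) (topspace (S r) - C r) < \<epsilon>" by metis
  have Ac: "topspace (S t) - A \<in> sets (borel_of (S t))"
    using sets.compl_sets[OF A] by simp
  obtain D where D: "compactin (S t) D" "D \<subseteq> A" "measure (\<mu> t) (A - D) < \<epsilon>"
    using Polish_space_inner_regular[OF Polish[OF t] fin[OF t] sets_mu[OF t] A \<epsilon>] by blast
  obtain D' where D': "compactin (S t) D'" "D' \<subseteq> topspace (S t) - A"
    "measure (\<mu> t) ((topspace (S t) - A) - D') < \<epsilon>"
    using Polish_space_inner_regular[OF Polish[OF t] fin[OF t] sets_mu[OF t] Ac \<epsilon>] by blast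
  have cs: "F \<in> sets (borel_of (S r))" if "compactin (S r) F" "r \<le> T" for F r
    using compactin_imp_closedin[OF Polish_space_Hausdorff[OF Polish[OF that(2)]] that(1)]
    by (rule closedin_sets_borel_of)
  define H where "H = Pi\<^sub>E {..T} (C(t := D))"
  define H' where "H' = Pi\<^sub>E {..T} (C(t := D'))"
  have H: "compactin X H" "compactin X H'"
    unfolding H_def H'_def by (rule compactin_PiE_topspace; use C D D' in auto)+
  have sub: "H \<subseteq> cylinder t A"
  proof
    fix s assume s: "s \<in> H"
    then have "s t \<in> D" unfolding H_def using t by (auto dest: PiE_mem[of s _ _ t])
    moreover have "s \<in> topspace X" using compactin_subset_topspace[OF H(1)] s by blast
    ultimately show "s \<in> cylinder t A" using D(2) unfolding cylinder_def by blast
  qed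
  have disj: "H' \<inter> cylinder t A = {}"
  proof -
    have "s t \<in> D'" if "s \<in> H'" for s
      using that t unfolding H'_def by (auto dest: PiE_mem[of s _ _ t])
    then show ?thesis using D'(2) unfolding cylinder_def by blast
  qed
  \<comment> \<open>A point outside both boxes has some coordinate outside \<open>C r\<close>, or
    its coordinate \<open>t\<close> lies in neither \<open>D\<close> nor \<open>D'\<close>; either
    way some component is at least \<open>1\<close>.\<close>
  define x where "x = (\<lambda>r a. indicat_real (topspace (S r) - C r) a +
    (if r = t then indicat_real (A - D) a + indicat_real ((topspace (S t) - A) - D') a else 0))"
  have Cs: "topspace (S r) - C r \<in> sets (borel_of (S r))" if "r \<le> T" for r
    using cs[OF C(1)[OF that] that] sets.top[of "borel_of (S r)"] by (auto intro: sets.Diff)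
  have Ds: "A - D \<in> sets (borel_of (S t))" "(topspace (S t) - A) - D' \<in> sets (borel_of (S t))"
    using cs[OF D(1) t] cs[OF D'(1) t] A Ac by auto
  have xi: "integrable_family x"
  proof (intro allI impI)
    fix r assume r: "r \<le> T"
    show "integrable (\<mu> r) (x r)"
      using integrable_indicator_mu[OF r Cs[OF r]] integrable_indicator_mu[OF t Ds(1)]
        integrable_indicator_mu[OF t Ds(2)] unfolding x_def by (cases "r = t") auto
  qed
  have xp: "0 \<le> x r a" for r a by (simp add: x_def)
  have le: "indicat_real (topspace X - (H \<union> H')) s \<le> separable_sum T x s" if s: "s \<in> topspace X" for s
  proof (cases "s \<in> H \<union> H'")
    case True
    then show ?thesis unfolding separable_sum_def by (simp add: sum_nonneg xp)
  next
    case False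
    have sr: "s r \<in> topspace (S r)" if "r \<le> T" for r using s that by (auto simp: PiE_iff)
    have ext: "s \<in> extensional {..T}" using s by (auto simp: PiE_iff)
    have "\<exists>r\<le>T. 1 \<le> x r (s r)"
    proof (rule ccontr)
      assume no: "\<not> ?thesis"
      have "s r \<in> C r" if "r \<le> T" for r
      proof -
        have "indicat_real (topspace (S r) - C r) (s r) \<le> x r (s r)" by (simp add: x_def)
        also have "\<dots> < 1" using no that by force
        finally show ?thesis using sr[OF that] by (auto simp: indicator_def split: if_splits)
      qed
      moreover have "s t \<in> D \<union> D'"
      proof -
        have "indicat_real (A - D) (s t) + indicat_real ((topspace (S t) - A) - D') (s t) \<le> x t (s t)"
          by (simp add: x_def)
        also have "\<dots> < 1" using no t by force
        finally show ?thesis using sr[OF t] by (cases "s t \<in> A"; cases "s t \<in> D") (auto simp: indicator_def)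
      qed
      ultimately have "s \<in> H \<union> H'"
        using ext unfolding H_def H'_def by (auto simp: PiE_iff)
      then show False using False by blast
    qed
    then obtain r where r: "r \<le> T" "1 \<le> x r (s r)" by blast
    have "x r (s r) \<le> separable_sum T x s"
      unfolding separable_sum_def using r xp by (intro member_le_sum) auto
    then show ?thesis using r(2) by (auto simp: indicator_def)
  qed
  have "content (topspace X - (H \<union> H')) \<le> marginal_integral x"
    unfolding content_def by (rule L_le_separable[OF bounded_indicator xi le])
  also have "\<dots> \<le> (\<Sum>r\<le>T. \<epsilon> + (if r = t then 2 * \<epsilon> else 0))"
    unfolding marginal_integral_def
  proof (rule sum_mono)
    fix r assume "r \<in> {..T}"
    then have r: "r \<le> T" by simp
    show "(\<integral>a. x r a \<partial>\<mu> r) \<le> \<epsilon> + (if r = t then 2 * \<epsilon> else 0)"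
    proof (cases "r = t")
      case True
      then show ?thesis
        using C(2)[OF t] D(3) D'(3) integrable_indicator_mu[OF t Cs[OF t]] integrable_indicator_mu[OF t Ds(1)]
          integrable_indicator_mu[OF t Ds(2)] integral_indicator_mu[OF t Cs[OF t]]
          integral_indicator_mu[OF t Ds(1)] integral_indicator_mu[OF t Ds(2)]
        unfolding x_def by (simp del: integral_indicator)
    next
      case False
      then show ?thesis using C(2)[OF r] integral_indicator_mu[OF r Cs[OF r]]
        unfolding x_def by (simp del: integral_indicator)
    qed
  qed
  also have "\<dots> = (real T + 3) * \<epsilon>" using t by (simp add: sum.distrib algebra_simps)
  also have "\<dots> < (real T + 4) * \<epsilon>" using \<epsilon> by simp
  also have "\<dots> = e" by (simp add: \<epsilon>_def)
  finally have "content (topspace X - (H \<union> H')) < e" .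
  then show "\<exists>K K'. compactin X K \<and> compactin X K' \<and> K \<subseteq> cylinder t A \<and> K' \<inter> cylinder t A = {} \<and>
      content (topspace X - (K \<union> K')) < e"
    using H sub disj by blast
qed

sublocale content: finitely_additive_content X content
proof
  show "Hausdorff_space X"
    using Polish_space_Hausdorff[OF Polish] by (simp add: Hausdorff_space_product_topology)
  have "cylinder 0 {} = {}" by (auto simp: cylinder_def)
  then show "{} \<in> compact_approximable X content" using cylinder_approximable[of 0 "{}"] by simp
qed (use content_nonneg content_additive in auto)

end

section \<open>Step functions on rectangles\<close>

text \<open>There are countably many pairs of a nonnegative rational and a base rectangle on which
  \<open>f\<close> is at least that rational. Lower semicontinuity makes every level below
  \<open>f s\<close> visible through one of them.\<close>

lemma rectangle_lower_approximation:
  fixes S :: "nat \<Rightarrow> 'a topology"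
  assumes I: "finite I" and S: "\<forall>t\<in>I. Polish_space (S t)"
    and ne: "topspace (product_topology S I) \<noteq> {}"
    and nonneg: "\<forall>s\<in>topspace (product_topology S I). 0 \<le> f s"
    and f: "lower_semicontinuous_map (product_topology S I) f"
  shows "\<exists>(r :: nat \<Rightarrow> real) R. (\<forall>k. 0 \<le> r k) \<and>
    (\<forall>k. \<exists>U. R k = Pi\<^sub>E I U \<and> (\<forall>t\<in>I. openin (S t) (U t))) \<and>
    (\<forall>k. \<forall>s\<in>R k. r k \<le> f s) \<and>
    (\<forall>s\<in>topspace (product_topology S I). \<forall>b\<ge>0. b < f s \<longrightarrow> (\<exists>k. s \<in> R k \<and> b < r k))"
proof -
  let ?X = "product_topology S I"
  obtain \<R> where R: "countable \<R>"
    "\<forall>R\<in>\<R>. \<exists>U. R = Pi\<^sub>E I U \<and> (\<forall>t\<in>I. openin (S t) (U t))"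
    "\<forall>U s. openin ?X U \<longrightarrow> s \<in> U \<longrightarrow> (\<exists>R\<in>\<R>. s \<in> R \<and> R \<subseteq> U)"
    using product_rectangle_base[OF I S] by blast
  define F where "F = {p \<in> (\<rat> \<inter> {0..}) \<times> \<R>. \<forall>s\<in>snd p. fst p \<le> f s}"
  have "F \<subseteq> \<rat> \<times> \<R>" by (auto simp: F_def)
  then have cF: "countable F" by (rule countable_subset) (intro countable_SIGMA countable_rat R(1))
  have ex: "\<exists>p\<in>F. s \<in> snd p \<and> b < fst p" if s: "s \<in> topspace ?X" and b: "0 \<le> b" "b < f s" for s b
  proof -
    obtain q where q: "b < of_rat q" "of_rat q < f s" using of_rat_dense[OF b(2)] by blast
    have "openin ?X {s \<in> topspace ?X. of_rat q < f s}" using f by (simp add: lower_semicontinuous_map_def)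
    moreover have "s \<in> {s \<in> topspace ?X. of_rat q < f s}" using s q by simp
    ultimately obtain A where A: "A \<in> \<R>" "s \<in> A" "A \<subseteq> {s \<in> topspace ?X. of_rat q < f s}"
      using R(3) by blast
    moreover have "0 \<le> (of_rat q :: real)" using q b by linarith
    moreover have "(of_rat q :: real) \<in> \<rat>" by simp
    ultimately have "(of_rat q, A) \<in> F" unfolding F_def by force
    then show ?thesis using q A by force
  qed
  \<comment> \<open>The enumeration by natural numbers needs an element; a base rectangle at height
    \<open>0\<close> is admissible because \<open>f\<close> is nonnegative.\<close>
  have "F \<noteq> {}"
  proof -
    obtain s where "s \<in> topspace ?X" using ne by blast
    then obtain A where A: "A \<in> \<R>" using R(3) openin_topspace by blast
    then obtain U where U: "A = Pi\<^sub>E I U" "\<forall>t\<in>I. openin (S t) (U t)" using R(2) by blast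
    have "A \<subseteq> topspace ?X" unfolding U(1) topspace_product_topology
      using U(2) openin_subset by (intro PiE_mono) blast
    then have "(0, A) \<in> F" using A nonneg unfolding F_def by auto
    then show ?thesis by blast
  qed
  define p where "p = from_nat_into F"
  have p: "p k \<in> F" for k unfolding p_def using \<open>F \<noteq> {}\<close> by (rule from_nat_into)
  have rp: "range p = F" unfolding p_def using cF \<open>F \<noteq> {}\<close> by (simp add: range_from_nat_into)
  show ?thesis
  proof (intro exI[of _ "\<lambda>k. fst (p k)"] exI[of _ "\<lambda>k. snd (p k)"] conjI allI ballI impI)
    show "0 \<le> fst (p k)" for k using p[of k] by (auto simp: F_def)
    show "\<exists>U. snd (p k) = Pi\<^sub>E I U \<and> (\<forall>t\<in>I. openin (S t) (U t))" for k
      using p[of k] R(2) by (auto simp: F_def)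
    show "fst (p k) \<le> f s" if "s \<in> snd (p k)" for k s using p[of k] that by (auto simp: F_def)
    show "\<exists>k. s \<in> snd (p k) \<and> b < fst (p k)" if "s \<in> topspace ?X" "0 \<le> b" "b < f s" for s b
      using ex[OF that] unfolding rp[symmetric] by auto
  qed
qed

text \<open>With level sets in the ring, a step function can be evaluated by a content and by a
  measure extending it, with the same result. The value \<open>0\<close> is left out of
  \<open>V n\<close>, since its level set contains every point outside \<open>\<Omega>\<close> and
  contributes nothing to the sum.\<close>

lemma max_step_level_sets:
  fixes r :: "nat \<Rightarrow> real" and R :: "nat \<Rightarrow> 'b set" and g :: "nat \<Rightarrow> 'b \<Rightarrow> real"
  assumes ring: "ring_of_sets \<Omega> \<A>" and r: "\<And>k. 0 \<le> r k" and R: "\<And>k. R k \<in> \<A>"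
    and g_def: "\<And>n s. g n s = Max ((\<lambda>k. r k * indicator (R k) s) ` {..n})"
    and V_def: "\<And>n. V n = r ` {..n} - {0}"
  shows "\<And>n s. g n s = (\<Sum>v\<in>V n. v * indicator {s. g n s = v} s)"
    "\<And>n v. v \<in> V n \<Longrightarrow> 0 < v \<and> {s. g n s = v} \<in> \<A>"
    "\<And>n s. 0 \<le> g n s" "\<And>n s. g n s \<le> g (Suc n) s"
    "\<And>n s b. 0 \<le> b \<Longrightarrow> b < g n s \<longleftrightarrow> (\<exists>k\<le>n. s \<in> R k \<and> b < r k)"
proof -
  interpret ring_of_sets \<Omega> \<A> by fact
  have fin: "finite ((\<lambda>k. r k * indicator (R k) s) ` {..n})" for n s by simp
  show gpos: "0 \<le> g n s" for n s
  proof -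
    have "0 \<le> r 0 * indicator (R 0) s" using r by simp
    also have "\<dots> \<le> g n s" unfolding g_def by (rule Max_ge[OF fin]) auto
    finally show ?thesis .
  qed
  show "g n s \<le> g (Suc n) s" for n s
    unfolding g_def by (rule Max_mono) auto
  show gt: "b < g n s \<longleftrightarrow> (\<exists>k\<le>n. s \<in> R k \<and> b < r k)" if "0 \<le> b" for n s b
  proof -
    have "b < g n s \<longleftrightarrow> (\<exists>k\<le>n. b < r k * indicator (R k) s)"
      unfolding g_def by (subst Max_gr_iff) auto
    also have "\<dots> \<longleftrightarrow> (\<exists>k\<le>n. s \<in> R k \<and> b < r k)"
      using that by (auto simp: indicator_def)
    finally show ?thesis .
  qed
  have range: "g n s \<in> insert 0 (V n)" for n s
  proof -
    have "g n s \<in> (\<lambda>k. r k * indicator (R k) s) ` {..n}" unfolding g_def by (rule Max_in) auto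
    then show ?thesis by (auto simp: V_def indicator_def split: if_splits)
  qed
  have Vpos: "0 < v" if "v \<in> V n" for v n using that r by (auto simp: V_def less_le)
  show "g n s = (\<Sum>v\<in>V n. v * indicator {s. g n s = v} s)" for n s
  proof -
    have "(\<Sum>v\<in>V n. v * indicator {s. g n s = v} s) = (\<Sum>v\<in>V n. if v = g n s then v else 0)"
      by (rule sum.cong) (auto simp: indicator_def)
    also have "\<dots> = g n s" using range[of n s] by (auto simp: V_def)
    finally show ?thesis by simp
  qed
  have sup: "{s. b < g n s} \<in> \<A>" if "0 \<le> b" for n b
  proof -
    have "{s. b < g n s} = (\<Union>k\<in>{k. k \<le> n \<and> b < r k}. R k)"
      using gt[OF that] by auto
    then show ?thesis using R by auto
  qed
  show "0 < v \<and> {s. g n s = v} \<in> \<A>" if v: "v \<in> V n" for n v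
  proof
    show pos: "0 < v" by (rule Vpos[OF v])
    \<comment> \<open>The largest candidate value below \<open>v\<close>, or \<open>0\<close>. As no
      value lies strictly between, the level set is a difference of two strict superlevel sets, each
      a finite union of the \<open>R k\<close>.\<close>
    define w where "w = Max (insert 0 {u \<in> V n. u < v})"
    have finV: "finite {u \<in> V n. u < v}" by (simp add: V_def)
    have w: "0 \<le> w" "w < v" unfolding w_def using finV pos by (auto simp: Max_ge_iff)
    have wle: "u \<le> w" if "u \<in> insert 0 (V n)" "u < v" for u
      unfolding w_def using that finV by (intro Max_ge) auto
    have "{s. g n s = v} = {s. w < g n s} - {s. v < g n s}"
      using w(2) wle[OF range] by (auto simp: not_less) (meson leD order.not_eq_order_implies_strict)
    then show "{s. g n s = v} \<in> \<A>" using sup[OF w(1)] sup[of v] pos by auto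
  qed
qed

section \<open>Existence of an optimal plan\<close>

context dominated_transport
begin

text \<open>Cylinders over Borel sets generate the Borel sets of the product, and each of them is
  approximable.\<close>

lemma sets_borel_of_product_subset:
  "sets (borel_of X) \<subseteq> sigma_sets (topspace X) (compact_approximable X content)"
proof -
  have "sets (borel_of X) = sets (Pi\<^sub>M {..T} (\<lambda>t. borel_of (S t)))"
    using sets_PiM_borel_of[OF _ Polish'] by simp
  also have "\<dots> = sigma_sets (topspace X) {cylinder t A |t A. t \<in> {..T} \<and> A \<in> sets (borel_of (S t))}"
    unfolding sets_PiM_single by (simp add: cylinder_def)
  also have "\<dots> \<subseteq> sigma_sets (topspace X) (compact_approximable X content)"
    by (rule sigma_sets_mono) (use cylinder_approximable in auto)
  finally show ?thesis .
qed

lemma rectangle_approximable: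
  assumes "\<forall>t\<in>{..T}. openin (S t) (U t)"
  shows "Pi\<^sub>E {..T} U \<in> compact_approximable X content"
proof -
  interpret ring_of_sets "topspace X" "compact_approximable X content"
    by (rule content.approximable_ring)
  have "Pi\<^sub>E {..T} U = (\<Inter>t\<in>{..T}. cylinder t (U t))"
  proof
    show "Pi\<^sub>E {..T} U \<subseteq> (\<Inter>t\<in>{..T}. cylinder t (U t))"
    proof -
      have "Pi\<^sub>E {..T} U \<subseteq> topspace X"
        unfolding topspace_product_topology by (intro PiE_mono) (use assms openin_subset in blast)
      then show ?thesis unfolding cylinder_def by (blast dest: PiE_mem)
    qed
    show "(\<Inter>t\<in>{..T}. cylinder t (U t)) \<subseteq> Pi\<^sub>E {..T} U"
      by (auto simp: cylinder_def PiE_iff extensional_def)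
  qed
  also have "\<dots> \<in> compact_approximable X content"
  proof (intro finite_INT)
    fix t assume "t \<in> {..T}"
    then show "cylinder t (U t) \<in> compact_approximable X content"
      using assms by (intro cylinder_approximable openin_sets_borel_of) auto
  qed auto
  finally show ?thesis .
qed

text \<open>The extension lives on a sigma-algebra that may exceed the Borel sets; pushing it
  forward along the identity restricts it to them. The marginals are then read off from
  cylinders.\<close>

lemma content_plan:
  obtains \<nu> where "\<nu> \<in> plans"
    "\<And>E. E \<in> sets (borel_of X) \<Longrightarrow> E \<in> compact_approximable X content \<Longrightarrow> emeasure \<nu> E = ennreal (content E)"
proof -
  obtain M where M: "space M = topspace X" "sets M = sigma_sets (topspace X) (compact_approximable X content)"
    "\<And>E. E \<in> compact_approximable X content \<Longrightarrow> emeasure M E = ennreal (content E)"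
    using content.content_extension by blast
  have sub: "E \<in> sets M" "E \<subseteq> topspace X" if "E \<in> sets (borel_of X)" for E
    using that sets_borel_of_product_subset M(2) sets.sets_into_space[OF that] by auto
  have id: "(\<lambda>s. s) \<in> measurable M (borel_of X)"
  proof (rule measurableI)
    fix E assume "E \<in> sets (borel_of X)"
    then show "(\<lambda>s. s) -` E \<inter> space M \<in> sets M" using sub[of E] M(1) by (simp add: inf.absorb1)
  qed (use M(1) in simp)
  define \<nu> where "\<nu> = distr M (borel_of X) (\<lambda>s. s)"
  have \<nu>: "emeasure \<nu> E = emeasure M E" if "E \<in> sets (borel_of X)" for E
    unfolding \<nu>_def using sub[OF that] M(1) by (simp add: emeasure_distr[OF id that] inf.absorb1)
  have cyl: "cylinder t A \<in> sets (borel_of X)" if "t \<le> T" "A \<in> sets (borel_of (S t))" for t A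
    using measurable_sets[OF projection_measurable[OF that(1)] that(2)]
    by (simp add: cylinder_def vimage_def Int_def conj_commute)
  have em: "emeasure \<nu> (cylinder t A) = emeasure (\<mu> t) A" if "t \<le> T" "A \<in> sets (borel_of (S t))" for t A
  proof -
    interpret prob_space "\<mu> t" using prob_mu[OF that(1)] .
    show ?thesis
      using \<nu>[OF cyl[OF that]] M(3)[OF cylinder_approximable[OF that]] content_cylinder[OF that]
      by (simp add: emeasure_eq_measure)
  qed
  have top: "cylinder 0 (topspace (S 0)) = topspace X" by (auto simp: cylinder_def)
  have fin: "finite_measure \<nu>"
  proof
    interpret prob_space "\<mu> 0" using prob_mu by simp
    have "emeasure \<nu> (topspace X) = emeasure (\<mu> 0) (topspace (S 0))"
      using em[of 0 "topspace (S 0)"] openin_sets_borel_of[OF openin_topspace, of "S 0"] top by simp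
    then show "emeasure \<nu> (space \<nu>) \<noteq> \<infinity>" by (simp add: \<nu>_def)
  qed
  have "marginal S \<nu> t = \<mu> t" if t: "t \<le> T" for t
  proof (rule measure_eqI)
    show "sets (marginal S \<nu> t) = sets (\<mu> t)" using sets_mu[OF t] by (simp add: marginal_def)
    fix A assume "A \<in> sets (marginal S \<nu> t)"
    then have A: "A \<in> sets (borel_of (S t))" by (simp add: marginal_def)
    have m: "(\<lambda>s. s t) \<in> measurable \<nu> (borel_of (S t))"
      unfolding \<nu>_def using projection_measurable[OF t] by simp
    have "emeasure (marginal S \<nu> t) A = emeasure \<nu> ((\<lambda>s. s t) -` A \<inter> space \<nu>)"
      unfolding marginal_def by (rule emeasure_distr[OF m A])
    also have "(\<lambda>s. s t) -` A \<inter> space \<nu> = cylinder t A"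
      by (auto simp: \<nu>_def cylinder_def)
    finally show "emeasure (marginal S \<nu> t) A = emeasure (\<mu> t) A" using em[OF t A] by simp
  qed
  then have "\<nu> \<in> plans" by (intro planI fin) (simp_all add: \<nu>_def)
  then show thesis using that \<nu> M(3) by simp
qed

text \<open>The functional controls bounded step functions only, and the plan integrates these to
  the same numbers; monotone convergence carries the bound over to the possibly unbounded
  cost.\<close>

theorem optimal_plan: "\<exists>\<nu>\<in>plans. integrable \<nu> c \<and> (\<integral>s. c s \<partial>\<nu>) \<le> max_value"
proof -
  obtain \<nu> where \<nu>: "\<nu> \<in> plans"
    "\<And>E. E \<in> sets (borel_of X) \<Longrightarrow> E \<in> compact_approximable X content \<Longrightarrow> emeasure \<nu> E = ennreal (content E)"
    using content_plan by blast
  \<comment> \<open>Subtracting the continuous separable minorant makes the cost nonnegative, keeps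
    it lower semicontinuous, and changes its integral by the same constant under every plan.\<close>
  define h where "h = (\<lambda>s. c s - K * separable_sum T \<psi> s)"
  define B where "B = max_value - K * marginal_integral \<psi>"
  have wi: "integrable_family \<psi>" using integrable_weight by simp
  have h0: "0 \<le> h s" if "s \<in> topspace X" for s using cost_ge[OF that] by (simp add: h_def)
  have hm: "h \<in> borel_measurable (borel_of X)"
    unfolding h_def using cost_measurable separable_sum_measurable[of \<psi>] continuous_weight
    by (auto intro!: borel_measurable_diff borel_measurable_times intro: continuous_map_borel_measurable)
  have "continuous_map X euclideanreal (\<lambda>s. \<psi> t (s t))" if "t \<le> T" for t
    using continuous_map_compose[OF continuous_map_product_projection[of t "{..T}" S] continuous_weight[OF that]] that
    by (simp add: o_def)
  then have cont: "continuous_map X euclideanreal (\<lambda>s. K * separable_sum T \<psi> s)"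
    unfolding separable_sum_def
    by (intro continuous_map_real_mult continuous_map_sum) auto
  have hl: "lower_semicontinuous_map X h"
    unfolding lower_semicontinuous_map_def
  proof
    fix a
    have "{s \<in> topspace X. a < h s} =
      (\<Union>q. {s \<in> topspace X. q < c s} \<inter> {s \<in> topspace X. K * separable_sum T \<psi> s \<in> {..<q - a}})"
    proof (intro set_eqI iffI)
      fix s assume "s \<in> {s \<in> topspace X. a < h s}"
      then have s: "s \<in> topspace X" "a + K * separable_sum T \<psi> s < c s" by (auto simp: h_def)
      obtain q where "a + K * separable_sum T \<psi> s < q" "q < c s" using dense[OF s(2)] by blast
      then show "s \<in> (\<Union>q. {s \<in> topspace X. q < c s} \<inter> {s \<in> topspace X. K * separable_sum T \<psi> s \<in> {..<q - a}})"
        using s(1) by (intro UN_I[of q]) auto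
    qed (auto simp: h_def)
    moreover have "openin X ({s \<in> topspace X. q < c s} \<inter> {s \<in> topspace X. K * separable_sum T \<psi> s \<in> {..<q - a}})" for q
      using lsc_cost openin_continuous_map_preimage[OF cont, of "{..<q - a}"]
      by (intro openin_Int) (auto simp only: lower_semicontinuous_map_def open_openin[symmetric] open_lessThan)
    ultimately show "openin X {s \<in> topspace X. a < h s}" by (simp only:) (rule openin_Union, blast)
  qed
  have ne: "topspace X \<noteq> {}"
    using prob_space.not_empty[OF plan_prob[OF \<nu>(1)]] planD(2)[OF \<nu>(1)] by simp
  have h0': "\<forall>s\<in>topspace X. 0 \<le> h s" using h0 by blast
  obtain r :: "nat \<Rightarrow> real" and R where rR': "\<forall>k. 0 \<le> r k" "\<forall>k. \<exists>U. R k = Pi\<^sub>E {..T} U \<and> (\<forall>t\<in>{..T}. openin (S t) (U t))"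
    "\<forall>k. \<forall>s\<in>R k. r k \<le> h s"
    "\<forall>s\<in>topspace X. \<forall>b\<ge>0. b < h s \<longrightarrow> (\<exists>k. s \<in> R k \<and> b < r k)"
    using rectangle_lower_approximation[OF finite_atMost Polish' ne h0' hl] by blast
  have rR: "0 \<le> r k" "\<exists>U. R k = Pi\<^sub>E {..T} U \<and> (\<forall>t\<in>{..T}. openin (S t) (U t))"
    "s \<in> R k \<Longrightarrow> r k \<le> h s"
    "s \<in> topspace X \<Longrightarrow> 0 \<le> b \<Longrightarrow> b < h s \<Longrightarrow> \<exists>k. s \<in> R k \<and> b < r k" for k s b
    using rR' by blast+
  have RA: "R k \<in> compact_approximable X content" for k
  proof -
    obtain U where U: "R k = Pi\<^sub>E {..T} U" "\<forall>t\<in>{..T}. openin (S t) (U t)" using rR(2) by blast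
    show ?thesis unfolding U(1) by (rule rectangle_approximable[OF U(2)])
  qed
  define g where "g = (\<lambda>n s. Max ((\<lambda>k. r k * indicator (R k) s) ` {..n}))"
  define V where "V = (\<lambda>n. r ` {..n} - {0})"
  note step = max_step_level_sets[OF content.approximable_ring rR(1) RA fun_cong[OF fun_cong[OF g_def]] fun_cong[OF V_def]]
  have gh: "g n s \<le> h s" if s: "s \<in> topspace X" for n s
  proof (rule ccontr)
    assume "\<not> ?thesis"
    then obtain k where "s \<in> R k" "h s < r k" using step(5)[OF h0[OF s]] by (auto simp: not_le)
    then show False using rR(3)[of s k] by simp
  qed
  have Rb: "R k \<in> sets (borel_of X)" for k
  proof -
    obtain U where U: "R k = Pi\<^sub>E {..T} U" "\<forall>t\<in>{..T}. openin (S t) (U t)" using rR(2) by blast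
    show ?thesis unfolding U(1) by (rule openin_sets_borel_of) (use U(2) in \<open>simp add: openin_PiE\<close>)
  qed
  have gm: "g n \<in> borel_measurable (borel_of X)" for n
    unfolding g_def using Rb by (intro borel_measurable_Max) auto
  have bnd: "bounded (range (\<lambda>s. v * indicat_real E s))" for v E
    by (rule boundedI[where B = "\<bar>v\<bar>"]) (auto simp: indicator_def)
  \<comment> \<open>On the level sets of \<open>g n\<close> the plan agrees with the content, so the
    integral is \<open>L (g n)\<close>. As \<open>g n\<close> lies below
    \<open>c - K \<psi>\<close>, the family \<open>- K \<psi>\<close> with \<open>a = 1\<close>
    dominates it, at the price \<open>B\<close>.\<close>
  have int: "(\<integral>\<^sup>+s. ennreal (g n s) \<partial>\<nu>) \<le> ennreal B" for n
  proof -
    let ?E = "\<lambda>v. {s. g n s = v}"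
    have E: "?E v \<in> sets (borel_of X)" if "v \<in> V n" for v
    proof -
      have "?E v \<subseteq> topspace X" using step(2)[OF that] by (auto simp: compact_approximable_def)
      then have "?E v = g n -` {v} \<inter> space (borel_of X)" by auto
      then show ?thesis using measurable_sets[OF gm, of "{v}" n] by simp
    qed
    have finV: "finite (V n)" by (simp add: V_def)
    have gsum: "g n = (\<lambda>s. \<Sum>v\<in>V n. v * indicat_real (?E v) s)" by (rule ext) (rule step(1))
    note Ls = L_sum[OF finV, of "\<lambda>v s. v * indicat_real (?E v) s", OF bnd]
    have "(\<integral>\<^sup>+s. ennreal (g n s) \<partial>\<nu>) = (\<integral>\<^sup>+s. (\<Sum>v\<in>V n. ennreal v * indicator (?E v) s) \<partial>\<nu>)"
    proof (rule nn_integral_cong)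
      fix s
      have "ennreal (g n s) = ennreal (\<Sum>v\<in>V n. v * indicator (?E v) s)" by (subst step(1)) simp
      also have "\<dots> = (\<Sum>v\<in>V n. ennreal (v * indicator (?E v) s))"
        using step(2) by (intro sum_ennreal[symmetric]) (auto simp: less_imp_le)
      also have "\<dots> = (\<Sum>v\<in>V n. ennreal v * indicator (?E v) s)"
        by (intro sum.cong) (auto simp: indicator_def)
      finally show "ennreal (g n s) = (\<Sum>v\<in>V n. ennreal v * indicator (?E v) s)" .
    qed
    also have "\<dots> = (\<Sum>v\<in>V n. ennreal v * emeasure \<nu> (?E v))"
      using E planD(1)[OF \<nu>(1)] by (subst nn_integral_sum) (auto intro!: sum.cong nn_integral_cmult_indicator)
    also have "\<dots> = (\<Sum>v\<in>V n. ennreal (v * content (?E v)))"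
      using \<nu>(2) E step(2) content_nonneg
      by (intro sum.cong) (auto simp: ennreal_mult less_imp_le)
    also have "\<dots> = ennreal (\<Sum>v\<in>V n. v * content (?E v))"
      using step(2) content_nonneg by (intro sum_ennreal) (auto simp: less_imp_le)
    also have "(\<Sum>v\<in>V n. v * content (?E v)) = (\<Sum>v\<in>V n. L (\<lambda>s. v * indicator (?E v) s))"
      using L_mult[OF bounded_indicator] by (simp add: content_def)
    also have "\<dots> = L (\<lambda>s. \<Sum>v\<in>V n. v * indicator (?E v) s)" using Ls by simp
    also have "\<dots> = L (g n)" by (rule arg_cong[OF gsum[symmetric]])
    also have "ennreal (L (g n)) \<le> ennreal B"
    proof (rule ennreal_leI)
      have "bounded (range (g n))" using Ls unfolding gsum[symmetric] by blast
      moreover have "dominates (\<lambda>t a. - K * \<psi> t a) 1 (g n)"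
        unfolding dominates_def using weight_potential(2) gh separable_sum_mult[of "- K" \<psi>]
        by (auto simp: h_def)
      ultimately have "L (g n) \<le> marginal_integral (\<lambda>t a. - K * \<psi> t a) + 1 * max_value"
        by (rule L_le)
      then show "L (g n) \<le> B" using marginal_integral_mult[of "- K" \<psi>] by (simp add: B_def)
    qed
    finally show ?thesis .
  qed
  have sup: "(SUP n. ennreal (g n s)) = ennreal (h s)" if s: "s \<in> topspace X" for s
  proof (rule antisym)
    show "(SUP n. ennreal (g n s)) \<le> ennreal (h s)"
      using gh[OF s] by (intro SUP_least ennreal_leI)
    show "ennreal (h s) \<le> (SUP n. ennreal (g n s))"
    proof (rule dense_le)
      fix y assume y: "y < ennreal (h s)"
      then obtain b where b: "y = ennreal b" "0 \<le> b" by (cases y) auto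
      then have "b < h s" using y by (simp add: ennreal_less_iff)
      then obtain k where "s \<in> R k" "b < r k" using rR(4)[OF s b(2)] by blast
      then have "b < g k s" using step(5)[OF b(2)] by auto
      then have "y \<le> ennreal (g k s)" using b by (simp add: ennreal_leI)
      also have "\<dots> \<le> (SUP n. ennreal (g n s))" by (rule SUP_upper) simp
      finally show "y \<le> (SUP n. ennreal (g n s))" .
    qed
  qed
  have "(\<integral>\<^sup>+s. ennreal (h s) \<partial>\<nu>) = (\<integral>\<^sup>+s. (SUP n. ennreal (g n s)) \<partial>\<nu>)"
    using sup planD(2)[OF \<nu>(1)] by (intro nn_integral_cong) simp
  also have "\<dots> = (SUP n. \<integral>\<^sup>+s. ennreal (g n s) \<partial>\<nu>)"
    using gm plan_measurable[OF \<nu>(1), of "borel :: real measure"] step(4)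
    by (intro nn_integral_monotone_convergence_SUP measurable_compose[OF _ measurable_ennreal])
      (auto simp: incseq_Suc_iff le_fun_def intro!: ennreal_leI)
  also have "\<dots> \<le> ennreal B" by (rule SUP_least) (rule int)
  finally have hB: "(\<integral>\<^sup>+s. ennreal (h s) \<partial>\<nu>) \<le> ennreal B" .
  have hAE: "AE s in \<nu>. 0 \<le> h s" using h0 planD(2)[OF \<nu>(1)] by (intro AE_I2) simp
  have hint: "integrable \<nu> h"
    using hm plan_measurable[OF \<nu>(1), of "borel :: real measure"] hB by (intro integrableI_nonneg hAE) (auto intro: le_less_trans)
  note wint = plan_integral[OF \<nu>(1) wi]
  have ci: "c = (\<lambda>s. h s + K * separable_sum T \<psi> s)" by (simp add: h_def)
  have cint: "integrable \<nu> c" unfolding ci using hint wint(1) by simp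
  have cv: "(\<integral>s. c s \<partial>\<nu>) = (\<integral>s. h s \<partial>\<nu>) + K * marginal_integral \<psi>"
    by (subst ci) (use hint wint in simp)
  \<comment> \<open>\<open>ennreal\<close> truncates negative numbers to \<open>0\<close>, so the
    bound returns to the reals only for nonnegative \<open>B\<close>. This holds because
    \<open>- K \<psi>\<close> is a potential.\<close>
  have "0 \<le> B"
    using weight_potential le_max_value[OF weight_potential] marginal_integral_mult[of "- K" \<psi>] by (simp add: B_def)
  then have "(\<integral>s. h s \<partial>\<nu>) \<le> B"
    using hB nn_integral_eq_integral[OF hint hAE] by (simp add: ennreal_le_iff)
  then have "(\<integral>s. c s \<partial>\<nu>) \<le> max_value" using cv by (simp add: B_def)
  then show ?thesis using \<nu>(1) cint by blast
qed

end

context transport_problem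
begin

lemma ex_optimal_plan: "\<exists>\<nu>\<in>plans. integrable \<nu> c \<and> (\<integral>s. c s \<partial>\<nu>) \<le> max_value"
proof -
  obtain L :: "((nat \<Rightarrow> 'a) \<Rightarrow> real) \<Rightarrow> real" where L:
    "\<And>f g. bounded (range f) \<Longrightarrow> bounded (range g) \<Longrightarrow> L (\<lambda>s. f s + g s) = L f + L g"
    "\<And>r f. bounded (range f) \<Longrightarrow> L (\<lambda>s. r * f s) = r * L f"
    "\<And>x a f. bounded (range f) \<Longrightarrow> dominates x a f \<Longrightarrow> L f \<le> marginal_integral x + a * max_value"
    using dominated_functional by blast
  interpret dominated_transport T S \<psi> \<mu> c K L by unfold_locales (fact L)+
  show ?thesis by (rule optimal_plan)
qed

end

section \<open>Existence of an optimal potential\<close>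

context transport_problem
begin

lemma marginal_integral_P: "integrable_family x \<Longrightarrow> (\<integral>s. separable_sum T x s \<partial>\<P>) = marginal_integral x"
  by (rule plan_integral[OF product_plan])

lemma potential_cong:
  assumes "x \<in> potentials" "\<And>t. t \<le> T \<Longrightarrow> y t \<in> borel_measurable (borel_of (S t))"
    "\<And>s. separable_sum T y s = separable_sum T x s"
  shows "y \<in> potentials"
  using assms unfolding dual_potentials_def by simp

text \<open>A potential may be shifted by constants summing to zero, so that only its first component
  carries mass.\<close>

definition centred :: "(nat \<Rightarrow> 'a \<Rightarrow> real) \<Rightarrow> nat \<Rightarrow> 'a \<Rightarrow> real" where
  "centred x = (\<lambda>t a. x t a - (\<integral>b. x t b \<partial>\<mu> t) + (if t = 0 then marginal_integral x else 0))"

lemma centred: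
  assumes x: "integrable_family x"
  shows "integrable_family (centred x)" "separable_sum T (centred x) s = separable_sum T x s"
    "t \<le> T \<Longrightarrow> (\<integral>a. centred x t a \<partial>\<mu> t) = (if t = 0 then marginal_integral x else 0)"
    "marginal_integral (centred x) = marginal_integral x"
proof -
  have fin: "finite_measure (\<mu> t)" if "t \<le> T" for t using prob_mu[OF that] by (simp add: prob_space_def)
  show "integrable_family (centred x)"
    using x fin unfolding centred_def by (auto simp: finite_measure.integrable_const)
  show "separable_sum T (centred x) s = separable_sum T x s"
    by (simp add: separable_sum_def centred_def sum.distrib sum_subtractf marginal_integral_def)
  show *: "(\<integral>a. centred x t a \<partial>\<mu> t) = (if t = 0 then marginal_integral x else 0)" if t: "t \<le> T" for t
  proof -
    interpret prob_space "\<mu> t" using prob_mu[OF t] .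
    show ?thesis using x t unfolding centred_def by (simp add: prob_space)
  qed
  show "marginal_integral (centred x) = marginal_integral x"
    unfolding marginal_integral_def[of "centred x"] by (simp add: * cong: sum.cong_simp)
qed

text \<open>Nonnegativity of \<open>c + \<Sum> x\<close> gives
  \<open>\<bar>\<Sum> x\<bar> \<le> \<bar>c\<bar> + (c + \<Sum> x)\<close>, and the bracket
  integrates to at most the excess of the product plan over \<open>max_value\<close>, plus
  \<open>1\<close>. Averaging out the other coordinates isolates component \<open>t\<close> up to a
  constant.\<close>

lemma centred_bound:
  assumes x: "x \<in> potentials" "integrable_family x" and opt: "max_value - 1 \<le> - marginal_integral x"
    and t: "t \<le> T"
  shows "(\<integral>a. \<bar>centred x t a\<bar> \<partial>\<mu> t) \<le> 2 * ((\<integral>s. \<bar>c s\<bar> \<partial>\<P>) + ((\<integral>s. c s \<partial>\<P>) - (max_value - 1)))"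
proof -
  let ?n = "centred x" and ?C = "\<integral>s. \<bar>c s\<bar> \<partial>\<P>" and ?D = "(\<integral>s. c s \<partial>\<P>) - (max_value - 1)"
  note n = centred[OF x(2)]
  note w = weak_duality[OF x product_plan integrable_cost]
  have sep: "integrable \<P> (separable_sum T x)" using plan_integral[OF product_plan x(2)] by blast
  have "(\<integral>s. \<bar>separable_sum T x s\<bar> \<partial>\<P>) \<le> (\<integral>s. \<bar>c s\<bar> + (c s + separable_sum T x s) \<partial>\<P>)"
  proof (rule integral_mono_AE)
    show "integrable \<P> (\<lambda>s. \<bar>separable_sum T x s\<bar>)" using sep by simp
    show "integrable \<P> (\<lambda>s. \<bar>c s\<bar> + (c s + separable_sum T x s))" using w(1) integrable_cost by auto
    show "AE s in \<P>. \<bar>separable_sum T x s\<bar> \<le> \<bar>c s\<bar> + (c s + separable_sum T x s)"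
      using potential_AE[OF x(1) product_plan] by eventually_elim auto
  qed
  also have "\<dots> = ?C + ((\<integral>s. c s \<partial>\<P>) + marginal_integral x)"
    unfolding w(2)[symmetric] using w(1) integrable_cost by (intro Bochner_Integration.integral_add) auto
  also have "\<dots> \<le> ?C + ?D" using opt by simp
  finally have s: "(\<integral>s. \<bar>separable_sum T x s\<bar> \<partial>\<P>) \<le> ?C + ?D" .
  \<comment> \<open>Components other than \<open>0\<close> have mean zero, so \<open>k\<close> is
    \<open>0\<close> or \<open>marginal_integral x\<close>. Removing it costs the same bound once
    more, whence the factor \<open>2\<close>.\<close>
  define k where "k = (\<Sum>i\<in>{..T} - {t}. \<integral>y. ?n i y \<partial>\<mu> i)"
  have kle: "\<bar>k\<bar> \<le> \<bar>marginal_integral x\<bar>"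
  proof -
    have "k = (\<Sum>i\<in>{..T} - {t}. if i = 0 then marginal_integral x else 0)"
      unfolding k_def using n(3) by (intro sum.cong) auto
    then show ?thesis by simp
  qed
  have ml: "\<bar>marginal_integral x\<bar> \<le> (\<integral>s. \<bar>separable_sum T x s\<bar> \<partial>\<P>)"
    using integral_abs_bound[of \<P> "separable_sum T x"] marginal_integral_P[OF x(2)] by simp
  have "(\<integral>a. \<bar>?n t a + k\<bar> \<partial>\<mu> t) \<le> (\<integral>s. \<bar>\<Sum>i\<in>{..T}. ?n i (s i)\<bar> \<partial>\<P>)"
    unfolding k_def
    by (rule integral_abs_sum_PiM_ge) (use t prob_mu n(1) in auto)
  also have "\<dots> = (\<integral>s. \<bar>separable_sum T x s\<bar> \<partial>\<P>)"
    using n(2) by (simp add: separable_sum_def)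
  finally have 1: "(\<integral>a. \<bar>?n t a + k\<bar> \<partial>\<mu> t) \<le> (\<integral>s. \<bar>separable_sum T x s\<bar> \<partial>\<P>)" .
  interpret prob_space "\<mu> t" using prob_mu[OF t] .
  have ni: "integrable (\<mu> t) (?n t)" using n(1) t by blast
  have "(\<integral>a. \<bar>?n t a\<bar> \<partial>\<mu> t) \<le> (\<integral>a. \<bar>?n t a + k\<bar> + \<bar>k\<bar> \<partial>\<mu> t)"
    using ni by (intro integral_mono) auto
  also have "\<dots> = (\<integral>a. \<bar>?n t a + k\<bar> \<partial>\<mu> t) + \<bar>k\<bar>"
    using ni by (simp add: prob_space)
  also have "\<dots> \<le> (?C + ?D) + (?C + ?D)"
    by (rule add_mono[OF order_trans[OF 1 s] order_trans[OF kle order_trans[OF ml s]]])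
  also have "\<dots> = 2 * (?C + ?D)" by simp
  finally show ?thesis .
qed

theorem ex_optimal_potential:
  "\<exists>x. x \<in> potentials \<and> integrable_family x \<and> max_value \<le> - marginal_integral x"
proof -
  define B where "B = 2 * ((\<integral>s. \<bar>c s\<bar> \<partial>\<P>) + ((\<integral>s. c s \<partial>\<P>) - (max_value - 1)))"
  define J where "J = {..T} \<times> (UNIV :: bool set)"
  define M where "M = (\<lambda>j :: nat \<times> bool. \<mu> (fst j))"
  have Mt: "M (t, b) = \<mu> t" for t b by (simp add: M_def)
  define diff where "diff = (\<lambda>(g :: nat \<times> bool \<Rightarrow> 'a \<Rightarrow> real) t a. g (t, True) a - g (t, False) a)"
  define D where "D = (\<lambda>n :: nat. {g. (\<forall>j a. 0 \<le> g j a) \<and> (\<forall>j\<in>J. integrable (M j) (g j) \<and> (\<integral>a. g j a \<partial>M j) \<le> B) \<and>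
     diff g \<in> potentials \<and> max_value - 1 / real (Suc n) \<le> - marginal_integral (diff g)})"
  have diff_int: "integrable_family (diff g)" if "g \<in> D n" for g n
    using that unfolding D_def diff_def J_def M_def by fastforce
  have Dne: "D n \<noteq> {}" for n
  proof -
    obtain x where x: "x \<in> potentials" "integrable_family x" "max_value - 1 / real (Suc n) < - marginal_integral x"
      using max_value_less[of "1 / real (Suc n)"] by auto
    note nx = centred[OF x(2)]
    have "1 / real (Suc n) \<le> 1" by simp
    then have opt: "max_value - 1 \<le> - marginal_integral x" using x(3) by linarith
    define g where "g = (\<lambda>(t, b) a. if b then max 0 (centred x t a) else max 0 (- centred x t a))"
    have dg: "diff g = centred x" by (auto simp: diff_def g_def fun_eq_iff)
    have "centred x \<in> potentials"
    proof (rule potential_cong[OF x(1)])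
      show "centred x t \<in> borel_measurable (borel_of (S t))" if "t \<le> T" for t
        using nx(1) that borel_measurable_integrable measurable_mu[OF that] by blast
    qed (rule nx(2))
    moreover have "integrable (M j) (g j) \<and> (\<integral>a. g j a \<partial>M j) \<le> B" if "j \<in> J" for j
    proof -
      obtain t b where j: "j = (t, b)" "t \<le> T" using \<open>j \<in> J\<close> by (auto simp: J_def)
      have ni: "integrable (\<mu> t) (centred x t)" using nx(1) j by blast
      then have gi: "integrable (\<mu> t) (g j)" unfolding g_def j by (cases b) auto
      have "(\<integral>a. g j a \<partial>\<mu> t) \<le> (\<integral>a. \<bar>centred x t a\<bar> \<partial>\<mu> t)"
        using ni gi by (intro integral_mono) (auto simp: g_def j)
      also have "\<dots> \<le> B" unfolding B_def by (rule centred_bound[OF x(1,2) opt j(2)])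
      finally show ?thesis using gi j by (simp add: M_def)
    qed
    moreover have "0 \<le> g j a" for j a by (simp add: g_def split: prod.split)
    ultimately have "g \<in> D n" unfolding D_def mem_Collect_eq dg nx(4) using x(3) by auto
    then show ?thesis by blast
  qed
  have Ddec: "D (Suc n) \<subseteq> D n" for n
  proof
    fix g assume g: "g \<in> D (Suc n)"
    have "1 / real (Suc (Suc n)) \<le> 1 / real (Suc n)" by (simp add: frac_le)
    then show "g \<in> D n" using g unfolding D_def by auto
  qed
  have Dmid: "(\<lambda>j x. (g j x + h j x) / 2) \<in> D n" if g: "g \<in> D n" and h: "h \<in> D n" for g h n
  proof -
    let ?m = "\<lambda>j x. (g j x + h j x) / 2"
    have dm: "diff ?m = (\<lambda>t a. (1/2) * (diff g t a + diff h t a))"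
      by (simp add: diff_def fun_eq_iff add_divide_distrib diff_divide_distrib)
    have sm: "separable_sum T (diff ?m) s = (separable_sum T (diff g) s + separable_sum T (diff h) s) / 2" for s
      unfolding dm separable_sum_mult separable_sum_add by simp
    have mm: "marginal_integral (diff ?m) = (marginal_integral (diff g) + marginal_integral (diff h)) / 2"
      unfolding dm marginal_integral_mult marginal_integral_add[OF diff_int[OF g] diff_int[OF h]] by simp
    have gp: "diff g \<in> potentials" and hp: "diff h \<in> potentials" using g h by (auto simp: D_def)
    obtain A where A: "\<forall>t\<le>T. A t \<in> sets (borel_of (S t)) \<and> measure (\<mu> t) (A t) = 1"
      "\<forall>s \<in> (\<Pi>\<^sub>E t\<in>{..T}. A t). - separable_sum T (diff g) s \<le> c s"
      using gp unfolding dual_potentials_def by blast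
    obtain A' where A': "\<forall>t\<le>T. A' t \<in> sets (borel_of (S t)) \<and> measure (\<mu> t) (A' t) = 1"
      "\<forall>s \<in> (\<Pi>\<^sub>E t\<in>{..T}. A' t). - separable_sum T (diff h) s \<le> c s"
      using hp unfolding dual_potentials_def by blast
    \<comment> \<open>Two constraints, each valid on a product of full sets, hold together on the
      product of the intersections, which are full again.\<close>
    have "diff ?m \<in> potentials"
      unfolding dual_potentials_def
    proof (intro CollectI conjI exI[of _ "\<lambda>t. A t \<inter> A' t"] allI impI ballI)
      fix t assume t: "t \<le> T"
      show "diff ?m t \<in> borel_measurable (borel_of (S t))"
        using potential_measurable[OF gp t] potential_measurable[OF hp t] unfolding dm by simp
      interpret prob_space "\<mu> t" using prob_mu[OF t] .
      show "A t \<inter> A' t \<in> sets (borel_of (S t))" using A A' t by auto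
      have "AE a in \<mu> t. a \<in> A t" "AE a in \<mu> t. a \<in> A' t"
        using A A' t sets_mu[OF t] AE_in_set_eq_1 by blast+
      then have "AE a in \<mu> t. a \<in> A t \<inter> A' t" by eventually_elim auto
      then show "measure (\<mu> t) (A t \<inter> A' t) = 1"
        using A A' t sets_mu[OF t] by (subst (asm) AE_in_set_eq_1) auto
    next
      fix s assume s: "s \<in> (\<Pi>\<^sub>E t\<in>{..T}. A t \<inter> A' t)"
      then have "s \<in> (\<Pi>\<^sub>E t\<in>{..T}. A t)" "s \<in> (\<Pi>\<^sub>E t\<in>{..T}. A' t)" by (auto simp: PiE_iff)
      then have "- separable_sum T (diff g) s \<le> c s" "- separable_sum T (diff h) s \<le> c s"
        using A(2) A'(2) by blast+
      then show "- separable_sum T (diff ?m) s \<le> c s" unfolding sm by (simp add: field_simps)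
    qed
    moreover have "max_value - 1 / real (Suc n) \<le> - marginal_integral (diff ?m)"
      using g h unfolding mm D_def by (simp add: field_simps)
    moreover have "integrable (M j) (?m j) \<and> (\<integral>a. ?m j a \<partial>M j) \<le> B" if "j \<in> J" for j
    proof -
      have "integrable (M j) (g j)" "(\<integral>a. g j a \<partial>M j) \<le> B" "integrable (M j) (h j)" "(\<integral>a. h j a \<partial>M j) \<le> B"
        using g h that unfolding D_def by blast+
      then show ?thesis by simp
    qed
    ultimately show ?thesis using g h unfolding D_def by auto
  qed
  obtain g where g: "\<And>n. g n \<in> D n" "\<And>j. j \<in> J \<Longrightarrow> AE x in M j. convergent (\<lambda>n. g n j x)"
  proof (rule midpoint_closed_AE_convergent[of J M D B])
    show "finite_measure (M j)" if "j \<in> J" for j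
      using that prob_mu by (auto simp: J_def M_def prob_space_def)
  qed (use Dne Ddec Dmid in \<open>auto simp: D_def J_def\<close>)
  define y where "y = (\<lambda>n. diff (g n))"
  have yp: "y n \<in> potentials" and yi: "integrable_family (y n)"
    and yv: "max_value - 1 / real (Suc n) \<le> - marginal_integral (y n)" for n
    using g(1)[of n] diff_int[OF g(1)[of n]] by (auto simp: D_def y_def)
  have "\<exists>A. (\<forall>t\<le>T. A t \<in> sets (borel_of (S t)) \<and> measure (\<mu> t) (A t) = 1) \<and>
      (\<forall>s \<in> (\<Pi>\<^sub>E t\<in>{..T}. A t). - separable_sum T (y n) s \<le> c s)" for n
    using yp[of n] unfolding dual_potentials_def by blast
  then obtain A where A: "\<And>n t. t \<le> T \<Longrightarrow> A n t \<in> sets (borel_of (S t)) \<and> measure (\<mu> t) (A n t) = 1"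
    "\<And>n s. s \<in> (\<Pi>\<^sub>E t\<in>{..T}. A n t) \<Longrightarrow> - separable_sum T (y n) s \<le> c s" by metis
  define E where "E = (\<lambda>t. {a \<in> topspace (S t). convergent (\<lambda>n. y n t a)})"
  \<comment> \<open>On the product of the \<open>Z t\<close> all countably many constraints hold and
    every coordinate converges, so the limit satisfies the constraint in the product sense. Outside,
    \<open>lim\<close> takes some value that still leaves \<open>x t\<close> measurable.\<close>
  define Z where "Z = (\<lambda>t. E t \<inter> (\<Inter>n. A n t))"
  define x where "x = (\<lambda>t a. lim (\<lambda>n. y n t a))"
  have ym: "y n t \<in> borel_measurable (borel_of (S t))" if "t \<le> T" for n t
    using potential_measurable[OF yp that] .
  have Es: "E t \<in> sets (borel_of (S t))" if t: "t \<le> T" for t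
    using sets_Collect_Cauchy[of "\<lambda>n. y n t" "borel_of (S t)"] ym[OF t]
    unfolding E_def Cauchy_convergent_iff[symmetric] by simp
  have Zs: "Z t \<in> sets (borel_of (S t))" if t: "t \<le> T" for t
    unfolding Z_def using Es[OF t] A(1)[OF t] by (intro sets.Int sets.countable_INT) auto
  have ZAE: "AE a in \<mu> t. a \<in> Z t" if t: "t \<le> T" for t
  proof -
    interpret prob_space "\<mu> t" using prob_mu[OF t] .
    have "AE a in \<mu> t. \<forall>n. a \<in> A n t"
      unfolding AE_all_countable using A(1)[OF t] sets_mu[OF t] AE_in_set_eq_1 by blast
    moreover have "AE a in \<mu> t. convergent (\<lambda>n. g n (t, b) a)" for b
      using g(2)[of "(t, b)"] t unfolding Mt by (simp add: J_def)
    note this[of True] this[of False]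
    moreover note AE_space
    ultimately show ?thesis
      by eventually_elim
        (auto simp: Z_def E_def y_def diff_def space_mu[OF t] intro: convergent_diff)
  qed
  have xl: "(\<lambda>n. y n t a) \<longlonglongrightarrow> x t a" if "a \<in> Z t" for t a
    using that unfolding x_def Z_def E_def by (simp add: convergent_LIMSEQ_iff)
  have sl: "(\<lambda>n. separable_sum T (y n) s) \<longlonglongrightarrow> separable_sum T x s" if "s \<in> (\<Pi>\<^sub>E t\<in>{..T}. Z t)" for s
    unfolding separable_sum_def by (intro tendsto_sum xl) (use that in \<open>auto simp: PiE_iff\<close>)
  have xp: "x \<in> potentials"
    unfolding dual_potentials_def
  proof (intro CollectI conjI exI[of _ Z] allI impI ballI)
    fix t assume t: "t \<le> T"
    interpret prob_space "\<mu> t" using prob_mu[OF t] .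
    show "x t \<in> borel_measurable (borel_of (S t))"
      unfolding x_def using ym[OF t] by (intro borel_measurable_lim_metric)
    show "Z t \<in> sets (borel_of (S t))" by (rule Zs[OF t])
    show "measure (\<mu> t) (Z t) = 1"
      using ZAE[OF t] Zs[OF t] sets_mu[OF t] by (subst (asm) AE_in_set_eq_1) auto
  next
    fix s assume s: "s \<in> (\<Pi>\<^sub>E t\<in>{..T}. Z t)"
    have "- separable_sum T (y n) s \<le> c s" for n
      by (rule A(2)) (use s in \<open>auto simp: Z_def PiE_iff\<close>)
    then show "- separable_sum T x s \<le> c s"
      using LIMSEQ_le_const2[OF tendsto_minus[OF sl[OF s]]] by blast
  qed
  have lim: "AE s in \<P>. (\<lambda>n. c s + separable_sum T (y n) s) \<longlonglongrightarrow> c s + separable_sum T x s"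
  proof -
    have "AE s in \<P>. s \<in> (\<Pi>\<^sub>E t\<in>{..T}. Z t)"
    proof (rule AE_plan_full_product[OF product_plan])
      fix t assume t: "t \<le> T"
      interpret prob_space "\<mu> t" using prob_mu[OF t] .
      show "Z t \<in> sets (borel_of (S t)) \<and> measure (\<mu> t) (Z t) = 1"
        using ZAE[OF t] Zs[OF t] sets_mu[OF t] by (subst (asm) AE_in_set_eq_1) auto
    qed
    then show ?thesis by eventually_elim (intro tendsto_add tendsto_const sl)
  qed
  \<comment> \<open>The nonnegative functions \<open>c + \<Sum> y n\<close> have integrals
    \<open>C + marginal_integral (y n)\<close> under the product plan, at most
    \<open>C - max_value + 1 / real (Suc n)\<close>; Fatou's lemma passes this bound to the
    limit.\<close>
  define C where "C = (\<integral>s. c s \<partial>\<P>)"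
  have wd: "integrable \<P> (\<lambda>s. c s + separable_sum T (y n) s)"
    "(\<integral>s. c s + separable_sum T (y n) s \<partial>\<P>) = C + marginal_integral (y n)" for n
    using weak_duality[OF yp yi product_plan integrable_cost] by (auto simp: C_def)
  have cm: "(\<lambda>s. c s + separable_sum T x s) \<in> borel_measurable \<P>"
    using cost_measurable separable_sum_measurable[of x] potential_measurable[OF xp]
      plan_measurable[OF product_plan, of "borel :: real measure"] by (auto intro!: borel_measurable_add)
  have "(\<integral>\<^sup>+s. ennreal (c s + separable_sum T x s) \<partial>\<P>) =
      (\<integral>\<^sup>+s. liminf (\<lambda>n. ennreal (c s + separable_sum T (y n) s)) \<partial>\<P>)"
    using lim by (intro nn_integral_cong_AE)
      (auto elim!: eventually_mono intro!: lim_imp_Liminf[symmetric] tendsto_ennrealI)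
  also have "\<dots> \<le> liminf (\<lambda>n. \<integral>\<^sup>+s. ennreal (c s + separable_sum T (y n) s) \<partial>\<P>)"
    using wd(1) by (intro nn_integral_liminf) auto
  also have "\<dots> = liminf (\<lambda>n. ennreal (C + marginal_integral (y n)))"
    using wd potential_AE[OF yp product_plan] by (simp add: nn_integral_eq_integral)
  also have "\<dots> \<le> liminf (\<lambda>n. ennreal (C - max_value + 1 / real (Suc n)))"
    using yv by (intro Liminf_mono always_eventually allI ennreal_leI) (smt (verit))
  also have "\<dots> = ennreal (C - max_value)"
  proof (intro lim_imp_Liminf tendsto_ennrealI)
    show "(\<lambda>n. C - max_value + 1 / real (Suc n)) \<longlonglongrightarrow> C - max_value"
      using tendsto_add[OF tendsto_const LIMSEQ_inverse_real_of_nat, of "C - max_value"]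
      by (simp add: inverse_eq_divide)
  qed simp
  finally have le: "(\<integral>\<^sup>+s. ennreal (c s + separable_sum T x s) \<partial>\<P>) \<le> ennreal (C - max_value)" .
  have int: "integrable \<P> (\<lambda>s. c s + separable_sum T x s)"
    by (rule integrableI_nonneg[OF cm potential_AE[OF xp product_plan]])
      (rule le_less_trans[OF le], simp)
  then have "integrable \<P> (\<lambda>s. (c s + separable_sum T x s) - c s)"
    using integrable_cost by (rule Bochner_Integration.integrable_diff)
  \<comment> \<open>No component was bounded separately in the limit; integrability comes from the
    whole sum and is then split by the product structure.\<close>
  then have sint: "integrable \<P> (\<lambda>s. \<Sum>t\<in>{..T}. x t (s t))" by (simp add: separable_sum_def)
  have xi: "integrable_family x"
    using PiM_sum_integrableD[OF finite_atMost _ _ sint] prob_mu by auto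
  \<comment> \<open>Without this, \<open>ennreal (C - max_value)\<close> might be a truncated
    negative number and the bound could not be read in the reals.\<close>
  have "max_value \<le> C"
  proof (rule field_le_epsilon)
    fix e :: real assume "0 < e"
    then obtain z where z: "z \<in> potentials" "integrable_family z" "max_value - e < - marginal_integral z"
      using max_value_less by blast
    show "max_value \<le> C + e"
      using weak_duality(3)[OF z(1,2) product_plan integrable_cost] z(3) by (simp add: C_def)
  qed
  moreover have "ennreal (C + marginal_integral x) \<le> ennreal (C - max_value)"
    using le nn_integral_eq_integral[OF int potential_AE[OF xp product_plan]]
      weak_duality(2)[OF xp xi product_plan integrable_cost] by (simp add: C_def)
  ultimately have "max_value \<le> - marginal_integral x" by (simp add: ennreal_le_iff)
  then show ?thesis using xp xi by blast
qed

end

section \<open>Duality\<close>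

lemma ext_integral_integrable:
  assumes "integrable M f" shows "ext_integral M f = ereal (\<integral>s. f s \<partial>M)"
proof -
  have p: "integrable M (\<lambda>s. max 0 (f s))" and n: "integrable M (\<lambda>s. max 0 (- f s))"
    using assms by auto
  have "(\<integral>\<^sup>+s. ennreal (- f s) \<partial>M) = (\<integral>\<^sup>+s. ennreal (max 0 (- f s)) \<partial>M)"
    by (intro nn_integral_cong) (simp add: max_def ennreal_neg)
  also have "\<dots> = ennreal (\<integral>s. max 0 (- f s) \<partial>M)"
    using n by (intro nn_integral_eq_integral) auto
  finally have "ext_integral M f = ereal (\<integral>s. max 0 (f s) \<partial>M) - ereal (\<integral>s. max 0 (- f s) \<partial>M)"
    using p by (simp add: ext_integral_def)
  also have "\<dots> = ereal (\<integral>s. max 0 (f s) - max 0 (- f s) \<partial>M)"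
    using p n by simp
  also have "(\<lambda>s. max 0 (f s) - max 0 (- f s)) = f" by (auto simp: max_def)
  finally show ?thesis .
qed

text \<open>A value of \<open>ext_integral\<close> below infinity controls the positive part only
  and still permits minus infinity; the integrable minorant controls the negative part.\<close>

lemma integrable_of_ext_integral_finite:
  assumes "ext_integral M f < \<infinity>" "f \<in> borel_measurable M" "integrable M g" "AE s in M. g s \<le> f s"
  shows "integrable M f"
proof -
  have "integrable M (\<lambda>s. max 0 (f s))"
    using assms(1) by (auto simp: ext_integral_def split: if_splits)
  then have "integrable M (\<lambda>s. max 0 (f s) + \<bar>g s\<bar>)" using assms(3) by auto
  then show ?thesis
    by (rule Bochner_Integration.integrable_bound) (use assms(2,4) in \<open>auto elim!: eventually_mono\<close>)
qed

text \<open>Once some \<open>z\<close> attains a lower bound, optimality is a statement about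
  values; both problems are thereby compared with \<open>max_value\<close>.\<close>

lemma optimal_iff_value:
  assumes "\<And>y. y \<in> C \<Longrightarrow> v \<le> f y" "z \<in> C" "f z \<le> v"
  shows "optimal f C x \<longleftrightarrow> x \<in> C \<and> f x = v"
proof
  assume "optimal f C x"
  then have x: "x \<in> C" "\<not> f z < f x" using assms(2) by (auto simp: optimal_def is_arg_min_def)
  then show "x \<in> C \<and> f x = v" using assms(1)[OF x(1)] assms(3) by simp
next
  assume "x \<in> C \<and> f x = v"
  then show "optimal f C x" using assms(1) by (auto simp: optimal_def is_arg_min_def not_less)
qed

context transport_problem
begin

text \<open>The constraint makes \<open>- c\<close> an integrable minorant of the separable sum, and
  the product measure then separates the components.\<close>

lemma potential_finite_cost:
  assumes "x \<in> potentials" "dual_cost T \<mu> x < \<infinity>"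
  shows "integrable_family x" "dual_cost T \<mu> x = ereal (marginal_integral x)"
proof -
  have "integrable \<P> (separable_sum T x)"
  proof (rule integrable_of_ext_integral_finite)
    show "ext_integral \<P> (separable_sum T x) < \<infinity>" using assms(2) by (simp add: dual_cost_def)
    show "separable_sum T x \<in> borel_measurable \<P>"
      using separable_sum_measurable[of x] potential_measurable[OF assms(1)]
        plan_measurable[OF product_plan, of "borel :: real measure"] by simp
    show "integrable \<P> (\<lambda>s. - c s)" using integrable_cost by simp
    show "AE s in \<P>. - c s \<le> separable_sum T x s"
      using potential_AE[OF assms(1) product_plan] by eventually_elim simp
  qed
  then have "integrable \<P> (\<lambda>s. \<Sum>t\<in>{..T}. x t (s t))" by (simp add: separable_sum_def[abs_def])
  then show xi: "integrable_family x"
    using PiM_sum_integrableD[OF finite_atMost, of _ T \<mu> x] prob_mu by auto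
  show "dual_cost T \<mu> x = ereal (marginal_integral x)"
    unfolding dual_cost_def using plan_integral[OF product_plan xi] by (simp add: ext_integral_integrable)
qed

text \<open>The minorant is the weighted sum \<open>K * separable_sum T \<psi>\<close>, integrable
  under every plan because of the marginals.\<close>

lemma plan_finite_cost:
  assumes "\<nu> \<in> plans" "primal_cost c \<nu> < \<infinity>"
  shows "integrable \<nu> c" "primal_cost c \<nu> = ereal (\<integral>s. c s \<partial>\<nu>)"
proof -
  show i: "integrable \<nu> c"
  proof (rule integrable_of_ext_integral_finite)
    show "ext_integral \<nu> c < \<infinity>" using assms(2) by (simp add: primal_cost_def)
    show "c \<in> borel_measurable \<nu>"
      using cost_measurable plan_measurable[OF assms(1), of "borel :: real measure"] by simp
    show "integrable \<nu> (\<lambda>s. K * separable_sum T \<psi> s)"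
      using plan_integral(1)[OF assms(1)] integrable_weight by simp
    show "AE s in \<nu>. K * separable_sum T \<psi> s \<le> c s"
      using planD(2)[OF assms(1)] cost_ge by (intro AE_I2) blast
  qed
  show "primal_cost c \<nu> = ereal (\<integral>s. c s \<partial>\<nu>)"
    using i by (simp add: primal_cost_def ext_integral_integrable)
qed

lemma dual_cost_ge: "x \<in> potentials \<Longrightarrow> ereal (- max_value) \<le> dual_cost T \<mu> x"
  using potential_finite_cost[of x] le_max_value[of x]
  by (cases "dual_cost T \<mu> x < \<infinity>") (auto simp: minus_le_iff)

lemma primal_cost_ge:
  assumes "\<nu> \<in> plans" shows "ereal max_value \<le> primal_cost c \<nu>"
proof (cases "primal_cost c \<nu> < \<infinity>")
  case True
  obtain x where x: "x \<in> potentials" "integrable_family x" "max_value \<le> - marginal_integral x"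
    using ex_optimal_potential by blast
  show ?thesis
    using weak_duality(3)[OF x(1,2) assms plan_finite_cost(1)[OF assms True]]
      plan_finite_cost(2)[OF assms True] x(3) by simp
qed simp

lemma optimal_primal_iff: "optimal (primal_cost c) plans \<nu> \<longleftrightarrow> \<nu> \<in> plans \<and> primal_cost c \<nu> = ereal max_value"
proof -
  obtain \<nu>' where \<nu>': "\<nu>' \<in> plans" "integrable \<nu>' c" "(\<integral>s. c s \<partial>\<nu>') \<le> max_value"
    using ex_optimal_plan by blast
  then have "primal_cost c \<nu>' \<le> ereal max_value"
    by (simp add: primal_cost_def ext_integral_integrable)
  then show ?thesis
    by (rule optimal_iff_value[OF _ \<nu>'(1), rotated]) (rule primal_cost_ge)
qed

lemma optimal_dual_iff:
  "optimal (dual_cost T \<mu>) potentials x \<longleftrightarrow> x \<in> potentials \<and> dual_cost T \<mu> x = ereal (- max_value)"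
proof -
  obtain x' where x': "x' \<in> potentials" "integrable_family x'" "max_value \<le> - marginal_integral x'"
    using ex_optimal_potential by blast
  then have "dual_cost T \<mu> x' \<le> ereal (- max_value)"
    unfolding dual_cost_def using plan_integral[OF product_plan x'(2)] by (simp add: ext_integral_integrable)
  then show ?thesis
    by (rule optimal_iff_value[OF _ x'(1), rotated]) (rule dual_cost_ge)
qed

lemma ex_optimal:
  "\<exists>\<nu>. optimal (primal_cost c) plans \<nu>" "\<exists>x. optimal (dual_cost T \<mu>) potentials x"
proof -
  obtain \<nu> where \<nu>: "\<nu> \<in> plans" "integrable \<nu> c" "(\<integral>s. c s \<partial>\<nu>) \<le> max_value"
    using ex_optimal_plan by blast
  then have "primal_cost c \<nu> = ereal max_value"
    using primal_cost_ge[OF \<nu>(1)] by (simp add: primal_cost_def ext_integral_integrable)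
  then show "\<exists>\<nu>. optimal (primal_cost c) plans \<nu>" using \<nu>(1) optimal_primal_iff by blast
  obtain x where x: "x \<in> potentials" "integrable_family x" "max_value \<le> - marginal_integral x"
    using ex_optimal_potential by blast
  have "dual_cost T \<mu> x = ereal (marginal_integral x)"
    unfolding dual_cost_def using plan_integral[OF product_plan x(2)] by (simp add: ext_integral_integrable)
  then have "dual_cost T \<mu> x = ereal (- max_value)"
    using dual_cost_ge[OF x(1)] x(3) by simp
  then show "\<exists>x. optimal (dual_cost T \<mu>) potentials x" using x(1) optimal_dual_iff by blast
qed

lemma no_duality_gap:
  "(INF x\<in>potentials. dual_cost T \<mu> x) = - (INF \<nu>\<in>plans. primal_cost c \<nu>)"
proof -
  obtain \<nu> x where o: "\<nu> \<in> plans" "primal_cost c \<nu> = ereal max_value"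
    "x \<in> potentials" "dual_cost T \<mu> x = ereal (- max_value)"
    using ex_optimal optimal_primal_iff optimal_dual_iff by blast
  have "(INF \<nu>\<in>plans. primal_cost c \<nu>) = ereal max_value"
    by (rule antisym[OF INF_lower2[OF o(1)] INF_greatest]) (use o(2) primal_cost_ge in auto)
  moreover have "(INF x\<in>potentials. dual_cost T \<mu> x) = ereal (- max_value)"
    by (rule antisym[OF INF_lower2[OF o(3)] INF_greatest]) (use o(4) dual_cost_ge in auto)
  ultimately show ?thesis by simp
qed

text \<open>The integral of \<open>c + \<Sum> x\<close> is the sum of the two objective values,
  which are at least \<open>max_value\<close> and \<open>- max_value\<close>. These bounds cancel,
  so the sum vanishes exactly when both are attained.\<close>

lemma complementary_slackness:
  assumes "feasible (primal_cost c) plans \<nu>" "feasible (dual_cost T \<mu>) potentials x"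
  shows "optimal (primal_cost c) plans \<nu> \<and> optimal (dual_cost T \<mu>) potentials x \<longleftrightarrow>
    ext_integral \<nu> (\<lambda>s. c s + separable_sum T x s) = 0"
proof -
  have \<nu>: "\<nu> \<in> plans" "primal_cost c \<nu> < \<infinity>" and x: "x \<in> potentials" "dual_cost T \<mu> x < \<infinity>"
    using assms by (auto simp: feasible_def)
  note pv = plan_finite_cost[OF \<nu>] and dv = potential_finite_cost[OF x]
  note wd = weak_duality[OF x(1) dv(1) \<nu>(1) pv(1)]
  have "max_value \<le> (\<integral>s. c s \<partial>\<nu>)" using primal_cost_ge[OF \<nu>(1)] pv(2) by simp
  moreover have "- max_value \<le> marginal_integral x" using dual_cost_ge[OF x(1)] dv(2) by simp
  moreover have "ext_integral \<nu> (\<lambda>s. c s + separable_sum T x s) = ereal ((\<integral>s. c s \<partial>\<nu>) + marginal_integral x)"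
    using ext_integral_integrable[OF wd(1)] wd(2) by simp
  ultimately show ?thesis
    unfolding optimal_primal_iff optimal_dual_iff using \<nu>(1) x(1) pv(2) dv(2) by auto
qed

end

theorem theorem20:
  fixes T :: nat
    and S :: "nat \<Rightarrow> 'a topology"
    and \<psi> :: "nat \<Rightarrow> 'a \<Rightarrow> real"
    and \<mu> :: "nat \<Rightarrow> 'a measure"
    and c :: "(nat \<Rightarrow> 'a) \<Rightarrow> real"
    and K :: real
  assumes "\<And>t. t \<le> T \<Longrightarrow> Polish_space (S t)"
    and "\<And>t. t \<le> T \<Longrightarrow> continuous_map (S t) euclideanreal (\<psi> t)"
    and "\<And>t s. t \<le> T \<Longrightarrow> s \<in> topspace (S t) \<Longrightarrow> 1 \<le> \<psi> t s"
    and "\<And>t. t \<le> T \<Longrightarrow> \<mu> t \<in> weighted_measures (S t) (\<psi> t)"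
    and "\<And>t. t \<le> T \<Longrightarrow> prob_space (\<mu> t)"
    and "lower_semicontinuous_map (prod_space T S) c"
    and "integrable (Pi\<^sub>M {..T} \<mu>) c"
    and "\<And>s. s \<in> topspace (prod_space T S) \<Longrightarrow> K * separable_sum T \<psi> s \<le> c s"
  shows "(\<exists>\<nu>. optimal (primal_cost c) (transport_plans T S \<psi> \<mu>) \<nu>) \<and>
         (\<exists>x. optimal (dual_cost T \<mu>) (dual_potentials T S \<mu> c) x) \<and>
         (INF x\<in>dual_potentials T S \<mu> c. dual_cost T \<mu> x) = - (INF \<nu>\<in>transport_plans T S \<psi> \<mu>. primal_cost c \<nu>) \<and>
         (\<forall>\<nu> x. feasible (primal_cost c) (transport_plans T S \<psi> \<mu>) \<nu> \<longrightarrow> feasible (dual_cost T \<mu>) (dual_potentials T S \<mu> c) x \<longrightarrow>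
            (optimal (primal_cost c) (transport_plans T S \<psi> \<mu>) \<nu> \<and> optimal (dual_cost T \<mu>) (dual_potentials T S \<mu> c) x \<longleftrightarrow>
             ext_integral \<nu> (\<lambda>s. c s + separable_sum T x s) = 0)) \<and>
         (\<forall>x. feasible (dual_cost T \<mu>) (dual_potentials T S \<mu> c) x \<longrightarrow>
            (\<forall>t\<le>T. integrable (\<mu> t) (x t)) \<and>
            dual_cost T \<mu> x = ereal (\<Sum>t\<le>T. \<integral>s. x t s \<partial>\<mu> t))"
proof -
  interpret transport_problem T S \<psi> \<mu> c K
    by (rule transport_problem.intro) (fact assms)+
  have dual: "t \<le> T \<Longrightarrow> integrable (\<mu> t) (x t)" "dual_cost T \<mu> x = ereal (\<Sum>t\<le>T. \<integral>s. x t s \<partial>\<mu> t)"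
    if "feasible (dual_cost T \<mu>) (dual_potentials T S \<mu> c) x" for t x
    using that potential_finite_cost[of x] by (auto simp: feasible_def marginal_integral_def)
  show ?thesis
    by (intro conjI allI impI)
      (rule ex_optimal no_duality_gap complementary_slackness dual; assumption)+
qed

end
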